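(* Let $\mathcal{A}$ be an essentially small additive category, $S$ a set of morphisms of $\mathcal{A}$, $\mathcal{C}=K^b(\mathcal{A})$, and let $\mathcal{D}\subset\mathcal{C}$ be the triangulated subcategory generated by the cones of elements of $S$. Let $A,A'$ be objects of $\mathcal{A}$. Then any $f\in(\mathcal{C}/\mathcal{D})(A,A')$ can be presented as a composition $g\circ s^{-1}\circ i$ (in $\mathcal{C}/\mathcal{D}$), where $A'',T$ are objects of $\mathcal{A}$, $g\in\mathcal{A}(A'',A')$, $s\in\mathcal{A}(A'',A\oplus T)$, $i\in\mathcal{A}(A,A\oplus T)$ is the canonical coretraction (inclusion of the summand), and $\operatorname{Cone}(s)$ is an object of $\mathcal{D}$.
   Context: $K^b(\mathcal{A})$ is the homotopy category of bounded complexes over $\mathcal{A}$; $\mathcal{A}$ is embedded in it as complexes concentrated in degree $0$. The cone of a morphism $s:X\to Y$ of $\mathcal{A}$ is the complex $X\xrightarrow{s}Y$ with $Y$ in degree $0$. The triangulated subcategory generated by a class of objects is the smallest full strict triangulated subcategory containing it. $\mathcal{C}/\mathcal{D}$ is the Verdier quotient; for a category $C$, $C(X,Y)$ denotes the set of morphisms from $X$ to $Y$. *)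

theory Defs
  imports Main "HOL-Algebra.Group"
begin

section \<open>Categories\<close>

record ('o, 'a) category =
  Ob :: "'o set"
  Arr :: "'a set"
  Dom :: "'a \<Rightarrow> 'o"
  Cod :: "'a \<Rightarrow> 'o"
  Id :: "'o \<Rightarrow> 'a"
  Comp :: "'a \<Rightarrow> 'a \<Rightarrow> 'a"  (infixr "\<cdot>\<index>" 70)

text \<open>As usual, \<open>g \<cdot> f\<close> is \<open>g\<close> after \<open>f\<close>. It is only meaningful if the codomain of \<open>f\<close> is the
  domain of \<open>g\<close>.\<close>

definition Hom :: "('o, 'a, 'm) category_scheme \<Rightarrow> 'o \<Rightarrow> 'o \<Rightarrow> 'a set" where
  "Hom C X Y = {f \<in> Arr C. Dom C f = X \<and> Cod C f = Y}"

locale category =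
  fixes C :: "('o, 'a, 'm) category_scheme" (structure)
  assumes dom_ob: "f \<in> Arr C \<Longrightarrow> Dom C f \<in> Ob C"
    and cod_ob: "f \<in> Arr C \<Longrightarrow> Cod C f \<in> Ob C"
    and id_hom: "X \<in> Ob C \<Longrightarrow> Id C X \<in> Hom C X X"
    and comp_hom: "\<lbrakk>f \<in> Hom C X Y; g \<in> Hom C Y Z\<rbrakk> \<Longrightarrow> g \<cdot> f \<in> Hom C X Z"
    and id_left: "f \<in> Hom C X Y \<Longrightarrow> Id C Y \<cdot> f = f"
    and id_right: "f \<in> Hom C X Y \<Longrightarrow> f \<cdot> Id C X = f"
    and comp_assoc:
      "\<lbrakk>f \<in> Hom C W X; g \<in> Hom C X Y; h \<in> Hom C Y Z\<rbrakk> \<Longrightarrow> h \<cdot> (g \<cdot> f) = (h \<cdot> g) \<cdot> f"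

definition inverse_arrows :: "('o, 'a, 'm) category_scheme \<Rightarrow> 'a \<Rightarrow> 'a \<Rightarrow> bool" where
  "inverse_arrows C f g \<longleftrightarrow> f \<in> Arr C \<and> g \<in> Hom C (Cod C f) (Dom C f)
     \<and> g \<cdot>\<^bsub>C\<^esub> f = Id C (Dom C f) \<and> f \<cdot>\<^bsub>C\<^esub> g = Id C (Cod C f)"

definition iso_arrow :: "('o, 'a, 'm) category_scheme \<Rightarrow> 'a \<Rightarrow> bool" where
  "iso_arrow C f \<longleftrightarrow> (\<exists>g. inverse_arrows C f g)"

definition isomorphic :: "('o, 'a, 'm) category_scheme \<Rightarrow> 'o \<Rightarrow> 'o \<Rightarrow> bool" where
  "isomorphic C X Y \<longleftrightarrow> (\<exists>f \<in> Hom C X Y. iso_arrow C f)"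

definition zero_object :: "('o, 'a, 'm) category_scheme \<Rightarrow> 'o \<Rightarrow> bool" where
  "zero_object C Z \<longleftrightarrow> Z \<in> Ob C
     \<and> (\<forall>X \<in> Ob C. (\<exists>!f. f \<in> Hom C X Z) \<and> (\<exists>!f. f \<in> Hom C Z X))"


section \<open>Additive categories\<close>

record ('o, 'a) preadditive_category = "('o, 'a) category" +
  Zero :: "'o \<Rightarrow> 'o \<Rightarrow> 'a"
  Add :: "'a \<Rightarrow> 'a \<Rightarrow> 'a"  (infixl "\<boxplus>\<index>" 65)

definition hom_group ::
    "('o, 'a, 'm) preadditive_category_scheme \<Rightarrow> 'o \<Rightarrow> 'o \<Rightarrow> 'a monoid" where
  "hom_group A X Y = \<lparr>carrier = Hom A X Y, mult = Add A, one = Zero A X Y\<rparr>"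

definition Neg :: "('o, 'a, 'm) preadditive_category_scheme \<Rightarrow> 'a \<Rightarrow> 'a" where
  "Neg A f = inv\<^bsub>hom_group A (Dom A f) (Cod A f)\<^esub> f"

locale preadditive_category = category A
  for A :: "('o, 'a, 'm) preadditive_category_scheme" (structure) +
  assumes hom_comm_group: "\<lbrakk>X \<in> Ob A; Y \<in> Ob A\<rbrakk> \<Longrightarrow> comm_group (hom_group A X Y)"
    and add_comp_left:
      "\<lbrakk>f \<in> Hom A X Y; g \<in> Hom A Y Z; h \<in> Hom A Y Z\<rbrakk> \<Longrightarrow> (g \<boxplus> h) \<cdot> f = (g \<cdot> f) \<boxplus> (h \<cdot> f)"
    and add_comp_right:
      "\<lbrakk>f \<in> Hom A X Y; g \<in> Hom A X Y; h \<in> Hom A Y Z\<rbrakk> \<Longrightarrow> h \<cdot> (f \<boxplus> g) = (h \<cdot> f) \<boxplus> (h \<cdot> g)"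

record ('o, 'a) biproduct =
  bp_ob :: 'o
  bp_in1 :: 'a
  bp_in2 :: 'a
  bp_pr1 :: 'a
  bp_pr2 :: 'a

definition is_biproduct ::
    "('o, 'a, 'm) preadditive_category_scheme \<Rightarrow> 'o \<Rightarrow> 'o \<Rightarrow> ('o, 'a) biproduct \<Rightarrow> bool" where
  "is_biproduct A X Y B \<longleftrightarrow> bp_ob B \<in> Ob A
     \<and> bp_in1 B \<in> Hom A X (bp_ob B) \<and> bp_in2 B \<in> Hom A Y (bp_ob B)
     \<and> bp_pr1 B \<in> Hom A (bp_ob B) X \<and> bp_pr2 B \<in> Hom A (bp_ob B) Y
     \<and> bp_pr1 B \<cdot>\<^bsub>A\<^esub> bp_in1 B = Id A X \<and> bp_pr2 B \<cdot>\<^bsub>A\<^esub> bp_in2 B = Id A Y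
     \<and> bp_pr2 B \<cdot>\<^bsub>A\<^esub> bp_in1 B = Zero A X Y \<and> bp_pr1 B \<cdot>\<^bsub>A\<^esub> bp_in2 B = Zero A Y X
     \<and> (bp_in1 B \<cdot>\<^bsub>A\<^esub> bp_pr1 B) \<boxplus>\<^bsub>A\<^esub> (bp_in2 B \<cdot>\<^bsub>A\<^esub> bp_pr2 B) = Id A (bp_ob B)"

locale additive_category = preadditive_category +
  assumes ex_zero_object: "\<exists>Z. zero_object A Z"
    and ex_biproduct: "\<lbrakk>X \<in> Ob A; Y \<in> Ob A\<rbrakk> \<Longrightarrow> \<exists>B. is_biproduct A X Y B"

definition zero_ob :: "('o, 'a, 'm) preadditive_category_scheme \<Rightarrow> 'o" where
  "zero_ob A = (SOME Z. zero_object A Z)"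

definition biprod ::
    "('o, 'a, 'm) preadditive_category_scheme \<Rightarrow> 'o \<Rightarrow> 'o \<Rightarrow> ('o, 'a) biproduct" where
  "biprod A X Y = (SOME B. is_biproduct A X Y B)"

definition sum_ob :: "('o, 'a, 'm) preadditive_category_scheme \<Rightarrow> 'o \<Rightarrow> 'o \<Rightarrow> 'o" where
  "sum_ob A X Y = bp_ob (biprod A X Y)"

definition in1 :: "('o, 'a, 'm) preadditive_category_scheme \<Rightarrow> 'o \<Rightarrow> 'o \<Rightarrow> 'a" where
  "in1 A X Y = bp_in1 (biprod A X Y)"

definition in2 :: "('o, 'a, 'm) preadditive_category_scheme \<Rightarrow> 'o \<Rightarrow> 'o \<Rightarrow> 'a" where
  "in2 A X Y = bp_in2 (biprod A X Y)"

definition pr1 :: "('o, 'a, 'm) preadditive_category_scheme \<Rightarrow> 'o \<Rightarrow> 'o \<Rightarrow> 'a" where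
  "pr1 A X Y = bp_pr1 (biprod A X Y)"

definition pr2 :: "('o, 'a, 'm) preadditive_category_scheme \<Rightarrow> 'o \<Rightarrow> 'o \<Rightarrow> 'a" where
  "pr2 A X Y = bp_pr2 (biprod A X Y)"


section \<open>Localization of a category at a set of arrows\<close>

text \<open>The arrows of the category of fractions \<open>C[W\<^sup>-\<^sup>1]\<close> are classes of zigzags. A zigzag is a list of
  arrows of \<open>C\<close> and of formal inverses (\<open>Bwd\<close>) of arrows in \<open>W\<close>, written in the order in which
  they are traversed. The relation \<open>zz_eq\<close> is the least congruence that makes the map \<open>f \<mapsto> [Fwd f]\<close>
  a functor and \<open>[Bwd w]\<close> inverse to \<open>[Fwd w]\<close>.\<close>

datatype 'a letter = Fwd 'a | Bwd 'a

inductive zigzag ::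
    "('o, 'a, 'm) category_scheme \<Rightarrow> 'a set \<Rightarrow> 'o \<Rightarrow> 'o \<Rightarrow> 'a letter list \<Rightarrow> bool"
  for C :: "('o, 'a, 'm) category_scheme" and W :: "'a set"
where
  zz_nil: "X \<in> Ob C \<Longrightarrow> zigzag C W X X []"
| zz_fwd: "\<lbrakk>f \<in> Hom C X Y; zigzag C W Y Z p\<rbrakk> \<Longrightarrow> zigzag C W X Z (Fwd f # p)"
| zz_bwd: "\<lbrakk>w \<in> W; w \<in> Hom C Y X; zigzag C W Y Z p\<rbrakk> \<Longrightarrow> zigzag C W X Z (Bwd w # p)"

inductive zz_eq ::
    "('o, 'a, 'm) category_scheme \<Rightarrow> 'a set \<Rightarrow> 'o \<Rightarrow> 'o \<Rightarrow> 'a letter list \<Rightarrow> 'a letter list \<Rightarrow> bool"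
  for C :: "('o, 'a, 'm) category_scheme" and W :: "'a set"
where
  zz_refl: "zigzag C W X Y p \<Longrightarrow> zz_eq C W X Y p p"
| zz_sym: "zz_eq C W X Y p q \<Longrightarrow> zz_eq C W X Y q p"
| zz_trans: "\<lbrakk>zz_eq C W X Y p q; zz_eq C W X Y q r\<rbrakk> \<Longrightarrow> zz_eq C W X Y p r"
| zz_append: "\<lbrakk>zz_eq C W X Y p p'; zz_eq C W Y Z q q'\<rbrakk> \<Longrightarrow> zz_eq C W X Z (p @ q) (p' @ q')"
| zz_id: "X \<in> Ob C \<Longrightarrow> zz_eq C W X X [Fwd (Id C X)] []"
| zz_comp: "\<lbrakk>f \<in> Hom C X Y; g \<in> Hom C Y Z\<rbrakk> \<Longrightarrow> zz_eq C W X Z [Fwd f, Fwd g] [Fwd (g \<cdot>\<^bsub>C\<^esub> f)]"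
| zz_fwd_bwd: "\<lbrakk>w \<in> W; w \<in> Hom C X Y\<rbrakk> \<Longrightarrow> zz_eq C W X X [Fwd w, Bwd w] []"
| zz_bwd_fwd: "\<lbrakk>w \<in> W; w \<in> Hom C X Y\<rbrakk> \<Longrightarrow> zz_eq C W Y Y [Bwd w, Fwd w] []"

type_synonym ('o, 'a) loc_arrow = "'o \<times> 'o \<times> 'a letter list set"

definition loc_class ::
    "('o, 'a, 'm) category_scheme \<Rightarrow> 'a set \<Rightarrow> 'o \<Rightarrow> 'o \<Rightarrow> 'a letter list \<Rightarrow> ('o, 'a) loc_arrow" where
  "loc_class C W X Y p = (X, Y, {q. zz_eq C W X Y p q})"

definition localization ::
    "('o, 'a, 'm) category_scheme \<Rightarrow> 'a set \<Rightarrow> ('o, ('o, 'a) loc_arrow) category" where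
  "localization C W = \<lparr>
     Ob = Ob C,
     Arr = {loc_class C W X Y p | X Y p. zigzag C W X Y p},
     Dom = (\<lambda>(X, Y, P). X),
     Cod = (\<lambda>(X, Y, P). Y),
     Id = (\<lambda>X. loc_class C W X X []),
     Comp = (\<lambda>(Y', Z, Q) (X, Y, P). (X, Z, {r. \<exists>p \<in> P. \<exists>q \<in> Q. zz_eq C W X Z (p @ q) r}))\<rparr>"

definition loc_map :: "('o, 'a, 'm) category_scheme \<Rightarrow> 'a set \<Rightarrow> 'a \<Rightarrow> ('o, 'a) loc_arrow" where
  "loc_map C W f = loc_class C W (Dom C f) (Cod C f) [Fwd f]"


section \<open>Triangulated subcategories and Verdier quotients\<close>

record ('o, 'a) shift_category = "('o, 'a) category" +
  Shift_ob :: "'o \<Rightarrow> 'o"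
  Shift_arr :: "'a \<Rightarrow> 'a"

record ('o, 'a) triangulated_category = "('o, 'a) shift_category" +
  Dist :: "('a \<times> 'a \<times> 'a) set"

definition triangle :: "('o, 'a, 'm) shift_category_scheme \<Rightarrow> 'a \<times> 'a \<times> 'a \<Rightarrow> bool" where
  "triangle C = (\<lambda>(u, v, w). u \<in> Arr C \<and> v \<in> Arr C \<and> w \<in> Arr C
     \<and> Cod C u = Dom C v \<and> Cod C v = Dom C w \<and> Cod C w = Shift_ob C (Dom C u))"

definition isomorphic_triangles ::
    "('o, 'a, 'm) shift_category_scheme \<Rightarrow> 'a \<times> 'a \<times> 'a \<Rightarrow> 'a \<times> 'a \<times> 'a \<Rightarrow> bool" where
  "isomorphic_triangles C = (\<lambda>(u, v, w) (u', v', w').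
     triangle C (u, v, w) \<and> triangle C (u', v', w') \<and>
     (\<exists>a \<in> Hom C (Dom C u) (Dom C u'). \<exists>b \<in> Hom C (Dom C v) (Dom C v').
      \<exists>c \<in> Hom C (Dom C w) (Dom C w').
        iso_arrow C a \<and> iso_arrow C b \<and> iso_arrow C c
        \<and> b \<cdot>\<^bsub>C\<^esub> u = u' \<cdot>\<^bsub>C\<^esub> a \<and> c \<cdot>\<^bsub>C\<^esub> v = v' \<cdot>\<^bsub>C\<^esub> b \<and> Shift_arr C a \<cdot>\<^bsub>C\<^esub> w = w' \<cdot>\<^bsub>C\<^esub> c))"

text \<open>A full subcategory is given by its set of objects; strict means closed under isomorphism.
  Closure under the shift in both directions and under the third vertex of distinguished
  triangles yields the two-out-of-three property by rotation.\<close>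

definition triangulated_subcategory ::
    "('o, 'a, 'm) triangulated_category_scheme \<Rightarrow> 'o set \<Rightarrow> bool" where
  "triangulated_subcategory C D \<longleftrightarrow> D \<subseteq> Ob C
     \<and> (\<forall>Z. zero_object C Z \<longrightarrow> Z \<in> D)
     \<and> (\<forall>X \<in> D. \<forall>Y \<in> Ob C. isomorphic C X Y \<longrightarrow> Y \<in> D)
     \<and> (\<forall>X \<in> Ob C. X \<in> D \<longleftrightarrow> Shift_ob C X \<in> D)
     \<and> (\<forall>(u, v, w) \<in> Dist C. Dom C u \<in> D \<and> Dom C v \<in> D \<longrightarrow> Dom C w \<in> D)"

definition generated_subcategory ::
    "('o, 'a, 'm) triangulated_category_scheme \<Rightarrow> 'o set \<Rightarrow> 'o set" where
  "generated_subcategory C G = \<Inter> {D. triangulated_subcategory C D \<and> G \<subseteq> D}"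

definition arrows_with_cone_in ::
    "('o, 'a, 'm) triangulated_category_scheme \<Rightarrow> 'o set \<Rightarrow> 'a set" where
  "arrows_with_cone_in C D = {u. \<exists>v w. (u, v, w) \<in> Dist C \<and> Dom C w \<in> D}"

definition verdier_quotient ::
    "('o, 'a, 'm) triangulated_category_scheme \<Rightarrow> 'o set \<Rightarrow> ('o, ('o, 'a) loc_arrow) category" where
  "verdier_quotient C D = localization C (arrows_with_cone_in C D)"

definition verdier_map ::
    "('o, 'a, 'm) triangulated_category_scheme \<Rightarrow> 'o set \<Rightarrow> 'a \<Rightarrow> ('o, 'a) loc_arrow" where
  "verdier_map C D f = loc_map C (arrows_with_cone_in C D) f"


section \<open>The homotopy category of bounded complexes\<close>

record ('o, 'a) complex =
  obj :: "int \<Rightarrow> 'o"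
  diff :: "int \<Rightarrow> 'a"

definition bounded_complex ::
    "('o, 'a, 'm) preadditive_category_scheme \<Rightarrow> ('o, 'a) complex \<Rightarrow> bool" where
  "bounded_complex A X \<longleftrightarrow>
     (\<forall>n. obj X n \<in> Ob A) \<and> (\<forall>n. diff X n \<in> Hom A (obj X n) (obj X (n + 1)))
     \<and> (\<forall>n. diff X (n + 1) \<cdot>\<^bsub>A\<^esub> diff X n = Zero A (obj X n) (obj X (n + 2)))
     \<and> (\<exists>N. \<forall>n. \<bar>n\<bar> > N \<longrightarrow> zero_object A (obj X n))"

definition chain_map ::
    "('o, 'a, 'm) preadditive_category_scheme \<Rightarrow> ('o, 'a) complex \<Rightarrow> ('o, 'a) complex
      \<Rightarrow> (int \<Rightarrow> 'a) \<Rightarrow> bool" where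
  "chain_map A X Y f \<longleftrightarrow> (\<forall>n. f n \<in> Hom A (obj X n) (obj Y n))
     \<and> (\<forall>n. diff Y n \<cdot>\<^bsub>A\<^esub> f n = f (n + 1) \<cdot>\<^bsub>A\<^esub> diff X n)"

definition homotopic ::
    "('o, 'a, 'm) preadditive_category_scheme \<Rightarrow> ('o, 'a) complex \<Rightarrow> ('o, 'a) complex
      \<Rightarrow> (int \<Rightarrow> 'a) \<Rightarrow> (int \<Rightarrow> 'a) \<Rightarrow> bool" where
  "homotopic A X Y f g \<longleftrightarrow> (\<exists>h. (\<forall>n. h n \<in> Hom A (obj X n) (obj Y (n - 1)))
     \<and> (\<forall>n. f n = g n \<boxplus>\<^bsub>A\<^esub> ((diff Y (n - 1) \<cdot>\<^bsub>A\<^esub> h n) \<boxplus>\<^bsub>A\<^esub> (h (n + 1) \<cdot>\<^bsub>A\<^esub> diff X n))))"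

type_synonym ('o, 'a) kb_arrow = "('o, 'a) complex \<times> ('o, 'a) complex \<times> (int \<Rightarrow> 'a) set"

definition homotopy_class ::
    "('o, 'a, 'm) preadditive_category_scheme \<Rightarrow> ('o, 'a) complex \<Rightarrow> ('o, 'a) complex
      \<Rightarrow> (int \<Rightarrow> 'a) \<Rightarrow> ('o, 'a) kb_arrow" where
  "homotopy_class A X Y f = (X, Y, {g. chain_map A X Y g \<and> homotopic A X Y f g})"

definition shift_complex ::
    "('o, 'a, 'm) preadditive_category_scheme \<Rightarrow> ('o, 'a) complex \<Rightarrow> ('o, 'a) complex" where
  "shift_complex A X = \<lparr>obj = (\<lambda>n. obj X (n + 1)), diff = (\<lambda>n. Neg A (diff X (n + 1)))\<rparr>"

text \<open>The image of a homotopy class under \<open>f \<mapsto> (n \<mapsto> f (n + 1))\<close> is again a full homotopy class: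
  a homotopy \<open>h\<close> is moved to \<open>n \<mapsto> - h (n + 1)\<close>.\<close>

definition Kb_shift ::
    "('o, 'a, 'm) preadditive_category_scheme
      \<Rightarrow> (('o, 'a) complex, ('o, 'a) kb_arrow) shift_category" where
  "Kb_shift A = \<lparr>
     Ob = {X. bounded_complex A X},
     Arr = {homotopy_class A X Y f | X Y f.
              bounded_complex A X \<and> bounded_complex A Y \<and> chain_map A X Y f},
     Dom = (\<lambda>(X, Y, F). X),
     Cod = (\<lambda>(X, Y, F). Y),
     Id = (\<lambda>X. homotopy_class A X X (\<lambda>n. Id A (obj X n))),
     Comp = (\<lambda>(Y', Z, G) (X, Y, F).
       (X, Z, {k. chain_map A X Z k \<and>
                  (\<exists>f \<in> F. \<exists>g \<in> G. homotopic A X Z (\<lambda>n. g n \<cdot>\<^bsub>A\<^esub> f n) k)})),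
     Shift_ob = shift_complex A,
     Shift_arr = (\<lambda>(X, Y, F). (shift_complex A X, shift_complex A Y, (\<lambda>f n. f (n + 1)) ` F))\<rparr>"

text \<open>The cone of a chain map \<open>f\<close> from \<open>X\<close> to \<open>Y\<close> has \<open>X (n + 1) \<oplus> Y n\<close> in degree \<open>n\<close> and
  the differential \<open>(x, y) \<mapsto> (- d x, f x + d y)\<close>.\<close>

definition cone ::
    "('o, 'a, 'm) preadditive_category_scheme \<Rightarrow> ('o, 'a) complex \<Rightarrow> ('o, 'a) complex
      \<Rightarrow> (int \<Rightarrow> 'a) \<Rightarrow> ('o, 'a) complex" where
  "cone A X Y f = \<lparr>
     obj = (\<lambda>n. sum_ob A (obj X (n + 1)) (obj Y n)),
     diff = (\<lambda>n.
       (in1 A (obj X (n + 2)) (obj Y (n + 1)) \<cdot>\<^bsub>A\<^esub>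
          (Neg A (diff X (n + 1)) \<cdot>\<^bsub>A\<^esub> pr1 A (obj X (n + 1)) (obj Y n)))
       \<boxplus>\<^bsub>A\<^esub>
       (in2 A (obj X (n + 2)) (obj Y (n + 1)) \<cdot>\<^bsub>A\<^esub>
          ((f (n + 1) \<cdot>\<^bsub>A\<^esub> pr1 A (obj X (n + 1)) (obj Y n))
           \<boxplus>\<^bsub>A\<^esub> (diff Y n \<cdot>\<^bsub>A\<^esub> pr2 A (obj X (n + 1)) (obj Y n)))))\<rparr>"

definition standard_triangle ::
    "('o, 'a, 'm) preadditive_category_scheme \<Rightarrow> ('o, 'a) complex \<Rightarrow> ('o, 'a) complex
      \<Rightarrow> (int \<Rightarrow> 'a) \<Rightarrow> ('o, 'a) kb_arrow \<times> ('o, 'a) kb_arrow \<times> ('o, 'a) kb_arrow" where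
  "standard_triangle A X Y f =
     (homotopy_class A X Y f,
      homotopy_class A Y (cone A X Y f) (\<lambda>n. in2 A (obj X (n + 1)) (obj Y n)),
      homotopy_class A (cone A X Y f) (shift_complex A X) (\<lambda>n. pr1 A (obj X (n + 1)) (obj Y n)))"

definition Kb ::
    "('o, 'a, 'm) preadditive_category_scheme
      \<Rightarrow> (('o, 'a) complex, ('o, 'a) kb_arrow) triangulated_category" where
  "Kb A = shift_category.extend (Kb_shift A) (triangulated_category.fields
     {t. \<exists>X Y f. bounded_complex A X \<and> bounded_complex A Y \<and> chain_map A X Y f
         \<and> isomorphic_triangles (Kb_shift A) t (standard_triangle A X Y f)})"

definition conc_ob ::
    "('o, 'a, 'm) preadditive_category_scheme \<Rightarrow> 'o \<Rightarrow> ('o, 'a) complex" where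
  "conc_ob A X = (let P = (\<lambda>n. if n = 0 then X else zero_ob A)
     in \<lparr>obj = P, diff = (\<lambda>n. Zero A (P n) (P (n + 1)))\<rparr>)"

definition conc_arr ::
    "('o, 'a, 'm) preadditive_category_scheme \<Rightarrow> 'a \<Rightarrow> ('o, 'a) kb_arrow" where
  "conc_arr A f = homotopy_class A (conc_ob A (Dom A f)) (conc_ob A (Cod A f))
     (\<lambda>n. if n = 0 then f else Zero A (zero_ob A) (zero_ob A))"

definition arrow_cone ::
    "('o, 'a, 'm) preadditive_category_scheme \<Rightarrow> 'a \<Rightarrow> ('o, 'a) complex" where
  "arrow_cone A s =
     (let P = (\<lambda>n. if n = - 1 then Dom A s else if n = 0 then Cod A s else zero_ob A)
      in \<lparr>obj = P, diff = (\<lambda>n. if n = - 1 then s else Zero A (P n) (P (n + 1)))\<rparr>)"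

end

theory Submission
  imports Defs
begin

text \<open>
  Fix \<open>X\<close>. Call \<open>t: M \<rightarrow> X\<close> a resolution if \<open>M\<close>
  lives in degrees \<open>\<ge> 0\<close>, \<open>t\<close> is an epimorphism in \<open>C/D\<close>, and for some \<open>c: M\<^sup>1 \<rightarrow> T\<close> the morphism
  \<open>s = (t\<^sup>0, c d\<^sup>0): M\<^sup>0 \<rightarrow> X \<oplus> T\<close> has its cone in \<open>D\<close>. Call \<open>K\<close> refinable if every chain map from a resolution
  \<open>M\<close> to \<open>K\<close> becomes null-homotopic on some further resolution \<open>M' \<rightarrow> M\<close>.

  The complexes all of whose shifts are refinable form a triangulated subcategory, by the exactness
  of \<open>Hom(M, -)\<close>. It contains the shifts of \<open>Cone(r)\<close> for \<open>r \<in> S\<close>: those living in negative degrees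
  receive no nonzero chain map from \<open>M\<close>, and for the others \<open>M'\<close> is the fibre of \<open>M \<rightarrow> K\<close>; the
  morphism \<open>s\<close> changes only if \<open>K\<close> lives in degrees \<open>-1, 0\<close>, and then it becomes a triangular matrix
  with diagonal \<open>s, r\<close>. Hence every object of \<open>D\<close> is refinable, and the inverted letters of a zigzag
  \<open>f\<close> from \<open>X\<close> can be removed one at a time: \<open>f t = h\<close> in \<open>C/D\<close> for a resolution \<open>t: M \<rightarrow> X\<close> and a
  morphism \<open>h: M \<rightarrow> X'\<close> of \<open>C\<close>.

  Since \<open>X'\<close> sits in degree \<open>0\<close>, \<open>h = g q\<close> where \<open>q: M \<rightarrow> M\<^sup>0\<close> is the truncation and \<open>g: M\<^sup>0 \<rightarrow> X'\<close>.
  The map \<open>c\<close> is a homotopy from \<open>s q\<close> to \<open>i t\<close>, so \<open>g s\<^sup>-\<^sup>1 i t = g q = f t\<close>, and \<open>t\<close> cancels.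
\<close>

lemma Hom_iff: "f \<in> Hom C X Y \<longleftrightarrow> f \<in> Arr C \<and> Dom C f = X \<and> Cod C f = Y"
  by (auto simp: Hom_def)

section \<open>Arithmetic in preadditive categories\<close>

context category
begin

lemma comp_arr [simp]:
  assumes "f \<in> Arr C" "g \<in> Arr C" "Dom C g = Cod C f"
  shows "g \<cdot> f \<in> Arr C" "Dom C (g \<cdot> f) = Dom C f" "Cod C (g \<cdot> f) = Cod C g"
  using comp_hom[of f "Dom C f" "Cod C f" g "Cod C g"] assms by (auto simp: Hom_iff)

lemma id_arr [simp]:
  assumes "X \<in> Ob C"
  shows "Id C X \<in> Arr C" "Dom C (Id C X) = X" "Cod C (Id C X) = X"
  using id_hom[OF assms] by (auto simp: Hom_iff)

lemma dom_cod_ob [simp]: "f \<in> Arr C \<Longrightarrow> Dom C f \<in> Ob C" "f \<in> Arr C \<Longrightarrow> Cod C f \<in> Ob C"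
  using dom_ob cod_ob by auto

lemma comp_assoc' [simp]:
  "\<lbrakk>f \<in> Arr C; g \<in> Arr C; h \<in> Arr C; Dom C g = Cod C f; Dom C h = Cod C g\<rbrakk>
    \<Longrightarrow> (h \<cdot> g) \<cdot> f = h \<cdot> (g \<cdot> f)"
  using comp_assoc[of f "Dom C f" "Cod C f" g "Cod C g" h "Cod C h"] by (auto simp: Hom_iff)

lemma id_comp [simp]:
  "\<lbrakk>f \<in> Arr C; Cod C f = X\<rbrakk> \<Longrightarrow> Id C X \<cdot> f = f"
  "\<lbrakk>f \<in> Arr C; Dom C f = X\<rbrakk> \<Longrightarrow> f \<cdot> Id C X = f"
  using id_left[of f "Dom C f" "Cod C f"] id_right[of f "Dom C f" "Cod C f"]
  by (auto simp: Hom_iff)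

end

context preadditive_category
begin

lemma hom_group_simps [simp]:
  "carrier (hom_group A X Y) = Hom A X Y"
  "mult (hom_group A X Y) = Add A"
  "one (hom_group A X Y) = Zero A X Y"
  by (auto simp: hom_group_def)

lemma zero_arr [simp]:
  assumes "X \<in> Ob A" "Y \<in> Ob A"
  shows "Zero A X Y \<in> Arr A" "Dom A (Zero A X Y) = X" "Cod A (Zero A X Y) = Y"
  using comm_group.axioms(2)[OF hom_comm_group[OF assms], THEN group.is_monoid, THEN monoid.one_closed]
  by (auto simp: Hom_iff)

lemma add_arr [simp]:
  assumes "f \<in> Arr A" "g \<in> Arr A" "Dom A g = Dom A f" "Cod A g = Cod A f"
  shows "f \<boxplus> g \<in> Arr A" "Dom A (f \<boxplus> g) = Dom A f" "Cod A (f \<boxplus> g) = Cod A f"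
  using comm_group.axioms(2)[OF hom_comm_group[of "Dom A f" "Cod A f"], THEN group.is_monoid,
      THEN monoid.m_closed, of f g] assms
  by (auto simp: Hom_iff)

lemma neg_arr [simp]:
  assumes "f \<in> Arr A"
  shows "Neg A f \<in> Arr A" "Dom A (Neg A f) = Dom A f" "Cod A (Neg A f) = Cod A f"
  using group.inv_closed[OF comm_group.axioms(2)[OF hom_comm_group[of "Dom A f" "Cod A f"]], of f] assms
  by (auto simp: Hom_iff Neg_def)

lemma add_assoc' [simp]:
  assumes "f \<in> Arr A" "g \<in> Arr A" "h \<in> Arr A" "Dom A g = Dom A f" "Cod A g = Cod A f"
    "Dom A h = Dom A f" "Cod A h = Cod A f"
  shows "(f \<boxplus> g) \<boxplus> h = f \<boxplus> (g \<boxplus> h)"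
  using monoid.m_assoc[OF group.is_monoid[OF comm_group.axioms(2)[OF hom_comm_group[of "Dom A f" "Cod A f"]]],
      of f g h] assms
  by (auto simp: Hom_iff)

lemma add_commute:
  assumes "f \<in> Arr A" "g \<in> Arr A" "Dom A g = Dom A f" "Cod A g = Cod A f"
  shows "f \<boxplus> g = g \<boxplus> f"
  using comm_monoid.m_comm[OF comm_group.axioms(1)[OF hom_comm_group[of "Dom A f" "Cod A f"]],
      of f g] assms
  by (auto simp: Hom_iff)

lemma add_left_commute:
  assumes "f \<in> Arr A" "g \<in> Arr A" "h \<in> Arr A" "Dom A g = Dom A f" "Cod A g = Cod A f"
    "Dom A h = Dom A f" "Cod A h = Cod A f"
  shows "f \<boxplus> (g \<boxplus> h) = g \<boxplus> (f \<boxplus> h)"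
  using add_assoc'[of f g h] add_assoc'[of g f h] add_commute[of f g] assms by simp

lemmas add_ac = add_commute add_left_commute

lemma add_zero [simp]:
  "\<lbrakk>f \<in> Arr A; Dom A f = X; Cod A f = Y\<rbrakk> \<Longrightarrow> Zero A X Y \<boxplus> f = f"
  "\<lbrakk>f \<in> Arr A; Dom A f = X; Cod A f = Y\<rbrakk> \<Longrightarrow> f \<boxplus> Zero A X Y = f"
  using monoid.l_one[OF group.is_monoid[OF comm_group.axioms(2)[OF hom_comm_group[of "Dom A f" "Cod A f"]]], of f]
  monoid.r_one[OF group.is_monoid[OF comm_group.axioms(2)[OF hom_comm_group[of "Dom A f" "Cod A f"]]], of f]
  by (auto simp: Hom_iff)

lemma add_neg [simp]:
  assumes "f \<in> Arr A"
  shows "f \<boxplus> Neg A f = Zero A (Dom A f) (Cod A f)" "Neg A f \<boxplus> f = Zero A (Dom A f) (Cod A f)"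
  using group.r_inv[OF comm_group.axioms(2)[OF hom_comm_group[of "Dom A f" "Cod A f"]], of f]
    group.l_inv[OF comm_group.axioms(2)[OF hom_comm_group[of "Dom A f" "Cod A f"]], of f] assms
  by (auto simp: Hom_iff Neg_def)

lemma add_neg_cancel [simp]:
  assumes "f \<in> Arr A" "g \<in> Arr A" "Dom A g = Dom A f" "Cod A g = Cod A f"
  shows "f \<boxplus> (Neg A f \<boxplus> g) = g" "Neg A f \<boxplus> (f \<boxplus> g) = g"
  using add_assoc'[of f "Neg A f" g] add_assoc'[of "Neg A f" f g] assms by (simp_all del: add_assoc')

lemma add_comp [simp]:
  assumes "g \<in> Arr A" "h \<in> Arr A" "f \<in> Arr A" "Dom A h = Dom A g" "Cod A h = Cod A g" "Dom A g = Cod A f"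
  shows "(g \<boxplus> h) \<cdot> f = (g \<cdot> f) \<boxplus> (h \<cdot> f)"
  using add_comp_left[of f "Dom A f" "Cod A f" g "Cod A g" h] assms by (simp add: Hom_iff)

lemma comp_add [simp]:
  assumes "g \<in> Arr A" "h \<in> Arr A" "f \<in> Arr A" "Dom A h = Dom A g" "Cod A h = Cod A g" "Dom A f = Cod A g"
  shows "f \<cdot> (g \<boxplus> h) = (f \<cdot> g) \<boxplus> (f \<cdot> h)"
  using add_comp_right[of g "Dom A g" "Cod A g" h f "Cod A f"] assms by (simp add: Hom_iff)

text \<open>Cancellation in the group of arrows. Applied to \<open>0 \<cdot> f\<close>, which equals
  its own double by distributivity, it gives the vanishing of composites with a zero arrow.\<close>

lemma idem_zero:
  assumes "f \<in> Arr A" "f \<boxplus> f = f" shows "f = Zero A (Dom A f) (Cod A f)"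
  using add_neg_cancel(2)[of f f] assms by simp

lemma zero_comp [simp]:
  assumes "f \<in> Arr A" "Cod A f = Y" "Z \<in> Ob A"
  shows "Zero A Y Z \<cdot> f = Zero A (Dom A f) Z"
proof -
  have "Zero A Y Z \<cdot> f \<boxplus> Zero A Y Z \<cdot> f = Zero A Y Z \<cdot> f"
    using add_comp[of "Zero A Y Z" "Zero A Y Z" f] assms by (auto simp del: add_comp)
  from idem_zero[OF _ this] show ?thesis using assms by auto
qed

lemma comp_zero [simp]:
  assumes "f \<in> Arr A" "Dom A f = Y" "X \<in> Ob A"
  shows "f \<cdot> Zero A X Y = Zero A X (Cod A f)"
proof -
  have "f \<cdot> Zero A X Y \<boxplus> f \<cdot> Zero A X Y = f \<cdot> Zero A X Y"
    using comp_add[of "Zero A X Y" "Zero A X Y" f] assms by (auto simp del: comp_add)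
  from idem_zero[OF _ this] show ?thesis using assms by auto
qed

lemma neg_eqI:
  assumes "f \<in> Arr A" "g \<in> Arr A" "Dom A g = Dom A f" "Cod A g = Cod A f"
    "f \<boxplus> g = Zero A (Dom A f) (Cod A f)"
  shows "Neg A f = g"
  using add_neg_cancel(2)[of f g] assms by simp

lemma neg_zero [simp]: "\<lbrakk>X \<in> Ob A; Y \<in> Ob A\<rbrakk> \<Longrightarrow> Neg A (Zero A X Y) = Zero A X Y"
  by (rule neg_eqI) auto

lemma neg_neg [simp]: "f \<in> Arr A \<Longrightarrow> Neg A (Neg A f) = f"
  by (rule neg_eqI) auto

lemma neg_add [simp]:
  assumes "f \<in> Arr A" "g \<in> Arr A" "Dom A g = Dom A f" "Cod A g = Cod A f"
  shows "Neg A (f \<boxplus> g) = Neg A f \<boxplus> Neg A g"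
proof (rule neg_eqI)
  have "(f \<boxplus> g) \<boxplus> (Neg A f \<boxplus> Neg A g) = f \<boxplus> (Neg A f \<boxplus> (g \<boxplus> Neg A g))"
    using add_left_commute[of g "Neg A f" "Neg A g"] assms by (simp del: add_neg add_neg_cancel)
  then show "(f \<boxplus> g) \<boxplus> (Neg A f \<boxplus> Neg A g) = Zero A (Dom A (f \<boxplus> g)) (Cod A (f \<boxplus> g))"
    using assms by simp
qed (use assms in auto)

lemma neg_comp [simp]:
  assumes "f \<in> Arr A" "g \<in> Arr A" "Dom A g = Cod A f"
  shows "Neg A g \<cdot> f = Neg A (g \<cdot> f)"
  by (rule neg_eqI[symmetric]) (use add_comp[of g "Neg A g" f] assms in \<open>auto simp del: add_comp\<close>)

lemma comp_neg [simp]: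
  assumes "f \<in> Arr A" "g \<in> Arr A" "Dom A g = Cod A f"
  shows "g \<cdot> Neg A f = Neg A (g \<cdot> f)"
  by (rule neg_eqI[symmetric]) (use comp_add[of f "Neg A f" g] assms in \<open>auto simp del: comp_add\<close>)

section \<open>Arrows into and out of zero objects\<close>

lemma zero_ob_ob: "zero_object A Z \<Longrightarrow> Z \<in> Ob A"
  by (simp add: zero_object_def)

lemma arr_from_zero_ob:
  assumes "f \<in> Arr A" "zero_object A (Dom A f)"
  shows "f = Zero A (Dom A f) (Cod A f)"
proof -
  have "\<exists>!g. g \<in> Hom A (Dom A f) (Cod A f)" using assms by (simp add: zero_object_def)
  moreover have "f \<in> Hom A (Dom A f) (Cod A f)" "Zero A (Dom A f) (Cod A f) \<in> Hom A (Dom A f) (Cod A f)"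
    using assms by (auto simp: Hom_iff)
  ultimately show ?thesis by blast
qed

lemma arr_to_zero_ob:
  assumes "f \<in> Arr A" "zero_object A (Cod A f)"
  shows "f = Zero A (Dom A f) (Cod A f)"
proof -
  have "\<exists>!g. g \<in> Hom A (Dom A f) (Cod A f)" using assms by (simp add: zero_object_def)
  moreover have "f \<in> Hom A (Dom A f) (Cod A f)" "Zero A (Dom A f) (Cod A f) \<in> Hom A (Dom A f) (Cod A f)"
    using assms by (auto simp: Hom_iff)
  ultimately show ?thesis by blast
qed

lemma arr_zero_ob_eq:
  assumes "f \<in> Arr A" "g \<in> Arr A" "Dom A f = Dom A g" "Cod A f = Cod A g"
    "zero_object A (Dom A g) \<or> zero_object A (Cod A g)"
  shows "f = g"
  using assms arr_from_zero_ob[of f] arr_from_zero_ob[of g] arr_to_zero_ob[of f] arr_to_zero_ob[of g]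
  by metis

text \<open>Every arrow \<open>f\<close> into or out of \<open>Z\<close> is its own composite with
  \<open>Id A Z\<close>, hence a composite with a zero arrow.\<close>

lemma zero_objectI:
  assumes "Z \<in> Ob A" "Id A Z = Zero A Z Z"
  shows "zero_object A Z"
proof -
  have *: "f = Zero A X Z" if "f \<in> Hom A X Z" for f X
    using that id_comp(1)[of f Z] assms by (metis Hom_iff zero_comp)
  have **: "f = Zero A Z X" if "f \<in> Hom A Z X" for f X
    using that id_comp(2)[of f Z] assms by (metis Hom_iff comp_zero)
  have h: "Zero A X Y \<in> Hom A X Y" if "X \<in> Ob A" "Y \<in> Ob A" for X Y using that by (simp add: Hom_iff)
  show ?thesis unfolding zero_object_def
    using assms(1) h * ** by blast
qed

end

section \<open>Biproducts and matrix calculus\<close>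

context additive_category
begin

lemma zero_ob_zero [simp]: "zero_object A (zero_ob A)"
  unfolding zero_ob_def using someI_ex[OF ex_zero_object] .

lemma zero_ob_in [simp]: "zero_ob A \<in> Ob A"
  by (rule zero_ob_ob) simp

lemma biprod_is: "\<lbrakk>X \<in> Ob A; Y \<in> Ob A\<rbrakk> \<Longrightarrow> is_biproduct A X Y (biprod A X Y)"
  unfolding biprod_def using someI_ex[OF ex_biproduct] .

lemma bp_arr [simp]:
  assumes "X \<in> Ob A" "Y \<in> Ob A"
  shows "sum_ob A X Y \<in> Ob A"
    "in1 A X Y \<in> Arr A" "Dom A (in1 A X Y) = X" "Cod A (in1 A X Y) = sum_ob A X Y"
    "in2 A X Y \<in> Arr A" "Dom A (in2 A X Y) = Y" "Cod A (in2 A X Y) = sum_ob A X Y"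
    "pr1 A X Y \<in> Arr A" "Dom A (pr1 A X Y) = sum_ob A X Y" "Cod A (pr1 A X Y) = X"
    "pr2 A X Y \<in> Arr A" "Dom A (pr2 A X Y) = sum_ob A X Y" "Cod A (pr2 A X Y) = Y"
  using biprod_is[OF assms] unfolding is_biproduct_def
  by (auto simp: Hom_iff sum_ob_def in1_def in2_def pr1_def pr2_def)

lemma bp_eqs [simp]:
  assumes "X \<in> Ob A" "Y \<in> Ob A"
  shows "pr1 A X Y \<cdot> in1 A X Y = Id A X" "pr2 A X Y \<cdot> in2 A X Y = Id A Y"
    "pr2 A X Y \<cdot> in1 A X Y = Zero A X Y" "pr1 A X Y \<cdot> in2 A X Y = Zero A Y X"
  using biprod_is[OF assms] unfolding is_biproduct_def
  by (auto simp: Hom_iff sum_ob_def in1_def in2_def pr1_def pr2_def)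

lemma bp_id:
  assumes "X \<in> Ob A" "Y \<in> Ob A"
  shows "(in1 A X Y \<cdot> pr1 A X Y) \<boxplus> (in2 A X Y \<cdot> pr2 A X Y) = Id A (sum_ob A X Y)"
  using biprod_is[OF assms] unfolding is_biproduct_def
  by (auto simp: Hom_iff sum_ob_def in1_def in2_def pr1_def pr2_def)

text \<open>Composites are normalised with brackets to the right, so the equations of a biproduct
  are also stored with a trailing factor \<open>f\<close>; otherwise they would not match inside
  longer composites.\<close>

lemma bp_eqs_comp [simp]:
  assumes "X \<in> Ob A" "Y \<in> Ob A" "f \<in> Arr A"
  shows "Cod A f = X \<Longrightarrow> pr1 A X Y \<cdot> (in1 A X Y \<cdot> f) = f"
    "Cod A f = Y \<Longrightarrow> pr2 A X Y \<cdot> (in2 A X Y \<cdot> f) = f"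
    "Cod A f = X \<Longrightarrow> pr2 A X Y \<cdot> (in1 A X Y \<cdot> f) = Zero A (Dom A f) Y"
    "Cod A f = Y \<Longrightarrow> pr1 A X Y \<cdot> (in2 A X Y \<cdot> f) = Zero A (Dom A f) X"
  using assms comp_assoc'[of f "in1 A X Y" "pr1 A X Y"] comp_assoc'[of f "in2 A X Y" "pr1 A X Y"]
    comp_assoc'[of f "in1 A X Y" "pr2 A X Y"] comp_assoc'[of f "in2 A X Y" "pr2 A X Y"]
  by (simp_all del: comp_assoc')

text \<open>Composing with the decomposition \<open>bp_id\<close> of the identity recovers an arrow
  from its two components. Matrix identities below are reduced to entries in this way.\<close>

lemma bp_eqI_to:
  assumes "f \<in> Arr A" "g \<in> Arr A" "X \<in> Ob A" "Y \<in> Ob A"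
    "Dom A f = Dom A g" "Cod A f = sum_ob A X Y" "Cod A g = sum_ob A X Y"
    "pr1 A X Y \<cdot> f = pr1 A X Y \<cdot> g" "pr2 A X Y \<cdot> f = pr2 A X Y \<cdot> g"
  shows "f = g"
proof -
  have *: "h = in1 A X Y \<cdot> (pr1 A X Y \<cdot> h) \<boxplus> in2 A X Y \<cdot> (pr2 A X Y \<cdot> h)"
    if "h \<in> Arr A" "Cod A h = sum_ob A X Y" for h
    using add_comp[of "in1 A X Y \<cdot> pr1 A X Y" "in2 A X Y \<cdot> pr2 A X Y" h] bp_id[of X Y] that assms(3,4)
    by (simp del: add_comp)
  show ?thesis using *[of f] *[of g] assms by simp
qed

lemma bp_eqI_from:
  assumes "f \<in> Arr A" "g \<in> Arr A" "X \<in> Ob A" "Y \<in> Ob A"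
    "Cod A f = Cod A g" "Dom A f = sum_ob A X Y" "Dom A g = sum_ob A X Y"
    "f \<cdot> in1 A X Y = g \<cdot> in1 A X Y" "f \<cdot> in2 A X Y = g \<cdot> in2 A X Y"
  shows "f = g"
proof -
  have *: "h = (h \<cdot> in1 A X Y) \<cdot> pr1 A X Y \<boxplus> (h \<cdot> in2 A X Y) \<cdot> pr2 A X Y"
    if "h \<in> Arr A" "Dom A h = sum_ob A X Y" for h
    using comp_add[of "in1 A X Y \<cdot> pr1 A X Y" "in2 A X Y \<cdot> pr2 A X Y" h] bp_id[of X Y] that assms(3,4)
    by (simp del: comp_add)
  show ?thesis using *[of f] *[of g] assms by metis
qed

lemma sum_zero_object:
  assumes "zero_object A X" "zero_object A Y"
  shows "zero_object A (sum_ob A X Y)"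
proof (rule zero_objectI)
  have XY: "X \<in> Ob A" "Y \<in> Ob A" using assms by (auto simp: zero_ob_ob)
  then show "sum_ob A X Y \<in> Ob A" by simp
  show "Id A (sum_ob A X Y) = Zero A (sum_ob A X Y) (sum_ob A X Y)"
    by (rule bp_eqI_to[of _ _ X Y]; (rule arr_zero_ob_eq)?) (use XY assms in auto)
qed

end

section \<open>Complexes, chain maps and homotopies\<close>

definition unshift_complex ::
    "('o, 'a, 'm) preadditive_category_scheme \<Rightarrow> ('o, 'a) complex \<Rightarrow> ('o, 'a) complex" where
  "unshift_complex A X = \<lparr>obj = (\<lambda>n. obj X (n - 1)), diff = (\<lambda>n. Neg A (diff X (n - 1)))\<rparr>"

text \<open>Unlike the shift, this translation introduces no signs, so translations by arbitrary
  integers compose strictly. The case \<open>m = 1\<close> is compared with the shift in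
  \<open>shift_reindex_equivalence\<close>.\<close>

definition reindex :: "int \<Rightarrow> ('o, 'a) complex \<Rightarrow> ('o, 'a) complex" where
  "reindex m X = \<lparr>obj = (\<lambda>n. obj X (n + m)), diff = (\<lambda>n. diff X (n + m))\<rparr>"

definition bounded_map ::
    "('o, 'a, 'm) preadditive_category_scheme \<Rightarrow> ('o, 'a) complex \<Rightarrow> ('o, 'a) complex
      \<Rightarrow> (int \<Rightarrow> 'a) \<Rightarrow> bool" where
  "bounded_map A X Y f \<longleftrightarrow> bounded_complex A X \<and> bounded_complex A Y \<and> chain_map A X Y f"

context additive_category
begin

lemma bounded_complexD [simp]:
  assumes "bounded_complex A X"
  shows "obj X n \<in> Ob A" "diff X n \<in> Arr A" "Dom A (diff X n) = obj X n"
    "Cod A (diff X n) = obj X (n + 1)"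
  using assms by (auto simp: bounded_complex_def Hom_iff)

lemma diff_diff [simp]:
  assumes "bounded_complex A X" "m = n + 1"
  shows "diff X m \<cdot> diff X n = Zero A (obj X n) (obj X (m + 1))"
proof -
  have "diff X (n + 1) \<cdot> diff X n = Zero A (obj X n) (obj X (n + 2))"
    using assms(1) unfolding bounded_complex_def by blast
  then show ?thesis using assms(2) by (simp only: add.assoc one_add_one)
qed

lemma diff_diff_comp [simp]:
  assumes "bounded_complex A X" "m = n + 1" "f \<in> Arr A" "Cod A f = obj X n"
  shows "diff X m \<cdot> (diff X n \<cdot> f) = Zero A (Dom A f) (obj X (m + 1))"
  using diff_diff[OF assms(1,2)] comp_assoc'[of f "diff X n" "diff X m"] assms
  by (simp del: comp_assoc' diff_diff)

lemma chain_map_simps: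
  assumes "bounded_map A X Y f"
  shows "bounded_complex A X" "bounded_complex A Y"
    "f n \<in> Arr A" "Dom A (f n) = obj X n" "Cod A (f n) = obj Y n"
    "m = n + 1 \<Longrightarrow> f m \<cdot> diff X n = diff Y n \<cdot> f n"
    "\<lbrakk>m = n + 1; x \<in> Arr A; Cod A x = obj X n\<rbrakk> \<Longrightarrow> f m \<cdot> (diff X n \<cdot> x) = diff Y n \<cdot> (f n \<cdot> x)"
proof -
  show b: "bounded_complex A X" "bounded_complex A Y" using assms by (auto simp: bounded_map_def)
  show t: "f n \<in> Arr A" "Dom A (f n) = obj X n" "Cod A (f n) = obj Y n" for n
    using assms by (auto simp: bounded_map_def chain_map_def Hom_iff)
  show *: "m = n + 1 \<Longrightarrow> f m \<cdot> diff X n = diff Y n \<cdot> f n" for m n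
    using assms by (auto simp: bounded_map_def chain_map_def)
  show "\<lbrakk>m = n + 1; x \<in> Arr A; Cod A x = obj X n\<rbrakk> \<Longrightarrow> f m \<cdot> (diff X n \<cdot> x) = diff Y n \<cdot> (f n \<cdot> x)"
    using *[of m n] comp_assoc'[of x "diff X n" "f m"] comp_assoc'[of x "f n" "diff Y n"] b
    by (simp del: comp_assoc' add: t)
qed

lemma bounded_mapI:
  assumes "bounded_complex A X" "bounded_complex A Y"
    "\<And>n. f n \<in> Arr A" "\<And>n. Dom A (f n) = obj X n" "\<And>n. Cod A (f n) = obj Y n"
    "\<And>n. diff Y n \<cdot> f n = f (n + 1) \<cdot> diff X n"
  shows "bounded_map A X Y f"
  using assms by (auto simp: bounded_map_def chain_map_def Hom_iff)

lemma homotopicI: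
  assumes "\<And>n. h n \<in> Arr A" "\<And>n. Dom A (h n) = obj X n" "\<And>n. Cod A (h n) = obj Y (n - 1)"
    "\<And>n. f n = g n \<boxplus> ((diff Y (n - 1) \<cdot> h n) \<boxplus> (h (n + 1) \<cdot> diff X n))"
  shows "homotopic A X Y f g"
  using assms by (auto simp: homotopic_def Hom_iff)

lemma homotopicE:
  assumes "homotopic A X Y f g"
  obtains h where "\<And>n. h n \<in> Arr A" "\<And>n. Dom A (h n) = obj X n" "\<And>n. Cod A (h n) = obj Y (n - 1)"
    "\<And>n. f n = g n \<boxplus> ((diff Y (n - 1) \<cdot> h n) \<boxplus> (h (n + 1) \<cdot> diff X n))"
  using assms by (auto simp: homotopic_def Hom_iff)

lemma bounded_map_id: "bounded_complex A X \<Longrightarrow> bounded_map A X X (\<lambda>n. Id A (obj X n))"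
  by (rule bounded_mapI) auto

lemma bounded_map_comp:
  assumes f: "bounded_map A X Y f" and g: "bounded_map A Y Z g"
  shows "bounded_map A X Z (\<lambda>n. g n \<cdot> f n)"
proof -
  note [simp] = chain_map_simps[OF f] chain_map_simps[OF g]
  show ?thesis by (rule bounded_mapI) auto
qed

lemma bounded_map_zero:
  assumes "bounded_complex A X" "bounded_complex A Y"
  shows "bounded_map A X Y (\<lambda>n. Zero A (obj X n) (obj Y n))"
  by (rule bounded_mapI) (use assms in auto)

lemma homotopic_refl:
  assumes f: "bounded_map A X Y f"
  shows "homotopic A X Y f f"
proof -
  note [simp] = chain_map_simps[OF f]
  show ?thesis by (rule homotopicI[where h = "\<lambda>n. Zero A (obj X n) (obj Y (n - 1))"]) auto
qed

lemma homotopic_sym: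
  assumes g: "bounded_map A X Y g" and fg: "homotopic A X Y f g"
  shows "homotopic A X Y g f"
proof -
  obtain h where [simp]: "\<And>n. h n \<in> Arr A" "\<And>n. Dom A (h n) = obj X n" "\<And>n. Cod A (h n) = obj Y (n - 1)"
    and eq: "\<And>n. f n = g n \<boxplus> ((diff Y (n - 1) \<cdot> h n) \<boxplus> (h (n + 1) \<cdot> diff X n))"
    using homotopicE[OF fg] by blast
  note [simp] = chain_map_simps[OF g]
  have c: "g n = (g n \<boxplus> (a \<boxplus> b)) \<boxplus> (Neg A a \<boxplus> Neg A b)"
    if "a \<in> Arr A" "Dom A a = Dom A (g n)" "Cod A a = Cod A (g n)"
      "b \<in> Arr A" "Dom A b = Dom A (g n)" "Cod A b = Cod A (g n)" for a b n
    using that add_neg[of "a \<boxplus> b"] by simp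
  show ?thesis
    apply (rule homotopicI[where h = "\<lambda>n. Neg A (h n)"])
       apply (simp_all only: neg_arr eq)
       apply (simp_all del: add_assoc')
    by (rule c) auto
qed

lemma homotopic_trans:
  assumes k: "bounded_map A X Y k" and fg: "homotopic A X Y f g" and gk: "homotopic A X Y g k"
  shows "homotopic A X Y f k"
proof -
  obtain h where [simp]: "\<And>n. h n \<in> Arr A" "\<And>n. Dom A (h n) = obj X n" "\<And>n. Cod A (h n) = obj Y (n - 1)"
    and eq: "\<And>n. f n = g n \<boxplus> ((diff Y (n - 1) \<cdot> h n) \<boxplus> (h (n + 1) \<cdot> diff X n))"
    using homotopicE[OF fg] by blast
  obtain h' where [simp]: "\<And>n. h' n \<in> Arr A" "\<And>n. Dom A (h' n) = obj X n" "\<And>n. Cod A (h' n) = obj Y (n - 1)"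
    and eq': "\<And>n. g n = k n \<boxplus> ((diff Y (n - 1) \<cdot> h' n) \<boxplus> (h' (n + 1) \<cdot> diff X n))"
    using homotopicE[OF gk] by blast
  note [simp] = chain_map_simps[OF k]
  show ?thesis
    by (rule homotopicI[where h = "\<lambda>n. h n \<boxplus> h' n"]) (auto simp: eq eq' add_ac)
qed

lemma homotopic_comp_left:
  assumes f': "bounded_map A X Y f'" and g: "bounded_map A Y Z g" and ff': "homotopic A X Y f f'"
  shows "homotopic A X Z (\<lambda>n. g n \<cdot> f n) (\<lambda>n. g n \<cdot> f' n)"
proof -
  obtain h where [simp]: "\<And>n. h n \<in> Arr A" "\<And>n. Dom A (h n) = obj X n" "\<And>n. Cod A (h n) = obj Y (n - 1)"
    and eq: "\<And>n. f n = f' n \<boxplus> ((diff Y (n - 1) \<cdot> h n) \<boxplus> (h (n + 1) \<cdot> diff X n))"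
    using homotopicE[OF ff'] by blast
  note [simp] = chain_map_simps[OF f'] chain_map_simps[OF g]
  show ?thesis
    by (rule homotopicI[where h = "\<lambda>n. g (n - 1) \<cdot> h n"]) (auto simp: eq)
qed

lemma homotopic_comp_right:
  assumes f: "bounded_map A X Y f" and g': "bounded_map A Y Z g'" and gg': "homotopic A Y Z g g'"
  shows "homotopic A X Z (\<lambda>n. g n \<cdot> f n) (\<lambda>n. g' n \<cdot> f n)"
proof -
  obtain h where [simp]: "\<And>n. h n \<in> Arr A" "\<And>n. Dom A (h n) = obj Y n" "\<And>n. Cod A (h n) = obj Z (n - 1)"
    and eq: "\<And>n. g n = g' n \<boxplus> ((diff Z (n - 1) \<cdot> h n) \<boxplus> (h (n + 1) \<cdot> diff Y n))"
    using homotopicE[OF gg'] by blast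
  note [simp] = chain_map_simps[OF f] chain_map_simps[OF g']
  show ?thesis
    by (rule homotopicI[where h = "\<lambda>n. h n \<cdot> f n"]) (auto simp: eq)
qed

lemma homotopic_comp:
  assumes "bounded_map A X Y f'" "bounded_map A Y Z g" "bounded_map A Y Z g'"
    "homotopic A X Y f f'" "homotopic A Y Z g g'"
  shows "homotopic A X Z (\<lambda>n. g n \<cdot> f n) (\<lambda>n. g' n \<cdot> f' n)"
  by (rule homotopic_trans[OF bounded_map_comp homotopic_comp_left homotopic_comp_right])
    (use assms in auto)

end

section \<open>Cones, shifts and fibres\<close>

text \<open>The arithmetic simprocs turn \<open>n + 1 + 1\<close> into \<open>2 + n\<close>, but leave \<open>n + 2\<close> alone.\<close>

lemma int_index_simps [simp]:
  fixes n :: int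
  shows "n + 1 + 1 = n + 2" "n + 2 + 1 = n + 3" "n - 1 + 2 = n + 1" "n + 2 - 1 = n + 1" "2 + n = n + 2" "3 + n = n + 3"
  by auto

context additive_category
begin

lemma bounded_by_zero:
  assumes "bounded_complex A X"
  obtains N where "\<And>n. \<bar>n\<bar> > N \<Longrightarrow> zero_object A (obj X n)"
  using assms unfolding bounded_complex_def by blast

lemma bounded_complexI:
  assumes "\<And>n. obj X n \<in> Ob A" "\<And>n. diff X n \<in> Arr A" "\<And>n. Dom A (diff X n) = obj X n"
    "\<And>n. Cod A (diff X n) = obj X (n + 1)"
    "\<And>n. diff X (n + 1) \<cdot> diff X n = Zero A (obj X n) (obj X (n + 2))"
    "\<And>n. \<bar>n\<bar> > N \<Longrightarrow> zero_object A (obj X n)"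
  shows "bounded_complex A X"
  using assms unfolding bounded_complex_def Hom_iff by blast

lemma shift_simps [simp]:
  "obj (shift_complex A X) n = obj X (n + 1)" "diff (shift_complex A X) n = Neg A (diff X (n + 1))"
  by (auto simp: shift_complex_def)

lemma unshift_simps [simp]:
  "obj (unshift_complex A X) n = obj X (n - 1)" "diff (unshift_complex A X) n = Neg A (diff X (n - 1))"
  by (auto simp: unshift_complex_def)

lemma reindex_simps [simp]:
  "obj (reindex m X) n = obj X (n + m)" "diff (reindex m X) n = diff X (n + m)"
  by (auto simp: reindex_def)

lemma bounded_shift [simp]:
  assumes [simp]: "bounded_complex A X" shows "bounded_complex A (shift_complex A X)"
proof -
  obtain N where "\<And>n. \<bar>n\<bar> > N \<Longrightarrow> zero_object A (obj X n)" using bounded_by_zero[OF assms] by blast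
  then show ?thesis by (intro bounded_complexI[where N = "\<bar>N\<bar> + 1"]) auto
qed

lemma bounded_unshift [simp]:
  assumes [simp]: "bounded_complex A X" shows "bounded_complex A (unshift_complex A X)"
proof -
  obtain N where "\<And>n. \<bar>n\<bar> > N \<Longrightarrow> zero_object A (obj X n)" using bounded_by_zero[OF assms] by blast
  then show ?thesis by (intro bounded_complexI[where N = "\<bar>N\<bar> + 1"]) auto
qed

lemma bounded_reindex [simp]:
  assumes [simp]: "bounded_complex A X" shows "bounded_complex A (reindex m X)"
proof -
  obtain N where "\<And>n. \<bar>n\<bar> > N \<Longrightarrow> zero_object A (obj X n)" using bounded_by_zero[OF assms] by blast
  then show ?thesis by (intro bounded_complexI[where N = "\<bar>N\<bar> + \<bar>m\<bar>"]) (auto simp: add_ac ac_simps)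
qed

lemma shift_unshift [simp]:
  assumes [simp]: "bounded_complex A X" shows "shift_complex A (unshift_complex A X) = X"
  by (rule complex.equality) (auto simp: fun_eq_iff shift_complex_def unshift_complex_def)

lemma reindex_0 [simp]: "reindex 0 X = X"
  by (rule complex.equality) (auto simp: fun_eq_iff reindex_def)

lemma reindex_reindex [simp]: "reindex m (reindex k X) = reindex (m + k) X"
  by (rule complex.equality) (auto simp: fun_eq_iff reindex_def ac_simps)

lemma bounded_map_shift:
  assumes f: "bounded_map A X Y f"
  shows "bounded_map A (shift_complex A X) (shift_complex A Y) (\<lambda>n. f (n + 1))"
proof -
  note [simp] = chain_map_simps[OF f]
  show ?thesis by (rule bounded_mapI) auto
qed

lemma bounded_map_reindex:
  assumes f: "bounded_map A X Y f"
  shows "bounded_map A (reindex m X) (reindex m Y) (\<lambda>n. f (n + m))"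
proof -
  note [simp] = chain_map_simps[OF f]
  show ?thesis by (rule bounded_mapI) (auto simp: ac_simps)
qed

lemma homotopic_reindex:
  assumes "homotopic A X Y f g"
  shows "homotopic A (reindex m X) (reindex m Y) (\<lambda>n. f (n + m)) (\<lambda>n. g (n + m))"
proof -
  obtain h where [simp]: "\<And>n. h n \<in> Arr A" "\<And>n. Dom A (h n) = obj X n" "\<And>n. Cod A (h n) = obj Y (n - 1)"
    and eq: "\<And>n. f n = g n \<boxplus> ((diff Y (n - 1) \<cdot> h n) \<boxplus> (h (n + 1) \<cdot> diff X n))"
    using homotopicE[OF assms] by blast
  show ?thesis
    by (rule homotopicI[where h = "\<lambda>n. h (n + m)"]) (auto simp: eq algebra_simps)
qed

lemma homotopic_shift:
  assumes f: "bounded_map A X Y f" and g: "bounded_map A X Y g"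
    and fg: "homotopic A X Y f g"
  shows "homotopic A (shift_complex A X) (shift_complex A Y) (\<lambda>n. f (n + 1)) (\<lambda>n. g (n + 1))"
proof -
  obtain h where [simp]: "\<And>n. h n \<in> Arr A" "\<And>n. Dom A (h n) = obj X n" "\<And>n. Cod A (h n) = obj Y (n - 1)"
    and eq: "\<And>n. f n = g n \<boxplus> ((diff Y (n - 1) \<cdot> h n) \<boxplus> (h (n + 1) \<cdot> diff X n))"
    using homotopicE[OF fg] by blast
  note [simp] = chain_map_simps[OF g]
  show ?thesis
    by (rule homotopicI[where h = "\<lambda>n. Neg A (h (n + 1))"]) (auto simp: eq)
qed

section \<open>Mapping cones and the exactness of Hom(M, -)\<close>

lemma cone_obj [simp]: "obj (cone A X Y f) n = sum_ob A (obj X (n + 1)) (obj Y n)"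
  by (simp add: cone_def)

lemma cone_diff:
  "diff (cone A X Y f) n =
       (in1 A (obj X (n + 2)) (obj Y (n + 1)) \<cdot>
          (Neg A (diff X (n + 1)) \<cdot> pr1 A (obj X (n + 1)) (obj Y n)))
       \<boxplus>
       (in2 A (obj X (n + 2)) (obj Y (n + 1)) \<cdot>
          ((f (n + 1) \<cdot> pr1 A (obj X (n + 1)) (obj Y n))
           \<boxplus> (diff Y n \<cdot> pr2 A (obj X (n + 1)) (obj Y n))))"
  by (simp add: cone_def)

lemma bounded_cone:
  assumes f: "bounded_map A X Y f"
  shows "bounded_complex A (cone A X Y f)"
proof -
  note [simp] = chain_map_simps[OF f]
  obtain N where N: "\<And>n. \<bar>n\<bar> > N \<Longrightarrow> zero_object A (obj X n)"
    using bounded_by_zero[of X] chain_map_simps[OF f] by metis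
  obtain N' where N': "\<And>n. \<bar>n\<bar> > N' \<Longrightarrow> zero_object A (obj Y n)"
    using bounded_by_zero[of Y] chain_map_simps[OF f] by metis
  show ?thesis
  \<comment> \<open>The extra 1 accounts for the summand \<open>obj X (n + 1)\<close> of degree
    \<open>n\<close>; the absolute values guard against negative bounds.\<close>
  proof (rule bounded_complexI[where N = "\<bar>N\<bar> + \<bar>N'\<bar> + 1"])
    fix n
    show "diff (cone A X Y f) (n + 1) \<cdot> diff (cone A X Y f) n =
          Zero A (obj (cone A X Y f) n) (obj (cone A X Y f) (n + 2))"
      by (rule bp_eqI_to[of _ _ "obj X (n + 3)" "obj Y (n + 2)"]) (auto simp: cone_diff)
    show "zero_object A (obj (cone A X Y f) n)" if "\<bar>n\<bar> > \<bar>N\<bar> + \<bar>N'\<bar> + 1"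
      using that by (auto intro!: sum_zero_object N N')
  qed (auto simp: cone_diff)
qed

lemma bounded_map_cone_in2:
  assumes f: "bounded_map A X Y f"
  shows "bounded_map A Y (cone A X Y f) (\<lambda>n. in2 A (obj X (n + 1)) (obj Y n))"
proof -
  note [simp] = chain_map_simps[OF f] bounded_cone[OF f]
  show ?thesis by (rule bounded_mapI) (auto simp: cone_diff)
qed

lemma bounded_map_cone_pr1:
  assumes f: "bounded_map A X Y f"
  shows "bounded_map A (cone A X Y f) (shift_complex A X) (\<lambda>n. pr1 A (obj X (n + 1)) (obj Y n))"
proof -
  note [simp] = chain_map_simps[OF f] bounded_cone[OF f]
  show ?thesis by (rule bounded_mapI) (auto simp: cone_diff)
qed

text \<open>An equality and not just an isomorphism, since \<open>reindex\<close> leaves all signs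
  alone. It reduces translates of a cone to cones of translated maps.\<close>

lemma reindex_cone:
  "reindex m (cone A X Y f) = cone A (reindex m X) (reindex m Y) (\<lambda>n. f (n + m))"
  by (rule complex.equality) (auto simp: fun_eq_iff reindex_def cone_def algebra_simps)

text \<open>A null-homotopy into the cone has two components. The cone differential forces the one
  in \<open>X\<close> to be a chain map \<open>x\<close>, and makes the one in \<open>Y\<close> a
  homotopy from \<open>y\<close> to \<open>f x\<close>.\<close>

lemma cone_exact_source:
  assumes f: "bounded_map A X Y f" and y: "bounded_map A M Y y"
    and null: "homotopic A M (cone A X Y f) (\<lambda>n. in2 A (obj X (n + 1)) (obj Y n) \<cdot> y n)
      (\<lambda>n. Zero A (obj M n) (obj (cone A X Y f) n))"
  shows "\<exists>x. bounded_map A M X x \<and> homotopic A M Y y (\<lambda>n. f n \<cdot> x n)"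
proof -
  note [simp] = chain_map_simps[OF f] chain_map_simps[OF y] bounded_cone[OF f]
  obtain h where h: "\<And>n. h n \<in> Arr A" "\<And>n. Dom A (h n) = obj M n"
      "\<And>n. Cod A (h n) = sum_ob A (obj X n) (obj Y (n - 1))"
    and eq: "\<And>n. in2 A (obj X (n + 1)) (obj Y n) \<cdot> y n = Zero A (obj M n) (sum_ob A (obj X (n + 1)) (obj Y n))
       \<boxplus> ((diff (cone A X Y f) (n - 1) \<cdot> h n) \<boxplus> (h (n + 1) \<cdot> diff M n))"
    using homotopicE[OF null] by (metis (no_types, lifting) cone_obj diff_add_cancel)
  note [simp] = h
  define x where "x n = pr1 A (obj X n) (obj Y (n - 1)) \<cdot> h n" for n
  define e where "e n = pr2 A (obj X n) (obj Y (n - 1)) \<cdot> h n" for n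
  have [simp]: "x n \<in> Arr A" "Dom A (x n) = obj M n" "Cod A (x n) = obj X n"
     "e n \<in> Arr A" "Dom A (e n) = obj M n" "Cod A (e n) = obj Y (n - 1)" for n
    by (auto simp: x_def e_def)
  have 1: "Neg A (diff X n \<cdot> x n) \<boxplus> (x (n + 1) \<cdot> diff M n) = Zero A (obj M n) (obj X (n + 1))" for n
    using arg_cong[OF eq[of n], of "\<lambda>z. pr1 A (obj X (n + 1)) (obj Y n) \<cdot> z"]
    by (simp add: cone_diff x_def)
  have 2: "y n = f n \<cdot> x n \<boxplus> (diff Y (n - 1) \<cdot> e n \<boxplus> e (n + 1) \<cdot> diff M n)" for n
    using arg_cong[OF eq[of n], of "\<lambda>z. pr2 A (obj X (n + 1)) (obj Y n) \<cdot> z"]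
    by (simp add: cone_diff x_def e_def)
  have "bounded_map A M X x"
  proof (rule bounded_mapI)
    show "diff X n \<cdot> x n = x (n + 1) \<cdot> diff M n" for n
      using neg_eqI[of "Neg A (diff X n \<cdot> x n)" "x (n + 1) \<cdot> diff M n"] 1[of n] by simp
  qed auto
  moreover have "homotopic A M Y y (\<lambda>n. f n \<cdot> x n)"
    by (rule homotopicI[where h = e]) (use 2 in auto)
  ultimately show ?thesis by blast
qed

text \<open>If \<open>h\<close> contracts the first component of \<open>z\<close>, then subtracting
  the boundary of \<open>in1 h\<close> from \<open>z\<close> removes that component. The second
  component \<open>p\<close> turns into \<open>p - f h\<close>, which is the required
  \<open>y\<close>.\<close>

lemma cone_exact_middle:
  assumes f: "bounded_map A X Y f" and z: "bounded_map A M (cone A X Y f) z"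
    and null: "homotopic A M (shift_complex A X) (\<lambda>n. pr1 A (obj X (n + 1)) (obj Y n) \<cdot> z n)
      (\<lambda>n. Zero A (obj M n) (obj (shift_complex A X) n))"
  shows "\<exists>y. bounded_map A M Y y \<and>
    homotopic A M (cone A X Y f) z (\<lambda>n. in2 A (obj X (n + 1)) (obj Y n) \<cdot> y n)"
proof -
  note [simp] = chain_map_simps(1,2)[OF f] chain_map_simps(3-)[OF f] chain_map_simps(1,3,4)[OF z] bounded_cone[OF f]
  have [simp]: "Cod A (z n) = sum_ob A (obj X (n + 1)) (obj Y n)" for n
    using chain_map_simps(5)[OF z] by simp
  obtain h where h: "\<And>n. h n \<in> Arr A" "\<And>n. Dom A (h n) = obj M n"
      "\<And>n. Cod A (h n) = obj X n"
    and eq: "\<And>n. pr1 A (obj X (n + 1)) (obj Y n) \<cdot> z n = Zero A (obj M n) (obj X (n + 1))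
       \<boxplus> ((Neg A (diff X n) \<cdot> h n) \<boxplus> (h (n + 1) \<cdot> diff M n))"
    using homotopicE[OF null] by (simp del: add_zero neg_comp) blast
  note [simp] = h
  have eq: "pr1 A (obj X (n + 1)) (obj Y n) \<cdot> z n = Neg A (diff X n \<cdot> h n) \<boxplus> (h (n + 1) \<cdot> diff M n)" for n
    using eq by simp
  define p where "p n = pr2 A (obj X (n + 1)) (obj Y n) \<cdot> z n" for n
  define y where "y n = p n \<boxplus> Neg A (f n \<cdot> h n)" for n
  have [simp]: "p n \<in> Arr A" "Dom A (p n) = obj M n" "Cod A (p n) = obj Y n"
     "y n \<in> Arr A" "Dom A (y n) = obj M n" "Cod A (y n) = obj Y n" for n
    by (auto simp: p_def y_def)
  have com: "p (n + 1) \<cdot> diff M n = f (n + 1) \<cdot> (Neg A (diff X n \<cdot> h n) \<boxplus> (h (n + 1) \<cdot> diff M n)) \<boxplus> diff Y n \<cdot> p n" for n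
    using chain_map_simps(6)[OF z, of "n+1" n, THEN arg_cong, of "\<lambda>z. pr2 A (obj X (n + 2)) (obj Y (n + 1)) \<cdot> z"]
    by (simp add: cone_diff p_def eq)
  have "bounded_map A M Y y"
  proof (rule bounded_mapI)
    show "diff Y n \<cdot> y n = y (n + 1) \<cdot> diff M n" for n
      by (simp add: y_def com add_ac)
  qed auto
  moreover have "homotopic A M (cone A X Y f) z (\<lambda>n. in2 A (obj X (n + 1)) (obj Y n) \<cdot> y n)"
  proof (rule homotopicI[where h = "\<lambda>n. in1 A (obj X n) (obj Y (n - 1)) \<cdot> h n"])
    show "z n = in2 A (obj X (n + 1)) (obj Y n) \<cdot> y n \<boxplus>
         (diff (cone A X Y f) (n - 1) \<cdot> (in1 A (obj X n) (obj Y (n - 1)) \<cdot> h n) \<boxplus>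
          (in1 A (obj X (n + 1)) (obj Y (n + 1 - 1)) \<cdot> h (n + 1)) \<cdot> diff M n)" for n
      by (rule bp_eqI_to[of _ _ "obj X (n + 1)" "obj Y n"]) (auto simp: cone_diff eq y_def p_def[symmetric])
  qed auto
  ultimately show ?thesis by blast
qed

end

definition homotopy_equivalence ::
    "('o, 'a, 'm) preadditive_category_scheme \<Rightarrow> ('o, 'a) complex \<Rightarrow> ('o, 'a) complex
      \<Rightarrow> (int \<Rightarrow> 'a) \<Rightarrow> (int \<Rightarrow> 'a) \<Rightarrow> bool" where
  "homotopy_equivalence A X Y f g \<longleftrightarrow> bounded_map A X Y f \<and> bounded_map A Y X g
     \<and> homotopic A X X (\<lambda>n. g n \<cdot>\<^bsub>A\<^esub> f n) (\<lambda>n. Id A (obj X n))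
     \<and> homotopic A Y Y (\<lambda>n. f n \<cdot>\<^bsub>A\<^esub> g n) (\<lambda>n. Id A (obj Y n))"

text \<open>The homotopy fibre of \<open>k\<close>: the cone moved one degree up. Degree
  \<open>n\<close> consists of \<open>obj M n\<close> and \<open>obj K (n - 1)\<close>, so the fibre
  lives in degrees at least 0 if \<open>M\<close> does and \<open>K\<close> lives in degrees at
  least -1.\<close>

definition fib ::
    "('o, 'a, 'm) preadditive_category_scheme \<Rightarrow> ('o, 'a) complex \<Rightarrow> ('o, 'a) complex
      \<Rightarrow> (int \<Rightarrow> 'a) \<Rightarrow> ('o, 'a) complex" where
  "fib A M K k = unshift_complex A (cone A M K k)"

definition fib_map ::
    "('o, 'a, 'm) preadditive_category_scheme \<Rightarrow> ('o, 'a) complex \<Rightarrow> ('o, 'a) complex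
      \<Rightarrow> int \<Rightarrow> 'a" where
  "fib_map A M K n = pr1 A (obj M n) (obj K (n - 1))"

definition conc_map :: "('o, 'a, 'm) preadditive_category_scheme \<Rightarrow> 'a \<Rightarrow> int \<Rightarrow> 'a" where
  "conc_map A f n = (if n = 0 then f else Zero A (zero_ob A) (zero_ob A))"

section \<open>Homotopy equivalences and fibres\<close>

context additive_category
begin

lemma homotopy_equivalence_sym:
  "homotopy_equivalence A X Y f g \<Longrightarrow> homotopy_equivalence A Y X g f"
  by (auto simp: homotopy_equivalence_def)

lemma homotopy_equivalenceI_iso:
  assumes f: "bounded_map A X Y f" and g: "bounded_map A Y X g"
    and "\<And>n. g n \<cdot> f n = Id A (obj X n)" "\<And>n. f n \<cdot> g n = Id A (obj Y n)"
  shows "homotopy_equivalence A X Y f g"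
  unfolding homotopy_equivalence_def
  using assms homotopic_refl[OF bounded_map_id] chain_map_simps(1,2)[OF f] by simp

text \<open>The sign of the differential of the shift is absorbed by alternating the signs of the
  identities.\<close>

lemma shift_reindex_equivalence:
  assumes [simp]: "bounded_complex A X"
  shows "\<exists>f g. homotopy_equivalence A (shift_complex A X) (reindex 1 X) f g"
proof -
  define f where "f n = (if even n then Id A (obj X (n + 1)) else Neg A (Id A (obj X (n + 1))))" for n
  have 1: "bounded_map A (shift_complex A X) (reindex 1 X) f"
    by (rule bounded_mapI) (auto simp: f_def)
  have 2: "bounded_map A (reindex 1 X) (shift_complex A X) f"
    by (rule bounded_mapI) (auto simp: f_def)
  show ?thesis
    by (intro exI[of _ f], rule homotopy_equivalenceI_iso[OF 1 2]) (auto simp: f_def)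
qed

lemma fib_obj [simp]: "obj (fib A M K k) n = sum_ob A (obj M n) (obj K (n - 1))"
  by (simp add: fib_def)

lemma fib_diff: "diff (fib A M K k) n = Neg A (diff (cone A M K k) (n - 1))"
  by (simp add: fib_def)

lemma bounded_fib: "bounded_map A M K k \<Longrightarrow> bounded_complex A (fib A M K k)"
  by (simp add: fib_def bounded_cone)

text \<open>The sign from moving the cone cancels that on the differential of \<open>M\<close> and
  passes to \<open>k\<close> and to the differential of \<open>K\<close>.\<close>

lemma fib_diff':
  assumes k: "bounded_map A M K k"
  shows "diff (fib A M K k) n =
       (in1 A (obj M (n + 1)) (obj K n) \<cdot> (diff M n \<cdot> pr1 A (obj M n) (obj K (n - 1))))
       \<boxplus> (in2 A (obj M (n + 1)) (obj K n) \<cdot>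
          (Neg A (k n \<cdot> pr1 A (obj M n) (obj K (n - 1)))
           \<boxplus> Neg A (diff K (n - 1) \<cdot> pr2 A (obj M n) (obj K (n - 1)))))"
proof -
  note [simp] = chain_map_simps[OF k]
  show ?thesis by (simp add: fib_diff cone_diff)
qed

lemma bounded_map_fib_map:
  assumes k: "bounded_map A M K k"
  shows "bounded_map A (fib A M K k) M (fib_map A M K)"
proof -
  note [simp] = chain_map_simps[OF k] bounded_fib[OF k]
  show ?thesis by (rule bounded_mapI) (auto simp: fib_diff' fib_map_def fib_diff'[OF k])
qed

lemma fib_map_null:
  assumes k: "bounded_map A M K k"
  shows "homotopic A (fib A M K k) K (\<lambda>n. k n \<cdot> fib_map A M K n)
    (\<lambda>n. Zero A (obj (fib A M K k) n) (obj K n))"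
proof -
  note [simp] = chain_map_simps[OF k] bounded_fib[OF k]
  show ?thesis
    \<comment> \<open>The projection of the fibre to \<open>K\<close> lowers degrees by 1. The minus
      sign offsets those in \<open>fib_diff'\<close>: the two terms with the differential of
      \<open>K\<close> cancel and \<open>k \<cdot> pr1\<close> remains.\<close>
    by (rule homotopicI[where h = "\<lambda>n. Neg A (pr2 A (obj M n) (obj K (n - 1)))"])
      (auto simp: fib_diff'[OF k] fib_map_def add_ac)
qed

text \<open>Produces the version with a trailing factor for equations between locally defined
  arrows.\<close>

lemma comp_rewrite:
  assumes "g \<cdot> f = e" "f \<in> Arr A" "g \<in> Arr A" "Dom A g = Cod A f" "x \<in> Arr A" "Cod A x = Dom A f"
  shows "g \<cdot> (f \<cdot> x) = e \<cdot> x"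
  using comp_assoc'[of x f g] assms by simp

text \<open>Rotation of the triangle of a fibre. The cone consists of \<open>K\<close> and two
  copies of \<open>M\<close> in adjacent degrees; the copies are joined by an identity and can be
  contracted, which leaves \<open>K\<close>.\<close>

lemma fib_map_cone_equivalence:
  assumes k: "bounded_map A M K k"
  shows "\<exists>f g. homotopy_equivalence A K (cone A (fib A M K k) M (fib_map A M K)) f g"
proof -
  note k' [simp] = chain_map_simps[OF k]
  let ?Z = "cone A (fib A M K k) M (fib_map A M K)"
  have bc [simp]: "bounded_complex A ?Z" using bounded_cone[OF bounded_map_fib_map[OF k]] .
  have of [simp]: "obj (fib A M K k) n = sum_ob A (obj M n) (obj K (n - 1))" for n by simp
  let ?F = "\<lambda>n. sum_ob A (obj M n) (obj K (n - 1))"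
  have ob: "obj ?Z n = sum_ob A (?F (n + 1)) (obj M n)" for n by simp
  \<comment> \<open>Coordinates on the cone, whose degree \<open>n\<close> is made of
    \<open>obj M (n + 1)\<close>, \<open>obj K n\<close> and \<open>obj M n\<close>. The
    differential is known through its three components \<open>deqs\<close>, and \<open>ext\<close>
    compares arrows by components.\<close>
  define p1 where "p1 n = pr1 A (obj M (n + 1)) (obj K n) \<cdot> pr1 A (?F (n + 1)) (obj M n)" for n
  define p2 where "p2 n = pr2 A (obj M (n + 1)) (obj K n) \<cdot> pr1 A (?F (n + 1)) (obj M n)" for n
  define p3 where "p3 n = pr2 A (?F (n + 1)) (obj M n)" for n
  define i1 where "i1 n = in1 A (?F (n + 1)) (obj M n) \<cdot> in1 A (obj M (n + 1)) (obj K n)" for n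
  define i2 where "i2 n = in1 A (?F (n + 1)) (obj M n) \<cdot> in2 A (obj M (n + 1)) (obj K n)" for n
  define D where "D n = diff ?Z n" for n
  define Z where "Z n = obj ?Z n" for n
  have ty [simp]: "p1 n \<in> Arr A" "Dom A (p1 n) = Z n" "Cod A (p1 n) = obj M (n + 1)"
    "p2 n \<in> Arr A" "Dom A (p2 n) = Z n" "Cod A (p2 n) = obj K n"
    "p3 n \<in> Arr A" "Dom A (p3 n) = Z n" "Cod A (p3 n) = obj M n"
    "i1 n \<in> Arr A" "Dom A (i1 n) = obj M (n + 1)" "Cod A (i1 n) = Z n"
    "i2 n \<in> Arr A" "Dom A (i2 n) = obj K n" "Cod A (i2 n) = Z n"
    "D n \<in> Arr A" "Dom A (D n) = Z n" "Cod A (D n) = Z (n + 1)" "Z n \<in> Ob A" for n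
    using bc by (auto simp: p1_def p2_def p3_def i1_def i2_def Z_def D_def simp del: bc)
  have eqs: "p1 n \<cdot> i1 n = Id A (obj M (n + 1))" "p2 n \<cdot> i1 n = Zero A (obj M (n + 1)) (obj K n)"
     "p3 n \<cdot> i1 n = Zero A (obj M (n + 1)) (obj M n)"
     "p1 n \<cdot> i2 n = Zero A (obj K n) (obj M (n + 1))" "p2 n \<cdot> i2 n = Id A (obj K n)"
     "p3 n \<cdot> i2 n = Zero A (obj K n) (obj M n)" for n
    by (auto simp: p1_def p2_def p3_def i1_def i2_def)
  have deqs: "p1 (n + 1) \<cdot> D n = Neg A (diff M (n + 1) \<cdot> p1 n)"
    "p2 (n + 1) \<cdot> D n = k (n + 1) \<cdot> p1 n \<boxplus> diff K n \<cdot> p2 n"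
    "p3 (n + 1) \<cdot> D n = p1 n \<boxplus> diff M n \<cdot> p3 n" for n
    unfolding p1_def p2_def p3_def D_def cone_diff fib_diff'[OF k] of
    by (simp_all add: fib_map_def)
  note c [simp] = eqs deqs comp_rewrite[OF eqs(1)] comp_rewrite[OF eqs(2)] comp_rewrite[OF eqs(3)]
    comp_rewrite[OF eqs(4)] comp_rewrite[OF eqs(5)] comp_rewrite[OF eqs(6)]
    comp_rewrite[OF deqs(1)] comp_rewrite[OF deqs(2)] comp_rewrite[OF deqs(3)]
  note c' [simp] = c[of "n - 1" for n, simplified]
  have ext: "u = v" if "p1 n \<cdot> u = p1 n \<cdot> v" "p2 n \<cdot> u = p2 n \<cdot> v" "p3 n \<cdot> u = p3 n \<cdot> v"
     "u \<in> Arr A" "v \<in> Arr A" "Dom A u = Dom A v" "Cod A u = Z n" "Cod A v = Z n" for u v n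
  proof (rule bp_eqI_to[of _ _ "?F (n + 1)" "obj M n"])
    have zz: "Cod A u = sum_ob A (?F (n + 1)) (obj M n)" "Cod A v = sum_ob A (?F (n + 1)) (obj M n)"
      using that by (auto simp: Z_def)
    note that = that(1-6) zz
    show "pr1 A (?F (n + 1)) (obj M n) \<cdot> u = pr1 A (?F (n + 1)) (obj M n) \<cdot> v"
      by (rule bp_eqI_to[of _ _ "obj M (n + 1)" "obj K n"]) (use that in \<open>simp_all add: p1_def p2_def\<close>)
  qed (use that in \<open>simp_all add: p3_def Z_def\<close>)
  \<comment> \<open>The projection \<open>p2\<close> alone is not compatible with the differentials:
    \<open>p2 \<cdot> D\<close> contains the extra term \<open>k \<cdot> p1\<close>. It is cancelled
    by \<open>k \<cdot> p3\<close>, since \<open>p3 \<cdot> D\<close> contains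
    \<open>p1\<close>.\<close>
  define g where "g n = p2 n \<boxplus> Neg A (k n \<cdot> p3 n)" for n
  have [simp]: "g n \<in> Arr A" "Dom A (g n) = Z n" "Cod A (g n) = obj K n" for n
    by (auto simp: g_def)
  have f: "bounded_map A K ?Z i2"
  proof (rule bounded_mapI)
    have "D n \<cdot> i2 n = i2 (n + 1) \<cdot> diff K n" for n
      by (rule ext[of "n + 1"]) auto
    then show "diff ?Z n \<cdot> i2 n = i2 (n + 1) \<cdot> diff K n" for n
      by (simp add: D_def)
  qed (use Z_def in auto)
  have g: "bounded_map A ?Z K g"
  proof (rule bounded_mapI)
    have "diff K n \<cdot> g n = g (n + 1) \<cdot> D n" for n
      by (auto simp: g_def add_ac)
    then show "diff K n \<cdot> g n = g (n + 1) \<cdot> diff ?Z n" for n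
      by (simp add: D_def)
  qed (use Z_def in auto)
  have gf: "g n \<cdot> i2 n = Id A (obj K n)" for n
    by (auto simp: g_def)
  have fg: "homotopic A ?Z ?Z (\<lambda>n. i2 n \<cdot> g n) (\<lambda>n. Id A (obj ?Z n))"
  \<comment> \<open>The homotopy carries the lower copy of \<open>M\<close> back to the copy in the
    adjacent degree, inverting the identity component of the differential up to sign.\<close>
  proof (rule homotopicI[where h = "\<lambda>n. Neg A (i1 (n - 1) \<cdot> p3 n)"], goal_cases)
    case (4 n)
    have "i2 n \<cdot> g n = Id A (Z n) \<boxplus> (D (n - 1) \<cdot> Neg A (i1 (n - 1) \<cdot> p3 n)
       \<boxplus> Neg A (i1 n \<cdot> p3 (n + 1)) \<cdot> D n)"
      by (rule ext[of n]) (auto simp: g_def add_ac)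
    then show ?case by (simp add: D_def Z_def del: ob of cone_obj fib_obj)
  qed (use Z_def in auto)
  show ?thesis
    unfolding homotopy_equivalence_def
    by (intro exI[of _ i2] exI[of _ g] conjI)
      (use f g fg gf homotopic_refl[OF bounded_map_id[of K]] in simp_all)
qed

text \<open>Outside degrees -1 and 0 all arrows with the same ends coincide, so the square
  \<open>comm\<close> is the only condition to check. The complexes may use different zero objects
  in the other degrees, so that they are isomorphic without being equal.\<close>

lemma homotopy_equivalence_two_term:
  assumes Z: "bounded_complex A Z" "\<And>n. n \<noteq> - 1 \<Longrightarrow> n \<noteq> 0 \<Longrightarrow> zero_object A (obj Z n)"
    and Z': "bounded_complex A Z'" "\<And>n. n \<noteq> - 1 \<Longrightarrow> n \<noteq> 0 \<Longrightarrow> zero_object A (obj Z' n)"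
    and a: "a \<in> Hom A (obj Z (- 1)) (obj Z' (- 1))" "a' \<in> Hom A (obj Z' (- 1)) (obj Z (- 1))"
      "a' \<cdot> a = Id A (obj Z (- 1))" "a \<cdot> a' = Id A (obj Z' (- 1))"
    and b: "b \<in> Hom A (obj Z 0) (obj Z' 0)" "b' \<in> Hom A (obj Z' 0) (obj Z 0)"
      "b' \<cdot> b = Id A (obj Z 0)" "b \<cdot> b' = Id A (obj Z' 0)"
    and comm: "b \<cdot> diff Z (- 1) = diff Z' (- 1) \<cdot> a"
  shows "\<exists>f g. homotopy_equivalence A Z Z' f g"
proof -
  note [simp] = Z Z'(1) Z'(2) a[unfolded Hom_iff] b[unfolded Hom_iff]
  have comm': "b' \<cdot> diff Z' (- 1) = diff Z (- 1) \<cdot> a'"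
  proof -
    have "b' \<cdot> diff Z' (- 1) = b' \<cdot> ((diff Z' (- 1) \<cdot> a) \<cdot> a')" by simp
    also have "\<dots> = (b' \<cdot> b) \<cdot> (diff Z (- 1) \<cdot> a')" by (simp flip: comm del: b(3))
    finally show ?thesis by simp
  qed
  define f where "f n = (if n = - 1 then a else if n = 0 then b else Zero A (obj Z n) (obj Z' n))" for n
  define g where "g n = (if n = - 1 then a' else if n = 0 then b' else Zero A (obj Z' n) (obj Z n))" for n
  have ft [simp]: "f n \<in> Arr A" "Dom A (f n) = obj Z n" "Cod A (f n) = obj Z' n" for n
    by (auto simp: f_def)
  have gt [simp]: "g n \<in> Arr A" "Dom A (g n) = obj Z' n" "Cod A (g n) = obj Z n" for n
    by (auto simp: g_def)
  have f: "bounded_map A Z Z' f"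
  proof (rule bounded_mapI)
    show "diff Z' n \<cdot> f n = f (n + 1) \<cdot> diff Z n" for n
    proof (cases "n = -1")
      case True then show ?thesis using comm by (simp add: f_def)
    next
      case False then show ?thesis by (cases "n = 0") (rule arr_zero_ob_eq; simp)+
    qed
  qed auto
  have g: "bounded_map A Z' Z g"
  proof (rule bounded_mapI)
    show "diff Z n \<cdot> g n = g (n + 1) \<cdot> diff Z' n" for n
    proof (cases "n = -1")
      case True then show ?thesis using comm' by (simp add: g_def)
    next
      case False then show ?thesis by (cases "n = 0") (rule arr_zero_ob_eq; simp)+
    qed
  qed auto
  have "g n \<cdot> f n = Id A (obj Z n)" "f n \<cdot> g n = Id A (obj Z' n)" for n
    by (cases "n = -1"; cases "n = 0"; (simp add: f_def g_def; fail)?; rule arr_zero_ob_eq; simp)+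
  then show ?thesis using homotopy_equivalenceI_iso[OF f g] by blast
qed

section \<open>Complexes concentrated in degree 0 and cones of arrows\<close>

lemma conc_ob_obj: "obj (conc_ob A X) n = (if n = 0 then X else zero_ob A)"
  and conc_ob_diff: "diff (conc_ob A X) n = Zero A (obj (conc_ob A X) n) (obj (conc_ob A X) (n + 1))"
  by (auto simp: conc_ob_def Let_def)

lemma conc_ob_obj_simps [simp]:
  "obj (conc_ob A X) 0 = X" "n \<noteq> 0 \<Longrightarrow> obj (conc_ob A X) n = zero_ob A"
  by (auto simp: conc_ob_obj)

lemma conc_ob_obj_ob [simp]: "X \<in> Ob A \<Longrightarrow> obj (conc_ob A X) n \<in> Ob A"
  by (auto simp: conc_ob_obj)

lemma bounded_conc_ob [simp]: "X \<in> Ob A \<Longrightarrow> bounded_complex A (conc_ob A X)"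
  by (rule bounded_complexI[where N = 0]) (simp_all add: conc_ob_diff)

lemma bounded_map_conc:
  assumes "f \<in> Hom A X Y"
  shows "bounded_map A (conc_ob A X) (conc_ob A Y) (conc_map A f)"
proof -
  have [simp]: "f \<in> Arr A" "Dom A f = X" "Cod A f = Y" "X \<in> Ob A" "Y \<in> Ob A"
    using assms dom_cod_ob by (auto simp: Hom_iff)
  have [simp]: "conc_map A f n \<in> Arr A" "Dom A (conc_map A f n) = obj (conc_ob A X) n"
    "Cod A (conc_map A f n) = obj (conc_ob A Y) n" for n
    by (auto simp: conc_map_def conc_ob_obj)
  show ?thesis by (rule bounded_mapI) (simp_all add: conc_ob_diff)
qed

lemma arrow_cone_obj:
    "obj (arrow_cone A s) n = (if n = - 1 then Dom A s else if n = 0 then Cod A s else zero_ob A)"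
  and arrow_cone_diff: "diff (arrow_cone A s) n =
      (if n = - 1 then s else Zero A (obj (arrow_cone A s) n) (obj (arrow_cone A s) (n + 1)))"
  by (auto simp: arrow_cone_def Let_def)

lemma arrow_cone_simps [simp]:
  "obj (arrow_cone A s) (- 1) = Dom A s" "obj (arrow_cone A s) 0 = Cod A s"
  "n \<noteq> - 1 \<Longrightarrow> n \<noteq> 0 \<Longrightarrow> obj (arrow_cone A s) n = zero_ob A"
  "diff (arrow_cone A s) (- 1) = s"
  by (auto simp: arrow_cone_obj arrow_cone_diff)

lemma bounded_arrow_cone [simp]:
  assumes [simp]: "s \<in> Arr A" shows "bounded_complex A (arrow_cone A s)"
proof -
  have [simp]: "obj (arrow_cone A s) n \<in> Ob A" for n by (auto simp: arrow_cone_obj)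
  have [simp]: "diff (arrow_cone A s) n \<in> Arr A" "Dom A (diff (arrow_cone A s) n) = obj (arrow_cone A s) n"
    "Cod A (diff (arrow_cone A s) n) = obj (arrow_cone A s) (n + 1)" for n
    by (auto simp: arrow_cone_diff)
  show ?thesis
  proof (rule bounded_complexI[where N = 1])
    show "diff (arrow_cone A s) (n + 1) \<cdot> diff (arrow_cone A s) n =
         Zero A (obj (arrow_cone A s) n) (obj (arrow_cone A s) (n + 2))" for n
      using arrow_cone_diff[of s 0] arrow_cone_diff[of s "-2"] by (cases "n = -1"; cases "n = -2") (simp_all add: arrow_cone_diff[of _ n])
  qed auto
qed

lemma arrow_cone_equivalence:
  assumes s: "s \<in> Arr A" "s' \<in> Arr A"
    and a: "a \<in> Hom A (Dom A s) (Dom A s')" "a' \<in> Hom A (Dom A s') (Dom A s)"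
      "a' \<cdot> a = Id A (Dom A s)" "a \<cdot> a' = Id A (Dom A s')"
    and b: "b \<in> Hom A (Cod A s) (Cod A s')" "b' \<in> Hom A (Cod A s') (Cod A s)"
      "b' \<cdot> b = Id A (Cod A s)" "b \<cdot> b' = Id A (Cod A s')"
    and comm: "b \<cdot> s = s' \<cdot> a"
  shows "\<exists>f g. homotopy_equivalence A (arrow_cone A s) (arrow_cone A s') f g"
  by (rule homotopy_equivalence_two_term[where a = a and a' = a' and b = b and b' = b'])
    (use assms in auto)

text \<open>Reconciles the two-term complex of \<open>s\<close> with the mapping cone of
  \<open>s\<close> seen as a chain map: the latter has sums with a zero object in place of
  \<open>X\<close> and \<open>Y\<close>.\<close>

lemma cone_conc_equivalence:
  assumes s: "s \<in> Hom A X Y"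
  shows "\<exists>f g. homotopy_equivalence A (arrow_cone A s) (cone A (conc_ob A X) (conc_ob A Y) (conc_map A s)) f g"
proof -
  note cs = bounded_cone[OF bounded_map_conc[OF s]]
  have [simp]: "s \<in> Arr A" "Dom A s = X" "Cod A s = Y" "X \<in> Ob A" "Y \<in> Ob A"
    using s dom_cod_ob by (auto simp: Hom_iff)
  show ?thesis
  proof (rule homotopy_equivalence_two_term[where a = "in1 A X (zero_ob A)" and a' = "pr1 A X (zero_ob A)"
        and b = "in2 A (zero_ob A) Y" and b' = "pr2 A (zero_ob A) Y"], goal_cases)
    case (4 n)
    then show ?case by (auto intro!: sum_zero_object)
  next
    case 8
    then show ?case by (rule bp_eqI_to[of _ _ X "zero_ob A"]; simp?; (rule arr_zero_ob_eq; simp)?)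
  next
    case 12
    then show ?case by (rule bp_eqI_to[of _ _ "zero_ob A" Y]; simp?; (rule arr_zero_ob_eq; simp)?)
  next
    case 13
    then show ?case by (rule bp_eqI_to[of _ _ "zero_ob A" Y]; simp add: cone_diff conc_ob_diff conc_map_def)
  qed (use cs in \<open>auto simp: Hom_iff\<close>)
qed

lemma arrow_cone_contractible:
  assumes s: "s \<in> Hom A U V" "s' \<in> Hom A V U" "s' \<cdot> s = Id A U" "s \<cdot> s' = Id A V"
  shows "homotopic A (arrow_cone A s) (arrow_cone A s) (\<lambda>n. Id A (obj (arrow_cone A s) n))
    (\<lambda>n. Zero A (obj (arrow_cone A s) n) (obj (arrow_cone A s) n))"
proof -
  have [simp]: "s \<in> Arr A" "Dom A s = U" "Cod A s = V" "U \<in> Ob A" "V \<in> Ob A"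
     "s' \<in> Arr A" "Dom A s' = V" "Cod A s' = U"
    using s dom_cod_ob by (auto simp: Hom_iff)
  have [simp]: "obj (arrow_cone A s) n \<in> Ob A" for n using bounded_arrow_cone[of s] by simp
  define h where "h n = (if n = 0 then s' else Zero A (obj (arrow_cone A s) n) (obj (arrow_cone A s) (n - 1)))" for n
  have [simp]: "h n \<in> Arr A" "Dom A (h n) = obj (arrow_cone A s) n" "Cod A (h n) = obj (arrow_cone A s) (n - 1)" for n
    by (auto simp: h_def)
  show ?thesis
  proof (rule homotopicI[where h = h], goal_cases)
    case (4 n)
    consider "n = -1" | "n = 0" | "n \<noteq> -1" "n \<noteq> 0" by blast
    then show ?case
    proof cases
      case 3
      then show ?thesis using bounded_arrow_cone[of s] by (intro arr_zero_ob_eq) auto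
    qed (use s bounded_arrow_cone[of s] in \<open>simp_all add: h_def arrow_cone_diff\<close>)
  qed auto
qed

end

section \<open>The homotopy category\<close>

lemma Kb_fields:
  "Ob (Kb A) = {X. bounded_complex A X}"
  "Arr (Kb A) = {homotopy_class A X Y f | X Y f. bounded_map A X Y f}"
  "Dom (Kb A) = (\<lambda>(X, Y, F). X)"
  "Cod (Kb A) = (\<lambda>(X, Y, F). Y)"
  "Id (Kb A) = (\<lambda>X. homotopy_class A X X (\<lambda>n. Id A (obj X n)))"
  "Comp (Kb A) = (\<lambda>(Y', Z, G) (X, Y, F).
       (X, Z, {k. chain_map A X Z k \<and>
                  (\<exists>f \<in> F. \<exists>g \<in> G. homotopic A X Z (\<lambda>n. g n \<cdot>\<^bsub>A\<^esub> f n) k)}))"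
  "Shift_ob (Kb A) = shift_complex A"
  "Shift_arr (Kb A) = (\<lambda>(X, Y, F). (shift_complex A X, shift_complex A Y, (\<lambda>f n. f (n + 1)) ` F))"
  "Dist (Kb A) = {t. \<exists>X Y f. bounded_map A X Y f
         \<and> isomorphic_triangles (Kb_shift A) t (standard_triangle A X Y f)}"
  by (auto simp: Kb_def Kb_shift_def shift_category.extend_def triangulated_category.fields_def
      bounded_map_def)

lemma Kb_shift_fields:
  "Ob (Kb_shift A) = Ob (Kb A)" "Arr (Kb_shift A) = Arr (Kb A)" "Dom (Kb_shift A) = Dom (Kb A)"
  "Cod (Kb_shift A) = Cod (Kb A)" "Id (Kb_shift A) = Id (Kb A)" "Comp (Kb_shift A) = Comp (Kb A)"
  "Shift_ob (Kb_shift A) = Shift_ob (Kb A)" "Shift_arr (Kb_shift A) = Shift_arr (Kb A)"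
  by (auto simp: Kb_def Kb_shift_def shift_category.extend_def triangulated_category.fields_def)

text \<open>The distinguished triangles of \<open>Kb A\<close> are defined by isomorphisms in
  \<open>Kb_shift A\<close>, before the field \<open>Dist\<close> exists; these equations bring them
  back to \<open>Kb A\<close>.\<close>

lemma Kb_shift_transfer:
  "Hom (Kb_shift A) X Y = Hom (Kb A) X Y"
  "iso_arrow (Kb_shift A) = iso_arrow (Kb A)"
  "triangle (Kb_shift A) = triangle (Kb A)"
  by (auto simp: Hom_def iso_arrow_def inverse_arrows_def triangle_def Kb_shift_fields fun_eq_iff)

lemma homotopy_class_dom_cod [simp]:
  "Dom (Kb A) (homotopy_class A X Y f) = X" "Cod (Kb A) (homotopy_class A X Y f) = Y"
  by (auto simp: Kb_fields homotopy_class_def)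

lemma homotopy_class_arr [simp]:
  "bounded_map A X Y f \<Longrightarrow> homotopy_class A X Y f \<in> Arr (Kb A)"
  by (auto simp: Kb_fields)

lemma homotopy_class_Hom: "bounded_map A X Y f \<Longrightarrow> homotopy_class A X Y f \<in> Hom (Kb A) X Y"
  by (simp add: Hom_iff)

lemma Kb_HomE:
  assumes "u \<in> Hom (Kb A) X Y"
  obtains f where "bounded_map A X Y f" "u = homotopy_class A X Y f"
  using assms by (auto simp: Hom_iff Kb_fields homotopy_class_def)

context additive_category
begin

lemma homotopy_class_eqI:
  assumes f: "bounded_map A X Y f" and g: "bounded_map A X Y g" and fg: "homotopic A X Y f g"
  shows "homotopy_class A X Y f = homotopy_class A X Y g"
proof -
  have "homotopic A X Y f k \<longleftrightarrow> homotopic A X Y g k" if "chain_map A X Y k" for k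
  proof -
    have k: "bounded_map A X Y k" using f that by (simp add: bounded_map_def)
    show ?thesis
      using homotopic_trans[OF k fg] homotopic_trans[OF k homotopic_sym[OF g fg]] by blast
  qed
  then show ?thesis by (auto simp: homotopy_class_def)
qed

lemma homotopy_class_eq_iff:
  assumes f: "bounded_map A X Y f" and g: "bounded_map A X Y g"
  shows "homotopy_class A X Y f = homotopy_class A X Y g \<longleftrightarrow> homotopic A X Y f g"
proof
  assume "homotopy_class A X Y f = homotopy_class A X Y g"
  moreover have "g \<in> {k. chain_map A X Y k \<and> homotopic A X Y g k}"
    using homotopic_refl[OF g] g by (simp add: bounded_map_def)
  ultimately show "homotopic A X Y f g" by (auto simp: homotopy_class_def)
qed (rule homotopy_class_eqI[OF f g])

lemma homotopy_class_comp [simp]: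
  assumes f: "bounded_map A X Y f" and g: "bounded_map A Y Z g"
  shows "homotopy_class A Y Z g \<cdot>\<^bsub>Kb A\<^esub> homotopy_class A X Y f
    = homotopy_class A X Z (\<lambda>n. g n \<cdot> f n)"
proof -
  have "(\<exists>f'. (chain_map A X Y f' \<and> homotopic A X Y f f') \<and>
     (\<exists>g'. (chain_map A Y Z g' \<and> homotopic A Y Z g g') \<and> homotopic A X Z (\<lambda>n. g' n \<cdot> f' n) k))
     \<longleftrightarrow> homotopic A X Z (\<lambda>n. g n \<cdot> f n) k" (is "?L \<longleftrightarrow> ?R") if "chain_map A X Z k" for k
  proof
    have k: "bounded_map A X Z k" using f g that by (simp add: bounded_map_def)
    assume ?L
    then obtain f' g' where *: "chain_map A X Y f'" "homotopic A X Y f f'" "chain_map A Y Z g'"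
      "homotopic A Y Z g g'" "homotopic A X Z (\<lambda>n. g' n \<cdot> f' n) k" by blast
    have f': "bounded_map A X Y f'" and g': "bounded_map A Y Z g'"
      using * f g by (auto simp: bounded_map_def)
    show ?R
      by (rule homotopic_trans[OF k homotopic_comp[OF f' g g' *(2,4)] *(5)])
  next
    assume ?R
    then show ?L using homotopic_refl[OF f] homotopic_refl[OF g] f g by (auto simp: bounded_map_def)
  qed
  then show ?thesis by (auto simp: homotopy_class_def Kb_fields)
qed

lemma Kb_category: "category (Kb A)"
proof
  fix f assume "f \<in> Arr (Kb A)"
  then show "Dom (Kb A) f \<in> Ob (Kb A)" "Cod (Kb A) f \<in> Ob (Kb A)"
    by (auto simp: Kb_fields homotopy_class_def bounded_map_def)
next
  fix X assume "X \<in> Ob (Kb A)"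
  then show "Id (Kb A) X \<in> Hom (Kb A) X X"
    by (auto simp: Kb_fields intro!: homotopy_class_Hom bounded_map_id)
next
  fix f g X Y Z assume "f \<in> Hom (Kb A) X Y" "g \<in> Hom (Kb A) Y Z"
  then show "g \<cdot>\<^bsub>Kb A\<^esub> f \<in> Hom (Kb A) X Z"
    by (auto elim!: Kb_HomE intro!: homotopy_class_Hom bounded_map_comp)
next
  fix f X Y assume "f \<in> Hom (Kb A) X Y"
  then obtain f' where f: "bounded_map A X Y f'" "f = homotopy_class A X Y f'" by (rule Kb_HomE)
  note [simp] = chain_map_simps[OF f(1)]
  have i: "Id (Kb A) X = homotopy_class A X X (\<lambda>n. Id A (obj X n))" for X by (simp add: Kb_fields)
  show "Id (Kb A) Y \<cdot>\<^bsub>Kb A\<^esub> f = f" "f \<cdot>\<^bsub>Kb A\<^esub> Id (Kb A) X = f"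
    using f homotopy_class_comp[OF f(1) bounded_map_id] homotopy_class_comp[OF bounded_map_id f(1)]
    by (auto simp: i)
next
  fix f g h W X Y Z assume "f \<in> Hom (Kb A) W X" "g \<in> Hom (Kb A) X Y" "h \<in> Hom (Kb A) Y Z"
  then obtain f' g' h' where f: "bounded_map A W X f'" "f = homotopy_class A W X f'"
    and g: "bounded_map A X Y g'" "g = homotopy_class A X Y g'"
    and h: "bounded_map A Y Z h'" "h = homotopy_class A Y Z h'" by (elim Kb_HomE) blast
  note [simp] = chain_map_simps[OF f(1)] chain_map_simps[OF g(1)] chain_map_simps[OF h(1)]
  show "h \<cdot>\<^bsub>Kb A\<^esub> (g \<cdot>\<^bsub>Kb A\<^esub> f) = (h \<cdot>\<^bsub>Kb A\<^esub> g) \<cdot>\<^bsub>Kb A\<^esub> f"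
    by (simp add: f g h bounded_map_comp[OF f(1) g(1)] bounded_map_comp[OF g(1) h(1)])
qed

sublocale Kb: category "Kb A" by (rule Kb_category)

lemma Kb_Id: "Id (Kb A) X = homotopy_class A X X (\<lambda>n. Id A (obj X n))"
  by (simp add: Kb_fields)

lemma homotopy_equivalence_iso_arrow:
  assumes "homotopy_equivalence A X Y f g"
  shows "inverse_arrows (Kb A) (homotopy_class A X Y f) (homotopy_class A Y X g)"
proof -
  have f: "bounded_map A X Y f" and g: "bounded_map A Y X g" using assms by (auto simp: homotopy_equivalence_def)
  note b = chain_map_simps(1,2)[OF f]
  show ?thesis unfolding inverse_arrows_def
    using assms f g homotopy_class_eqI[OF bounded_map_comp[OF f g] bounded_map_id[OF b(1)]]
      homotopy_class_eqI[OF bounded_map_comp[OF g f] bounded_map_id[OF b(2)]]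
    by (simp add: homotopy_class_Hom Kb_Id homotopy_equivalence_def)
qed

lemma homotopy_equivalence_isomorphic:
  assumes "homotopy_equivalence A X Y f g"
  shows "isomorphic (Kb A) X Y"
  unfolding isomorphic_def iso_arrow_def
  using homotopy_equivalence_iso_arrow[OF assms] assms homotopy_class_Hom
  unfolding homotopy_equivalence_def by blast

lemma Kb_iso_arrowE:
  assumes "u \<in> Hom (Kb A) X Y" "iso_arrow (Kb A) u"
  obtains f g where "u = homotopy_class A X Y f" "homotopy_equivalence A X Y f g"
proof -
  obtain f where f: "bounded_map A X Y f" "u = homotopy_class A X Y f" using Kb_HomE[OF assms(1)] .
  obtain v where v: "inverse_arrows (Kb A) u v" using assms by (auto simp: iso_arrow_def)
  then have "v \<in> Hom (Kb A) Y X" using f by (auto simp: inverse_arrows_def)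
  then obtain g where g: "bounded_map A Y X g" "v = homotopy_class A Y X g" by (rule Kb_HomE)
  note b = chain_map_simps(1,2)[OF f(1)]
  have "homotopy_equivalence A X Y f g" unfolding homotopy_equivalence_def
    using v f g homotopy_class_eq_iff[OF bounded_map_comp[OF f(1) g(1)] bounded_map_id[OF b(1)]]
     homotopy_class_eq_iff[OF bounded_map_comp[OF g(1) f(1)] bounded_map_id[OF b(2)]]
    by (simp add: inverse_arrows_def Kb_Id)
  then show ?thesis using that f by blast
qed

section \<open>Zero objects of the homotopy category as contractible complexes\<close>

lemma Kb_zero_object_contractible:
  assumes "zero_object (Kb A) Z"
  shows "bounded_complex A Z" "homotopic A Z Z (\<lambda>n. Id A (obj Z n)) (\<lambda>n. Zero A (obj Z n) (obj Z n))"
proof -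
  show b: "bounded_complex A Z" using assms by (auto simp: zero_object_def Kb_fields)
  have "\<exists>!f. f \<in> Hom (Kb A) Z Z" using assms unfolding zero_object_def by blast
  then have "homotopy_class A Z Z (\<lambda>n. Id A (obj Z n)) = homotopy_class A Z Z (\<lambda>n. Zero A (obj Z n) (obj Z n))"
    using homotopy_class_Hom[OF bounded_map_id[OF b]] homotopy_class_Hom[OF bounded_map_zero[OF b b]] by blast
  then show "homotopic A Z Z (\<lambda>n. Id A (obj Z n)) (\<lambda>n. Zero A (obj Z n) (obj Z n))"
    using homotopy_class_eq_iff[OF bounded_map_id[OF b] bounded_map_zero[OF b b]] by simp
qed

lemma homotopic_zero_if_contractible:
  assumes Z: "bounded_complex A Z" "homotopic A Z Z (\<lambda>n. Id A (obj Z n)) (\<lambda>n. Zero A (obj Z n) (obj Z n))"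
  shows "bounded_map A X Z f \<Longrightarrow> homotopic A X Z f (\<lambda>n. Zero A (obj X n) (obj Z n))"
    and "bounded_map A Z X f' \<Longrightarrow> homotopic A Z X f' (\<lambda>n. Zero A (obj Z n) (obj X n))"
proof -
  assume f: "bounded_map A X Z f"
  show "homotopic A X Z f (\<lambda>n. Zero A (obj X n) (obj Z n))"
    using homotopic_comp_right[OF f bounded_map_zero[OF Z(1) Z(1)] Z(2)]
    by (simp add: chain_map_simps[OF f])
next
  assume f: "bounded_map A Z X f'"
  show "homotopic A Z X f' (\<lambda>n. Zero A (obj Z n) (obj X n))"
    using homotopic_comp_left[OF bounded_map_zero[OF Z(1) Z(1)] f Z(2)]
    by (simp add: chain_map_simps[OF f])
qed

lemma contractible_Kb_zero_object:
  assumes Z: "bounded_complex A Z" "homotopic A Z Z (\<lambda>n. Id A (obj Z n)) (\<lambda>n. Zero A (obj Z n) (obj Z n))"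
  shows "zero_object (Kb A) Z"
proof -
  have 1: "u = homotopy_class A X Z (\<lambda>n. Zero A (obj X n) (obj Z n))"
    if u: "u \<in> Hom (Kb A) X Z" for u X
  proof -
    obtain f where f: "bounded_map A X Z f" "u = homotopy_class A X Z f" using Kb_HomE[OF u] by blast
    show ?thesis unfolding f(2)
      by (rule homotopy_class_eqI[OF f(1) bounded_map_zero homotopic_zero_if_contractible(1)[OF Z f(1)]])
        (rule chain_map_simps[OF f(1)])+
  qed
  have 2: "u = homotopy_class A Z X (\<lambda>n. Zero A (obj Z n) (obj X n))"
    if u: "u \<in> Hom (Kb A) Z X" for u X
  proof -
    obtain f where f: "bounded_map A Z X f" "u = homotopy_class A Z X f" using Kb_HomE[OF u] by blast
    show ?thesis unfolding f(2)
      by (rule homotopy_class_eqI[OF f(1) bounded_map_zero homotopic_zero_if_contractible(2)[OF Z f(1)]])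
        (rule chain_map_simps[OF f(1)])+
  qed
  have ob: "X \<in> Ob (Kb A) \<longleftrightarrow> bounded_complex A X" for X by (simp add: Kb_fields)
  have "(\<exists>!f. f \<in> Hom (Kb A) X Z) \<and> (\<exists>!f. f \<in> Hom (Kb A) Z X)" if X: "bounded_complex A X" for X
    by (intro conjI ex1I, rule homotopy_class_Hom[OF bounded_map_zero[OF X Z(1)]], erule 1,
        rule homotopy_class_Hom[OF bounded_map_zero[OF Z(1) X]], erule 2)
  then show ?thesis unfolding zero_object_def using Z(1) by (simp add: ob)
qed

text \<open>\<open>Shift_arr\<close> acts on the whole set of representatives, so every member of
  the target class has to be a translate. Moving such a \<open>g\<close> back to
  \<open>g (n - 1)\<close> gives a chain map again, because the signs of the shifted differentials
  cancel, and its homotopy moves back with a sign.\<close>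

lemma Shift_arr_homotopy_class:
  assumes f: "bounded_map A X Y f"
  shows "Shift_arr (Kb A) (homotopy_class A X Y f)
    = homotopy_class A (shift_complex A X) (shift_complex A Y) (\<lambda>n. f (n + 1))"
proof -
  note [simp] = chain_map_simps[OF f]
  have 1: "chain_map A (shift_complex A X) (shift_complex A Y) (\<lambda>n. g (n + 1))
       \<and> homotopic A (shift_complex A X) (shift_complex A Y) (\<lambda>n. f (n + 1)) (\<lambda>n. g (n + 1))"
    if "chain_map A X Y g" "homotopic A X Y f g" for g
  proof -
    have g: "bounded_map A X Y g" using that by (simp add: bounded_map_def)
    show ?thesis using bounded_map_shift[OF g] homotopic_shift[OF f g that(2)] by (simp add: bounded_map_def)
  qed
  have 2: "g \<in> (\<lambda>f n. f (n + 1)) ` {g. chain_map A X Y g \<and> homotopic A X Y f g}"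
    if "chain_map A (shift_complex A X) (shift_complex A Y) g"
      and hom: "homotopic A (shift_complex A X) (shift_complex A Y) (\<lambda>n. f (n + 1)) g" for g
  proof -
    have "bounded_map A (shift_complex A X) (shift_complex A Y) g" using that by (simp add: bounded_map_def)
    note g [simp] = chain_map_simps(3-)[OF this, simplified]
    have b: "bounded_map A X Y (\<lambda>n. g (n - 1))"
    proof (rule bounded_mapI)
      show "diff Y n \<cdot> g (n - 1) = g (n + 1 - 1) \<cdot> diff X n" for n
        using arg_cong[OF g(4)[of n "n - 1"], of "Neg A"] by simp
    qed auto
    obtain h where h [simp]: "\<And>n. h n \<in> Arr A" "\<And>n. Dom A (h n) = obj X (n + 1)" "\<And>n. Cod A (h n) = obj Y n"
    and eq: "\<And>n. f (n + 1) = g n \<boxplus> ((Neg A (diff Y n) \<cdot> h n) \<boxplus> (h (n + 1) \<cdot> Neg A (diff X (n + 1))))"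
      using homotopicE[OF hom] by simp blast
    have "homotopic A X Y f (\<lambda>n. g (n - 1))"
      by (rule homotopicI[where h = "\<lambda>n. Neg A (h (n - 1))"]) (use eq[of "n - 1" for n] in auto)
    with b show ?thesis by (intro image_eqI[of _ _ "\<lambda>n. g (n - 1)"]) (auto simp: bounded_map_def)
  qed
  have "(\<lambda>f n. f (n + 1)) ` {g. chain_map A X Y g \<and> homotopic A X Y f g} =
     {g. chain_map A (shift_complex A X) (shift_complex A Y) g \<and>
       homotopic A (shift_complex A X) (shift_complex A Y) (\<lambda>n. f (n + 1)) g}"
    using 1 2 by blast
  then show ?thesis by (simp add: Kb_fields homotopy_class_def)
qed

section \<open>Distinguished triangles\<close>

lemma standard_triangle_dist:
  assumes f: "bounded_map A X Y f"
  shows "standard_triangle A X Y f \<in> Dist (Kb A)"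
proof -
  note b [simp] = chain_map_simps(1,2)[OF f] bounded_cone[OF f]
  note m [simp] = f bounded_map_cone_in2[OF f] bounded_map_cone_pr1[OF f]
  have i: "iso_arrow (Kb A) (Id (Kb A) Z)" if "bounded_complex A Z" for Z
    unfolding iso_arrow_def inverse_arrows_def using that Kb.id_arr[of Z] Kb.id_comp(1)[of "Id (Kb A) Z"] Kb.id_hom[of Z]
    by (intro exI[of _ "Id (Kb A) Z"]) (auto simp: Kb_fields(1))
  have s: "Shift_arr (Kb A) (Id (Kb A) X) = Id (Kb A) (shift_complex A X)"
    using Shift_arr_homotopy_class[OF bounded_map_id[OF b(1)]] by (simp add: Kb_Id)
  have "isomorphic_triangles (Kb_shift A) (standard_triangle A X Y f) (standard_triangle A X Y f)"
    unfolding isomorphic_triangles_def standard_triangle_def Kb_shift_transfer Kb_shift_fields split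
    by (intro conjI bexI[of _ "Id (Kb A) X"] bexI[of _ "Id (Kb A) Y"] bexI[of _ "Id (Kb A) (cone A X Y f)"])
      (use i s Kb.id_hom in \<open>auto simp: triangle_def Kb_fields(1,7)\<close>)
  then show ?thesis unfolding Kb_fields using f by blast
qed

text \<open>Of an isomorphism with a standard triangle, only the square over \<open>u\<close> and
  the isomorphism at the third vertex are kept. The former serves to lift arrows, the latter to
  compare the third vertex with a cone.\<close>

lemma DistE:
  assumes "(u, v, w) \<in> Dist (Kb A)"
  obtains X Y f a b c where "bounded_map A X Y f" "u \<in> Hom (Kb A) (Dom (Kb A) u) (Dom (Kb A) v)"
    "a \<in> Hom (Kb A) (Dom (Kb A) u) X" "iso_arrow (Kb A) a"
    "b \<in> Hom (Kb A) (Dom (Kb A) v) Y" "iso_arrow (Kb A) b"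
    "c \<in> Hom (Kb A) (Dom (Kb A) w) (cone A X Y f)" "iso_arrow (Kb A) c"
    "b \<cdot>\<^bsub>Kb A\<^esub> u = homotopy_class A X Y f \<cdot>\<^bsub>Kb A\<^esub> a"
proof -
  obtain X Y f where f: "bounded_map A X Y f" and t: "isomorphic_triangles (Kb_shift A) (u, v, w) (standard_triangle A X Y f)"
    using assms by (auto simp: Kb_fields)
  from t have "triangle (Kb A) (u, v, w)"
    unfolding isomorphic_triangles_def standard_triangle_def Kb_shift_transfer Kb_shift_fields split by blast
  then have u: "u \<in> Hom (Kb A) (Dom (Kb A) u) (Dom (Kb A) v)"
    by (simp add: triangle_def Hom_iff)
  from t obtain a b c where "a \<in> Hom (Kb A) (Dom (Kb A) u) X" "iso_arrow (Kb A) a"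
    "b \<in> Hom (Kb A) (Dom (Kb A) v) Y" "iso_arrow (Kb A) b"
    "c \<in> Hom (Kb A) (Dom (Kb A) w) (cone A X Y f)" "iso_arrow (Kb A) c"
    "b \<cdot>\<^bsub>Kb A\<^esub> u = homotopy_class A X Y f \<cdot>\<^bsub>Kb A\<^esub> a"
    unfolding isomorphic_triangles_def standard_triangle_def Kb_shift_transfer Kb_shift_fields split
      homotopy_class_dom_cod by blast
  with f u show ?thesis using that by blast
qed

end

section \<open>The subcategory generated by the cones\<close>

locale cone_quotient = additive_category A
  for A :: "('o, 'a, 'm) preadditive_category_scheme" (structure) +
  fixes S :: "'a set"
  assumes S_arr: "S \<subseteq> Arr A"
begin

abbreviation D :: "('o, 'a) complex set" where
  "D \<equiv> generated_subcategory (Kb A) (arrow_cone A ` S)"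

abbreviation W :: "('o, 'a) kb_arrow set" where
  "W \<equiv> arrows_with_cone_in (Kb A) D"

lemma D_gen: "s \<in> S \<Longrightarrow> arrow_cone A s \<in> D"
  by (auto simp: generated_subcategory_def)

text \<open>\<open>D\<close> is an intersection of triangulated subcategories, and a closure
  property shared by all of them passes to it. The next lemmas use the same principle.\<close>

lemma D_equivalence:
  assumes "X \<in> D" "homotopy_equivalence A X Y f g"
  shows "Y \<in> D"
proof -
  have "Y \<in> Ob (Kb A)" "isomorphic (Kb A) X Y"
    using assms(2) homotopy_equivalence_isomorphic[OF assms(2)] chain_map_simps(2)
    by (auto simp: Kb_fields homotopy_equivalence_def)
  with assms(1) show ?thesis
    unfolding generated_subcategory_def triangulated_subcategory_def by blast
qed

lemma D_contractible:
  assumes "bounded_complex A Z" "homotopic A Z Z (\<lambda>n. Id A (obj Z n)) (\<lambda>n. Zero A (obj Z n) (obj Z n))"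
  shows "Z \<in> D"
  using contractible_Kb_zero_object[OF assms]
  unfolding generated_subcategory_def triangulated_subcategory_def by blast

lemma D_shift:
  assumes "bounded_complex A X"
  shows "shift_complex A X \<in> D \<longleftrightarrow> X \<in> D"
proof -
  have "X \<in> Ob (Kb A)" "Shift_ob (Kb A) = shift_complex A" using assms by (auto simp: Kb_fields)
  then show ?thesis
    unfolding generated_subcategory_def triangulated_subcategory_def by (simp only: Inter_iff mem_Collect_eq) blast
qed

lemma D_cone:
  assumes f: "bounded_map A X Y f" and "X \<in> D" "Y \<in> D"
  shows "cone A X Y f \<in> D"
proof -
  have *: "Dom (Kb A) w \<in> E" if "(u, v, w) \<in> Dist (Kb A)" "triangulated_subcategory (Kb A) E"
     "Dom (Kb A) u \<in> E" "Dom (Kb A) v \<in> E" for u v w E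
    using that unfolding triangulated_subcategory_def by blast
  have "cone A X Y f \<in> E" if E: "triangulated_subcategory (Kb A) E" "arrow_cone A ` S \<subseteq> E" for E
  proof -
    have "X \<in> E" "Y \<in> E" using assms(2,3) E unfolding generated_subcategory_def by blast+
    then show ?thesis
      using *[OF standard_triangle_dist[OF f, unfolded standard_triangle_def] E(1)] by simp
  qed
  then show ?thesis by (auto simp: generated_subcategory_def)
qed

lemma D_reindex_1:
  assumes b: "bounded_complex A X"
  shows "reindex 1 X \<in> D \<longleftrightarrow> X \<in> D"
proof -
  obtain f g where "homotopy_equivalence A (shift_complex A X) (reindex 1 X) f g"
    using shift_reindex_equivalence[OF b] by blast
  then show ?thesis
    using D_equivalence D_shift[OF b] homotopy_equivalence_sym by blast
qed

lemma D_reindex: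
  assumes X: "bounded_complex A X" "X \<in> D"
  shows "reindex m X \<in> D"
\<comment> \<open>The induction runs in both directions, which is possible because
  \<open>D_reindex_1\<close> is an equivalence.\<close>
proof (induction m rule: int_induct[where k = 0])
  case base
  then show ?case using X by simp
next
  case (step1 i)
  then show ?case using D_reindex_1[OF bounded_reindex[OF X(1)], of i] by (simp add: add.commute)
next
  case (step2 i)
  then show ?case using D_reindex_1[OF bounded_reindex[OF X(1)], of "i - 1"] by simp
qed

lemma W_I:
  assumes f: "bounded_map A X Y f" and "cone A X Y f \<in> D"
  shows "homotopy_class A X Y f \<in> W"
  unfolding arrows_with_cone_in_def mem_Collect_eq
  by (intro exI conjI, rule standard_triangle_dist[OF f, unfolded standard_triangle_def])
    (simp add: assms(2))

section \<open>Morphisms of \<open>A\<close> whose cone lies in \<open>D\<close>\<close>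

lemma D_arrow_cone_iso:
  assumes s: "s \<in> Hom A U V" "s' \<in> Hom A V U" "s' \<cdot> s = Id A U" "s \<cdot> s' = Id A V"
  shows "arrow_cone A s \<in> D"
  using D_contractible[OF _ arrow_cone_contractible[OF s]] s by (simp add: Hom_iff)

text \<open>The matrix is triangular with diagonal \<open>s\<close>, \<open>r\<close>, and its
  two-term complex is an extension of that of \<open>s\<close> by that of \<open>r\<close>: the cone
  of a chain map from the first, moved one degree up, to the second.\<close>

lemma D_arrow_cone_triangular:
  assumes s: "s \<in> Hom A P Q" "arrow_cone A s \<in> D"
    and r: "r \<in> Hom A U V" "arrow_cone A r \<in> D"
    and k: "k \<in> Hom A P V"
  shows "arrow_cone A ((in1 A Q V \<cdot> (s \<cdot> pr1 A P U)) \<boxplus> (in2 A Q V \<cdot> ((k \<cdot> pr1 A P U) \<boxplus> (r \<cdot> pr2 A P U)))) \<in> D"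
    (is "arrow_cone A ?s \<in> D")
proof -
  have [simp]: "s \<in> Arr A" "Dom A s = P" "Cod A s = Q" "r \<in> Arr A" "Dom A r = U" "Cod A r = V"
     "k \<in> Arr A" "Dom A k = P" "Cod A k = V"
    using assms by (auto simp: Hom_iff)
  have [simp]: "P \<in> Ob A" "Q \<in> Ob A" "U \<in> Ob A" "V \<in> Ob A"
    using dom_cod_ob[of s] dom_cod_ob[of r] by auto
  have bs [simp]: "bounded_complex A (arrow_cone A s)" and br [simp]: "bounded_complex A (arrow_cone A r)"
    by auto
  \<comment> \<open>\<open>?N\<close> has \<open>P\<close> in degree 0 and \<open>Q\<close> in
    degree 1, so \<open>k\<close> in degree 0 is a chain map to the complex of \<open>r\<close>. The
    sign from moving and the sign from the cone cancel on \<open>s\<close>.\<close>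
  let ?N = "unshift_complex A (arrow_cone A s)"
  define kk where "kk n = (if n = 0 then k else Zero A (obj ?N n) (obj (arrow_cone A r) n))" for n
  have [simp]: "kk n \<in> Arr A" "Dom A (kk n) = obj ?N n" "Cod A (kk n) = obj (arrow_cone A r) n" for n
    by (auto simp: kk_def)
  have kk: "bounded_map A ?N (arrow_cone A r) kk"
  proof (rule bounded_mapI)
    show "diff (arrow_cone A r) n \<cdot> kk n = kk (n + 1) \<cdot> diff ?N n" for n
      by (cases "n < 0"; rule arr_zero_ob_eq) auto
  qed auto
  have D: "cone A ?N (arrow_cone A r) kk \<in> D"
    using D_cone[OF kk] s r D_shift[of ?N] by simp
  have [simp]: "?s \<in> Arr A" "Dom A ?s = sum_ob A P U" "Cod A ?s = sum_ob A Q V" by auto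
  note bk = bounded_cone[OF kk]
  have "\<exists>f g. homotopy_equivalence A (cone A ?N (arrow_cone A r) kk) (arrow_cone A ?s) f g"
  proof (rule homotopy_equivalence_two_term[where a = "Id A (sum_ob A P U)" and a' = "Id A (sum_ob A P U)"
        and b = "Id A (sum_ob A Q V)" and b' = "Id A (sum_ob A Q V)"], goal_cases)
    case (2 n)
    then show ?case by (auto intro!: sum_zero_object)
  next
    case 13
    have "diff (cone A ?N (arrow_cone A r) kk) (- 1) = ?s"
      by (simp add: cone_diff kk_def)
    then show ?case by simp
  qed (use bk in \<open>auto simp: Hom_iff\<close>)
  then show ?thesis using D D_equivalence by blast
qed

lemma D_arrow_cone_comp_iso:
  assumes s: "s \<in> Hom A P Q" "arrow_cone A s \<in> D"
    and a: "a \<in> Hom A P' P" "a' \<in> Hom A P P'" "a' \<cdot> a = Id A P'" "a \<cdot> a' = Id A P"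
    and b: "b \<in> Hom A Q Q'" "b' \<in> Hom A Q' Q" "b' \<cdot> b = Id A Q" "b \<cdot> b' = Id A Q'"
  shows "arrow_cone A (b \<cdot> (s \<cdot> a)) \<in> D"
proof -
  have [simp]: "s \<in> Arr A" "Dom A s = P" "Cod A s = Q"
     "a \<in> Arr A" "Dom A a = P'" "Cod A a = P" "a' \<in> Arr A" "Dom A a' = P" "Cod A a' = P'"
     "b \<in> Arr A" "Dom A b = Q" "Cod A b = Q'" "b' \<in> Arr A" "Dom A b' = Q'" "Cod A b' = Q"
    using assms by (auto simp: Hom_iff)
  have "\<exists>f g. homotopy_equivalence A (arrow_cone A s) (arrow_cone A (b \<cdot> (s \<cdot> a))) f g"
    by (rule arrow_cone_equivalence[where a = a' and a' = a and b = b and b' = b'])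
      (use assms in \<open>auto simp: Hom_iff\<close>)
  then show ?thesis using s D_equivalence by blast
qed

text \<open>Chosen sums are not strictly associative. The isomorphism is written out as a matrix
  because \<open>resolution_fib\<close> has to compose with it explicitly.\<close>

lemma sum_assoc_iso:
  assumes [simp]: "P \<in> Ob A" "Q \<in> Ob A" "R \<in> Ob A"
  defines "b \<equiv> (in1 A P (sum_ob A Q R) \<cdot> (pr1 A P Q \<cdot> pr1 A (sum_ob A P Q) R))
      \<boxplus> (in2 A P (sum_ob A Q R) \<cdot> ((in1 A Q R \<cdot> (pr2 A P Q \<cdot> pr1 A (sum_ob A P Q) R))
         \<boxplus> (in2 A Q R \<cdot> pr2 A (sum_ob A P Q) R)))"
  shows "b \<in> Hom A (sum_ob A (sum_ob A P Q) R) (sum_ob A P (sum_ob A Q R))"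
    "\<exists>b' \<in> Hom A (sum_ob A P (sum_ob A Q R)) (sum_ob A (sum_ob A P Q) R).
       b' \<cdot> b = Id A (sum_ob A (sum_ob A P Q) R) \<and> b \<cdot> b' = Id A (sum_ob A P (sum_ob A Q R))"
proof -
  define b' where "b' = (in1 A (sum_ob A P Q) R \<cdot> ((in1 A P Q \<cdot> pr1 A P (sum_ob A Q R))
      \<boxplus> (in2 A P Q \<cdot> (pr1 A Q R \<cdot> pr2 A P (sum_ob A Q R)))))
      \<boxplus> (in2 A (sum_ob A P Q) R \<cdot> (pr2 A Q R \<cdot> pr2 A P (sum_ob A Q R)))"
  have b [simp]: "b \<in> Arr A" "Dom A b = sum_ob A (sum_ob A P Q) R" "Cod A b = sum_ob A P (sum_ob A Q R)"
    by (auto simp: b_def)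
  have b' [simp]: "b' \<in> Arr A" "Cod A b' = sum_ob A (sum_ob A P Q) R" "Dom A b' = sum_ob A P (sum_ob A Q R)"
    by (auto simp: b'_def)
  show "b \<in> Hom A (sum_ob A (sum_ob A P Q) R) (sum_ob A P (sum_ob A Q R))" by (simp add: Hom_iff)
  have 1: "b \<cdot> (in1 A (sum_ob A P Q) R \<cdot> in1 A P Q) = in1 A P (sum_ob A Q R)"
    "b \<cdot> (in1 A (sum_ob A P Q) R \<cdot> in2 A P Q) = in2 A P (sum_ob A Q R) \<cdot> in1 A Q R"
    "b \<cdot> in2 A (sum_ob A P Q) R = in2 A P (sum_ob A Q R) \<cdot> in2 A Q R"
    by (simp_all add: b_def)
  have 2: "b' \<cdot> in1 A P (sum_ob A Q R) = in1 A (sum_ob A P Q) R \<cdot> in1 A P Q"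
    "b' \<cdot> (in2 A P (sum_ob A Q R) \<cdot> in1 A Q R) = in1 A (sum_ob A P Q) R \<cdot> in2 A P Q"
    "b' \<cdot> (in2 A P (sum_ob A Q R) \<cdot> in2 A Q R) = in2 A (sum_ob A P Q) R"
    by (simp_all add: b'_def)
  have "b' \<cdot> b = Id A (sum_ob A (sum_ob A P Q) R)"
    apply (rule bp_eqI_from[of _ _ "sum_ob A P Q" R])
    apply (simp_all add: 1 2)
    by (rule bp_eqI_from[of _ _ P Q]) (simp_all add: 1 2)
  moreover have "b \<cdot> b' = Id A (sum_ob A P (sum_ob A Q R))"
    apply (rule bp_eqI_from[of _ _ P "sum_ob A Q R"])
    apply (simp_all add: 1 2)
    by (rule bp_eqI_from[of _ _ Q R]) (simp_all add: 1 2)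
  ultimately show "\<exists>b' \<in> Hom A (sum_ob A P (sum_ob A Q R)) (sum_ob A (sum_ob A P Q) R).
       b' \<cdot> b = Id A (sum_ob A (sum_ob A P Q) R) \<and> b \<cdot> b' = Id A (sum_ob A P (sum_ob A Q R))"
    using b' by (intro bexI[of _ b']) (auto simp: Hom_iff)
qed

lemma pr1_zero_iso:
  assumes [simp]: "P \<in> Ob A" and Z: "zero_object A Z"
  shows "in1 A P Z \<cdot> pr1 A P Z = Id A (sum_ob A P Z)"
proof (rule bp_eqI_to[of _ _ P Z])
  have [simp]: "Z \<in> Ob A" using Z by (rule zero_ob_ob)
  show "pr2 A P Z \<cdot> (in1 A P Z \<cdot> pr1 A P Z) = pr2 A P Z \<cdot> Id A (sum_ob A P Z)"
    by (rule arr_zero_ob_eq) (use Z in auto)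
qed (use zero_ob_ob[OF Z] in auto)

end

section \<open>Zigzags\<close>

declare zz_trans [trans]

lemma loc_class_eqI: "zz_eq C W X Y p q \<Longrightarrow> loc_class C W X Y p = loc_class C W X Y q"
  unfolding loc_class_def by (auto intro: zz_trans zz_sym)

lemma localization_comp:
  assumes "zigzag C W X Y p" "zigzag C W Y Z q"
  shows "loc_class C W Y Z q \<cdot>\<^bsub>localization C W\<^esub> loc_class C W X Y p = loc_class C W X Z (p @ q)"
proof -
  have "(\<exists>p' \<in> {r. zz_eq C W X Y p r}. \<exists>q' \<in> {r. zz_eq C W Y Z q r}. zz_eq C W X Z (p' @ q') r)
     \<longleftrightarrow> zz_eq C W X Z (p @ q) r" for r
    using zz_refl[OF assms(1)] zz_refl[OF assms(2)] by (blast intro: zz_append zz_trans)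
  then show ?thesis by (simp add: loc_class_def localization_def)
qed

lemma localization_arr: "zigzag C W X Y p \<Longrightarrow> loc_class C W X Y p \<in> Arr (localization C W)"
  by (auto simp: localization_def)

lemma localization_dom_cod:
  "Dom (localization C W) (loc_class C W X Y p) = X"
  "Cod (localization C W) (loc_class C W X Y p) = Y"
  by (auto simp: localization_def loc_class_def)

lemma localization_HomE:
  assumes "f \<in> Hom (localization C W) X Y"
  obtains p where "zigzag C W X Y p" "f = loc_class C W X Y p"
  using assms by (auto simp: Hom_iff localization_def loc_class_def)

text \<open>Expresses that the image of \<open>t\<close> in \<open>localization C W\<close> is an
  epimorphism, in terms of representatives. Zigzags are read in the order of traversal, so
  \<open>t\<close> is the first letter.\<close>

definition loc_epi ::
    "('o, 'a, 'm) category_scheme \<Rightarrow> 'a set \<Rightarrow> 'a \<Rightarrow> bool" where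
  "loc_epi C W t \<longleftrightarrow> (\<forall>Z p q. zigzag C W (Cod C t) Z p \<longrightarrow> zigzag C W (Cod C t) Z q
     \<longrightarrow> zz_eq C W (Dom C t) Z (Fwd t # p) (Fwd t # q) \<longrightarrow> zz_eq C W (Cod C t) Z p q)"

context category
begin

lemma zigzag_append: "zigzag C W X Y p \<Longrightarrow> zigzag C W Y Z q \<Longrightarrow> zigzag C W X Z (p @ q)"
  by (induction rule: zigzag.induct) (auto intro: zigzag.intros)

lemma zigzag_Fwd: "f \<in> Hom C X Y \<Longrightarrow> zigzag C W X Y [Fwd f]"
  by (rule zz_fwd, assumption, rule zz_nil) (auto simp: Hom_iff)

lemma zigzag_Bwd: "w \<in> Hom C X Y \<Longrightarrow> w \<in> W \<Longrightarrow> zigzag C W Y X [Bwd w]"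
  by (rule zz_bwd, assumption, assumption, rule zz_nil) (auto simp: Hom_iff)

lemma zz_prefix:
  "zz_eq C W X Y p p' \<Longrightarrow> zigzag C W Y Z q \<Longrightarrow> zz_eq C W X Z (p @ q) (p' @ q)"
  by (intro zz_append zz_refl)

lemma zz_suffix:
  "zigzag C W X Y p \<Longrightarrow> zz_eq C W Y Z q q' \<Longrightarrow> zz_eq C W X Z (p @ q) (p @ q')"
  by (intro zz_append zz_refl)

lemma zz_Fwd_comp:
  assumes "f \<in> Hom C X Y" "g \<in> Hom C Y Z" "zigzag C W Z V q"
  shows "zz_eq C W X V (Fwd f # Fwd g # q) (Fwd (g \<cdot> f) # q)"
  using zz_prefix[OF zz_comp[OF assms(1,2)] assms(3)] by simp

lemma zz_Fwd_Bwd: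
  assumes "w \<in> Hom C X Y" "w \<in> W" "zigzag C W X V q"
  shows "zz_eq C W X V (Fwd w # Bwd w # q) q"
  using zz_prefix[OF zz_fwd_bwd[OF assms(2,1)] assms(3)] by simp

lemma zz_Bwd_Fwd:
  assumes "w \<in> Hom C X Y" "w \<in> W" "zigzag C W Y V q"
  shows "zz_eq C W Y V (Bwd w # Fwd w # q) q"
  using zz_prefix[OF zz_bwd_fwd[OF assms(2,1)] assms(3)] by simp

lemma zz_Fwd_Id:
  assumes "zigzag C W X V q" "X \<in> Ob C"
  shows "zz_eq C W X V (Fwd (Id C X) # q) q"
  using zz_prefix[OF zz_id[OF assms(2)] assms(1)] by simp

lemma zz_Fwd_cong:
  "f \<in> Hom C X Y \<Longrightarrow> zz_eq C W Y Z q q' \<Longrightarrow> zz_eq C W X Z (Fwd f # q) (Fwd f # q')"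
  using zz_suffix[OF zigzag_Fwd] by fastforce

lemma loc_epi_Id:
  assumes "X \<in> Ob C" shows "loc_epi C W (Id C X)"
  unfolding loc_epi_def using assms zz_Fwd_Id
  by (simp add: id_arr) (blast intro: zz_trans zz_sym)

text \<open>Prepending the formal inverse \<open>Bwd t\<close> to both sides cancels
  \<open>Fwd t\<close>.\<close>

lemma loc_epi_inverted:
  assumes t: "t \<in> Hom C X Y" "t \<in> W" shows "loc_epi C W t"
  unfolding loc_epi_def
proof (intro allI impI)
  have [simp]: "Dom C t = X" "Cod C t = Y" using t by (auto simp: Hom_iff)
  fix Z p q assume p: "zigzag C W (Cod C t) Z p" and q: "zigzag C W (Cod C t) Z q"
    and eq: "zz_eq C W (Dom C t) Z (Fwd t # p) (Fwd t # q)"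
  have "zz_eq C W Y Z p (Bwd t # Fwd t # p)"
    using zz_Bwd_Fwd[OF t] p by (auto intro: zz_sym)
  also have "zz_eq C W Y Z (Bwd t # Fwd t # p) (Bwd t # Fwd t # q)"
    using zz_suffix[OF zigzag_Bwd[OF t]] eq by fastforce
  also have "zz_eq C W Y Z (Bwd t # Fwd t # q) q"
    using zz_Bwd_Fwd[OF t] q by auto
  finally show "zz_eq C W (Cod C t) Z p q" by simp
qed

lemma loc_epi_comp:
  assumes t: "t \<in> Hom C Y Z" "loc_epi C W t" and r: "r \<in> Hom C X Y" "loc_epi C W r"
  shows "loc_epi C W (t \<cdot> r)"
  unfolding loc_epi_def
proof (intro allI impI)
  have [simp]: "Dom C t = Y" "Cod C t = Z" "t \<in> Arr C" "Dom C r = X" "Cod C r = Y" "r \<in> Arr C"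
    using t r by (auto simp: Hom_iff)
  fix V p q assume p: "zigzag C W (Cod C (t \<cdot> r)) V p" and q: "zigzag C W (Cod C (t \<cdot> r)) V q"
    and eq: "zz_eq C W (Dom C (t \<cdot> r)) V (Fwd (t \<cdot> r) # p) (Fwd (t \<cdot> r) # q)"
  have p: "zigzag C W Z V p" and q: "zigzag C W Z V q" using p q by auto
  have "zz_eq C W X V (Fwd r # Fwd t # p) (Fwd (t \<cdot> r) # p)" by (rule zz_Fwd_comp[OF r(1) t(1) p])
  also have "zz_eq C W X V (Fwd (t \<cdot> r) # p) (Fwd (t \<cdot> r) # q)" using eq by simp
  also have "zz_eq C W X V (Fwd (t \<cdot> r) # q) (Fwd r # Fwd t # q)"
    by (rule zz_sym, rule zz_Fwd_comp[OF r(1) t(1) q])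
  finally have "zz_eq C W Y V (Fwd t # p) (Fwd t # q)"
    using r(2) zz_fwd[OF t(1) p] zz_fwd[OF t(1) q] by (simp add: loc_epi_def)
  then show "zz_eq C W (Cod C (t \<cdot> r)) V p q"
    using t(2) p q by (simp add: loc_epi_def)
qed

end

section \<open>Resolutions\<close>

context cone_quotient
begin

text \<open>The last clause makes the column \<open>(t 0, c \<cdot> diff M 0)\<close> invertible in
  the quotient while it remains a morphism of \<open>A\<close>. \<open>T\<close> and
  \<open>c\<close> are existential because refining a resolution may enlarge
  \<open>T\<close>.\<close>

definition resolution :: "'o \<Rightarrow> ('o, 'a) complex \<Rightarrow> (int \<Rightarrow> 'a) \<Rightarrow> bool" where
  "resolution X M t \<longleftrightarrow> bounded_map A M (conc_ob A X) t \<and> (\<forall>n < 0. zero_object A (obj M n))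
     \<and> loc_epi (Kb A) W (homotopy_class A M (conc_ob A X) t)
     \<and> (\<exists>T \<in> Ob A. \<exists>c \<in> Hom A (obj M 1) T.
          arrow_cone A ((in1 A X T \<cdot> t 0) \<boxplus> (in2 A X T \<cdot> (c \<cdot> diff M 0))) \<in> D)"

lemma resolution_id:
  assumes X: "X \<in> Ob A"
  shows "resolution X (conc_ob A X) (\<lambda>n. Id A (obj (conc_ob A X) n))"
  unfolding resolution_def
proof (intro conjI bexI)
  show "bounded_map A (conc_ob A X) (conc_ob A X) (\<lambda>n. Id A (obj (conc_ob A X) n))"
    using bounded_map_id X by simp
  show "loc_epi (Kb A) W (homotopy_class A (conc_ob A X) (conc_ob A X) (\<lambda>n. Id A (obj (conc_ob A X) n)))"
    using Kb.loc_epi_Id[of "conc_ob A X" W] X by (simp add: Kb_fields)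
  show "Zero A (zero_ob A) (zero_ob A) \<in> Hom A (obj (conc_ob A X) 1) (zero_ob A)" by (simp add: Hom_iff)
  \<comment> \<open>With \<open>T\<close> the zero object the column is the inclusion of
    \<open>X\<close> into its sum with 0, which is an isomorphism.\<close>
  have "arrow_cone A (in1 A X (zero_ob A)) \<in> D"
    by (rule D_arrow_cone_iso[of _ X "sum_ob A X (zero_ob A)" "pr1 A X (zero_ob A)"])
      (use X pr1_zero_iso[OF X zero_ob_zero] in \<open>auto simp: Hom_iff\<close>)
  then show "arrow_cone A ((in1 A X (zero_ob A) \<cdot> Id A (obj (conc_ob A X) 0)) \<boxplus>
      (in2 A X (zero_ob A) \<cdot> (Zero A (zero_ob A) (zero_ob A) \<cdot> diff (conc_ob A X) 0))) \<in> D"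
    using X by (simp add: conc_ob_diff)
qed (use X in auto)

text \<open>The cone of the fibre map is \<open>K\<close> up to homotopy, so the fibre map is
  inverted and the composite with \<open>t\<close> stays an epimorphism. Degree 0 of the fibre is
  the sum of \<open>obj M 0\<close> and \<open>obj K (- 1)\<close>: if the second summand vanishes,
  the column changes by an isomorphism; in the other case it is enlarged to a triangular matrix with
  second diagonal entry \<open>diff K (- 1)\<close>.\<close>

lemma resolution_fib:
  assumes res: "resolution X M t" and X: "X \<in> Ob A"
    and k: "bounded_map A M K k" and K: "K \<in> D" "\<And>n. n < - 1 \<Longrightarrow> zero_object A (obj K n)"
    and KD: "zero_object A (obj K (- 1)) \<or> arrow_cone A (diff K (- 1)) \<in> D"
  shows "resolution X (fib A M K k) (\<lambda>n. t n \<cdot> fib_map A M K n)"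
proof -
  let ?F = "fib A M K k"
  have t: "bounded_map A M (conc_ob A X) t" and M: "\<And>n. n < 0 \<Longrightarrow> zero_object A (obj M n)"
    and epi: "loc_epi (Kb A) W (homotopy_class A M (conc_ob A X) t)"
    using res by (auto simp: resolution_def)
  obtain T c where T [simp]: "T \<in> Ob A" and c: "c \<in> Hom A (obj M 1) T" and
    s: "arrow_cone A ((in1 A X T \<cdot> t 0) \<boxplus> (in2 A X T \<cdot> (c \<cdot> diff M 0))) \<in> D" (is "arrow_cone A ?s \<in> D")
    using res by (auto simp: resolution_def)
  note m = bounded_map_fib_map[OF k]
  note [simp] = chain_map_simps(1,2)[OF k] chain_map_simps(3-5)[OF k] chain_map_simps(3-5)[OF t] X
  have [simp]: "c \<in> Arr A" "Dom A c = obj M 1" "Cod A c = T" using c by (auto simp: Hom_iff)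
  have "homotopy_class A ?F M (fib_map A M K) \<in> W"
    using W_I[OF m] fib_map_cone_equivalence[OF k] D_equivalence K(1) by blast
  then have "loc_epi (Kb A) W (homotopy_class A ?F M (fib_map A M K))"
    using Kb.loc_epi_inverted homotopy_class_Hom[OF m] by blast
  then have "loc_epi (Kb A) W (homotopy_class A M (conc_ob A X) t \<cdot>\<^bsub>Kb A\<^esub> homotopy_class A ?F M (fib_map A M K))"
    using Kb.loc_epi_comp homotopy_class_Hom[OF m] homotopy_class_Hom[OF t] epi by blast
  then have 1: "loc_epi (Kb A) W (homotopy_class A ?F (conc_ob A X) (\<lambda>n. t n \<cdot> fib_map A M K n))"
    using m t by simp
  let ?M0 = "obj M 0" and ?U = "obj K (- 1)" and ?V = "obj K 0" and ?M1 = "obj M 1"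
  have d0: "diff ?F 0 = (in1 A ?M1 ?V \<cdot> (diff M 0 \<cdot> pr1 A ?M0 ?U))
       \<boxplus> (in2 A ?M1 ?V \<cdot> (Neg A (k 0 \<cdot> pr1 A ?M0 ?U) \<boxplus> Neg A (diff K (- 1) \<cdot> pr2 A ?M0 ?U)))"
    using fib_diff'[OF k, of 0] by simp
  have [simp]: "Cod A (diff M 0) = ?M1" "Cod A (diff K (- 1)) = ?V" "Cod A (t 0) = X" by simp_all
  have [simp]: "?s \<in> Arr A" "Dom A ?s = ?M0" "Cod A ?s = sum_ob A X T" by simp_all
  from KD have "\<exists>T' \<in> Ob A. \<exists>c' \<in> Hom A (obj ?F 1) T'.
          arrow_cone A ((in1 A X T' \<cdot> (t 0 \<cdot> fib_map A M K 0)) \<boxplus> (in2 A X T' \<cdot> (c' \<cdot> diff ?F 0))) \<in> D"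
  proof
    assume U: "zero_object A ?U"
    have "arrow_cone A (Id A (sum_ob A X T) \<cdot> (?s \<cdot> pr1 A ?M0 ?U)) \<in> D"
      by (rule D_arrow_cone_comp_iso[OF _ s, where a' = "in1 A ?M0 ?U" and b' = "Id A (sum_ob A X T)"])
        (use pr1_zero_iso[OF _ U] in \<open>auto simp: Hom_iff\<close>)
    then have "arrow_cone A ((in1 A X T \<cdot> (t 0 \<cdot> fib_map A M K 0)) \<boxplus>
        (in2 A X T \<cdot> ((c \<cdot> pr1 A ?M1 ?V) \<cdot> diff ?F 0))) \<in> D"
      by (simp add: fib_map_def d0)
    then show ?thesis
      by (intro bexI[of _ T] bexI[of _ "c \<cdot> pr1 A ?M1 ?V"]) (auto simp: Hom_iff)
  next
    assume r: "arrow_cone A (diff K (- 1)) \<in> D"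
    let ?T = "sum_ob A T ?V"
    \<comment> \<open>The minus sign on the component into \<open>?V\<close> cancels those in
      \<open>d0\<close>, so that \<open>?c \<cdot> diff ?F 0\<close> contains the bottom row of
      \<open>?s'\<close> unchanged.\<close>
    let ?c = "(in1 A T ?V \<cdot> (c \<cdot> pr1 A ?M1 ?V)) \<boxplus> (in2 A T ?V \<cdot> Neg A (pr2 A ?M1 ?V))"
    let ?s' = "(in1 A (sum_ob A X T) ?V \<cdot> (?s \<cdot> pr1 A ?M0 ?U))
      \<boxplus> (in2 A (sum_ob A X T) ?V \<cdot> ((k 0 \<cdot> pr1 A ?M0 ?U) \<boxplus> (diff K (- 1) \<cdot> pr2 A ?M0 ?U)))"
    have s': "arrow_cone A ?s' \<in> D"
      by (rule D_arrow_cone_triangular[OF _ s _ r]) (auto simp: Hom_iff)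
    define b where "b = (in1 A X (sum_ob A T ?V) \<cdot> (pr1 A X T \<cdot> pr1 A (sum_ob A X T) ?V))
      \<boxplus> (in2 A X (sum_ob A T ?V) \<cdot> ((in1 A T ?V \<cdot> (pr2 A X T \<cdot> pr1 A (sum_ob A X T) ?V))
         \<boxplus> (in2 A T ?V \<cdot> pr2 A (sum_ob A X T) ?V)))"
    obtain b' where b: "b \<in> Hom A (sum_ob A (sum_ob A X T) ?V) (sum_ob A X ?T)"
       "b' \<in> Hom A (sum_ob A X ?T) (sum_ob A (sum_ob A X T) ?V)"
       "b' \<cdot> b = Id A (sum_ob A (sum_ob A X T) ?V)" "b \<cdot> b' = Id A (sum_ob A X ?T)"
      using sum_assoc_iso[of X T ?V] unfolding b_def by auto
    have [simp]: "?s' \<in> Arr A" "Dom A ?s' = sum_ob A ?M0 ?U" "Cod A ?s' = sum_ob A (sum_ob A X T) ?V"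
      by simp_all
    have "arrow_cone A (b \<cdot> (?s' \<cdot> Id A (sum_ob A ?M0 ?U))) \<in> D"
      by (rule D_arrow_cone_comp_iso[OF _ s', where a' = "Id A (sum_ob A ?M0 ?U)" and b' = b'])
        (use b in \<open>auto simp: Hom_iff\<close>)
    moreover have "b \<cdot> (?s' \<cdot> Id A (sum_ob A ?M0 ?U)) =
        (in1 A X ?T \<cdot> (t 0 \<cdot> fib_map A M K 0)) \<boxplus> (in2 A X ?T \<cdot> (?c \<cdot> diff ?F 0))"
      by (simp add: b_def fib_map_def d0 add_ac)
    ultimately show ?thesis
      by (intro bexI[of _ ?T] bexI[of _ ?c]) (auto simp: Hom_iff)
  qed
  then show ?thesis unfolding resolution_def
    using 1 bounded_map_comp[OF m t] M K(2) by (auto intro!: sum_zero_object)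
qed

text \<open>The composite with \<open>t\<close> is required to be a resolution, and no condition
  beyond being a chain map is put on \<open>r\<close> itself. Successive refinements therefore
  remain resolutions of the same \<open>X\<close>.\<close>

definition refinable :: "'o \<Rightarrow> ('o, 'a) complex \<Rightarrow> bool" where
  "refinable X K \<longleftrightarrow> (\<forall>M t k. resolution X M t \<longrightarrow> bounded_map A M K k \<longrightarrow>
     (\<exists>M' r. bounded_map A M' M r \<and> resolution X M' (\<lambda>n. t n \<cdot> r n) \<and>
        homotopic A M' K (\<lambda>n. k n \<cdot> r n) (\<lambda>n. Zero A (obj M' n) (obj K n))))"

section \<open>Closure properties of refinable complexes\<close>

lemma resolution_comp_id:
  assumes "resolution X M t"
  shows "resolution X M (\<lambda>n. t n \<cdot> Id A (obj M n))"
proof -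
  have t: "bounded_map A M (conc_ob A X) t" using assms by (simp add: resolution_def)
  have "(\<lambda>n. t n \<cdot> Id A (obj M n)) = t" using chain_map_simps[OF t] by auto
  then show ?thesis using assms by simp
qed

lemma refinable_null:
  assumes "resolution X M t" and k: "bounded_map A M K k"
    and null: "homotopic A M K k (\<lambda>n. Zero A (obj M n) (obj K n))"
  shows "\<exists>M' r. bounded_map A M' M r \<and> resolution X M' (\<lambda>n. t n \<cdot> r n) \<and>
        homotopic A M' K (\<lambda>n. k n \<cdot> r n) (\<lambda>n. Zero A (obj M' n) (obj K n))"
  by (intro exI[of _ M] exI[of _ "\<lambda>n. Id A (obj M n)"] conjI)
    (use assms resolution_comp_id bounded_map_id chain_map_simps[OF k] in auto)

lemma refinable_generator:
  assumes X: "X \<in> Ob A" and s: "s \<in> S"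
  shows "refinable X (reindex m (arrow_cone A s))"
  unfolding refinable_def
proof (intro allI impI)
  fix M t k
  let ?K = "reindex m (arrow_cone A s)"
  assume res: "resolution X M t" and k: "bounded_map A M ?K k"
  have [simp]: "s \<in> Arr A" using s S_arr by auto
  have b: "bounded_complex A (arrow_cone A s)" by simp
  have M: "\<And>n. n < 0 \<Longrightarrow> zero_object A (obj M n)" using res by (auto simp: resolution_def)
  show "\<exists>M' r. bounded_map A M' M r \<and> resolution X M' (\<lambda>n. t n \<cdot> r n) \<and>
        homotopic A M' ?K (\<lambda>n. k n \<cdot> r n) (\<lambda>n. Zero A (obj M' n) (obj ?K n))"
  proof (cases "m > 0")
    \<comment> \<open>The complex is now concentrated in the negative degrees \<open>- 1 - m\<close>
      and \<open>- m\<close>, where \<open>M\<close> vanishes.\<close>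
    case True
    have "k n = Zero A (obj M n) (obj ?K n)" for n
      by (cases "n < 0"; rule arr_zero_ob_eq) (use chain_map_simps(1-5)[OF k] M[of n] True in auto)
    then have "k = (\<lambda>n. Zero A (obj M n) (obj ?K n))" by auto
    then show ?thesis using refinable_null[OF res k] homotopic_refl[OF k] by simp
  next
    case False
    \<comment> \<open>The complex now lives in degrees at least -1. It is nonzero in degree -1 only
      for \<open>m = 0\<close>, and then its differential there is the generator
      \<open>s\<close>.\<close>
    have "resolution X (fib A M ?K k) (\<lambda>n. t n \<cdot> fib_map A M ?K n)"
    proof (rule resolution_fib[OF res X k D_reindex[OF b D_gen[OF s]]])
      show "zero_object A (obj ?K n)" if "n < - 1" for n
        using that False by simp
      show "zero_object A (obj ?K (- 1)) \<or> arrow_cone A (diff ?K (- 1)) \<in> D"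
        using False D_gen[OF s] by (cases "m = 0") auto
    qed
    then show ?thesis
      using bounded_map_fib_map[OF k] fib_map_null[OF k] by blast
  qed
qed

text \<open>A refinement that kills \<open>f k\<close> also kills \<open>g f k\<close>, and the
  latter is homotopic to \<open>k\<close>.\<close>

lemma refinable_retract:
  assumes K': "refinable X K'" and f: "bounded_map A K K' f" and g: "bounded_map A K' K g"
    and gf: "homotopic A K K (\<lambda>n. g n \<cdot> f n) (\<lambda>n. Id A (obj K n))"
  shows "refinable X K"
  unfolding refinable_def
proof (intro allI impI)
  fix M t k
  assume res: "resolution X M t" and k: "bounded_map A M K k"
  obtain M' r where r: "bounded_map A M' M r" "resolution X M' (\<lambda>n. t n \<cdot> r n)"
    and null: "homotopic A M' K' (\<lambda>n. (f n \<cdot> k n) \<cdot> r n) (\<lambda>n. Zero A (obj M' n) (obj K' n))"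
    using K' res bounded_map_comp[OF k f] unfolding refinable_def by blast
  note [simp] = chain_map_simps(1,2)[OF k] chain_map_simps(3-5)[OF k]
    chain_map_simps(1,3-5)[OF r(1)] chain_map_simps(2,3-5)[OF f] chain_map_simps(3-5)[OF g]
  note kr = bounded_map_comp[OF r(1) k]
  have "homotopic A M' K (\<lambda>n. g n \<cdot> ((f n \<cdot> k n) \<cdot> r n)) (\<lambda>n. g n \<cdot> Zero A (obj M' n) (obj K' n))"
    by (rule homotopic_comp_left[OF bounded_map_zero g null]) auto
  then have 1: "homotopic A M' K (\<lambda>n. g n \<cdot> (f n \<cdot> (k n \<cdot> r n))) (\<lambda>n. Zero A (obj M' n) (obj K n))"
    by simp
  have "homotopic A M' K (\<lambda>n. (g n \<cdot> f n) \<cdot> (k n \<cdot> r n)) (\<lambda>n. Id A (obj K n) \<cdot> (k n \<cdot> r n))"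
    by (rule homotopic_comp_right[OF kr bounded_map_id gf]) simp
  then have "homotopic A M' K (\<lambda>n. g n \<cdot> (f n \<cdot> (k n \<cdot> r n))) (\<lambda>n. k n \<cdot> r n)"
    by simp
  then have "homotopic A M' K (\<lambda>n. k n \<cdot> r n) (\<lambda>n. Zero A (obj M' n) (obj K n))"
    using homotopic_trans[OF bounded_map_zero homotopic_sym[OF kr] 1] by simp
  with r show "\<exists>M' r. bounded_map A M' M r \<and> resolution X M' (\<lambda>n. t n \<cdot> r n) \<and>
        homotopic A M' K (\<lambda>n. k n \<cdot> r n) (\<lambda>n. Zero A (obj M' n) (obj K n))" by blast
qed

lemma refinable_equivalence:
  assumes "refinable X K'" "homotopy_equivalence A K K' f g"
  shows "refinable X K"
  using refinable_retract[OF assms(1)] assms(2) unfolding homotopy_equivalence_def by blast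

text \<open>Two successive refinements. The first kills the component of \<open>k\<close> in the
  shift of \<open>K\<close>, after which \<open>k r\<close> factors up to homotopy through a map
  \<open>y\<close> to \<open>L\<close>; the second kills \<open>y\<close>.\<close>

lemma refinable_cone:
  assumes K: "refinable X (shift_complex A K)" and L: "refinable X L" and f: "bounded_map A K L f"
  shows "refinable X (cone A K L f)"
  unfolding refinable_def
proof (intro allI impI)
  fix M t k
  let ?C = "cone A K L f"
  let ?i = "\<lambda>n. in2 A (obj K (n + 1)) (obj L n)" and ?p = "\<lambda>n. pr1 A (obj K (n + 1)) (obj L n)"
  assume res: "resolution X M t" and k: "bounded_map A M ?C k"
  have i: "bounded_map A L ?C ?i" by (rule bounded_map_cone_in2[OF f])
  have p: "bounded_map A ?C (shift_complex A K) ?p" by (rule bounded_map_cone_pr1[OF f])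
  obtain M' r where r: "bounded_map A M' M r" "resolution X M' (\<lambda>n. t n \<cdot> r n)"
    and null: "homotopic A M' (shift_complex A K) (\<lambda>n. (?p n \<cdot> k n) \<cdot> r n)
       (\<lambda>n. Zero A (obj M' n) (obj (shift_complex A K) n))"
    using K res bounded_map_comp[OF k p] unfolding refinable_def by blast
  note [simp] = chain_map_simps(1-5)[OF f] chain_map_simps(3-4)[OF k]
    chain_map_simps(1-5)[OF r(1)] bounded_cone[OF f]
  have [simp]: "Cod A (k n) = sum_ob A (obj K (n + 1)) (obj L n)" for n
    using chain_map_simps(5)[OF k] by simp
  note kr = bounded_map_comp[OF r(1) k]
  obtain y where y: "bounded_map A M' L y" "homotopic A M' ?C (\<lambda>n. k n \<cdot> r n) (\<lambda>n. ?i n \<cdot> y n)"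
    using cone_exact_middle[OF f kr] null by auto
  obtain M'' r' where r': "bounded_map A M'' M' r'" "resolution X M'' (\<lambda>n. (t n \<cdot> r n) \<cdot> r' n)"
    and null': "homotopic A M'' L (\<lambda>n. y n \<cdot> r' n) (\<lambda>n. Zero A (obj M'' n) (obj L n))"
    using L r(2) y(1) unfolding refinable_def by blast
  note [simp] = chain_map_simps(1-5)[OF r'(1)] chain_map_simps(3-5)[OF y(1)]
  have t: "bounded_map A M (conc_ob A X) t" using res by (simp add: resolution_def)
  note [simp] = chain_map_simps(3-5)[OF t]
  have "homotopic A M'' ?C (\<lambda>n. ?i n \<cdot> (y n \<cdot> r' n)) (\<lambda>n. ?i n \<cdot> Zero A (obj M'' n) (obj L n))"
    by (rule homotopic_comp_left[OF bounded_map_zero i null']) auto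
  then have 1: "homotopic A M'' ?C (\<lambda>n. ?i n \<cdot> (y n \<cdot> r' n)) (\<lambda>n. Zero A (obj M'' n) (obj ?C n))"
    by simp
  have "homotopic A M'' ?C (\<lambda>n. (k n \<cdot> r n) \<cdot> r' n) (\<lambda>n. (?i n \<cdot> y n) \<cdot> r' n)"
    by (rule homotopic_comp_right[OF r'(1) bounded_map_comp[OF y(1) i] y(2)])
  then have 2: "homotopic A M'' ?C (\<lambda>n. k n \<cdot> (r n \<cdot> r' n)) (\<lambda>n. ?i n \<cdot> (y n \<cdot> r' n))"
    by simp
  have 3: "homotopic A M'' ?C (\<lambda>n. k n \<cdot> (r n \<cdot> r' n)) (\<lambda>n. Zero A (obj M'' n) (obj ?C n))"
    by (rule homotopic_trans[OF bounded_map_zero 2 1]) auto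
  show "\<exists>M' r. bounded_map A M' M r \<and> resolution X M' (\<lambda>n. t n \<cdot> r n) \<and>
        homotopic A M' ?C (\<lambda>n. k n \<cdot> r n) (\<lambda>n. Zero A (obj M' n) (obj ?C n))"
    by (intro exI[of _ M''] exI[of _ "\<lambda>n. r n \<cdot> r' n"] conjI)
      (use bounded_map_comp[OF r'(1) r(1)] r'(2) 3 in auto)
qed

section \<open>The triangulated subcategory of strongly refinable complexes\<close>

lemma homotopy_equivalence_reindex:
  assumes "homotopy_equivalence A K L f g"
  shows "homotopy_equivalence A (reindex m K) (reindex m L) (\<lambda>n. f (n + m)) (\<lambda>n. g (n + m))"
  using assms bounded_map_reindex homotopic_reindex[of K K "\<lambda>n. g n \<cdot> f n" "\<lambda>n. Id A (obj K n)" m]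
    homotopic_reindex[of L L "\<lambda>n. f n \<cdot> g n" "\<lambda>n. Id A (obj L n)" m]
  unfolding homotopy_equivalence_def by simp

lemma isomorphicE:
  assumes "u \<in> Hom (Kb A) K L" "iso_arrow (Kb A) u"
  obtains f g where "homotopy_equivalence A K L f g"
  using Kb_iso_arrowE[OF assms] by metis

text \<open>Refinability refers to the fixed degrees of a resolution. Demanding it of all translates
  builds in closure under the shift in both directions.\<close>

definition strongly_refinable :: "'o \<Rightarrow> ('o, 'a) complex set" where
  "strongly_refinable X = {K. bounded_complex A K \<and> (\<forall>m. refinable X (reindex m K))}"

lemma strongly_refinable_equivalence:
  assumes "K \<in> strongly_refinable X" "homotopy_equivalence A K L f g"
  shows "L \<in> strongly_refinable X"
proof -
  have "bounded_complex A L" using assms(2) chain_map_simps(2) unfolding homotopy_equivalence_def by blast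
  moreover have "refinable X (reindex m L)" for m
    using refinable_equivalence[OF _ homotopy_equivalence_reindex[OF homotopy_equivalence_sym[OF assms(2)]]]
      assms(1) by (auto simp: strongly_refinable_def)
  ultimately show ?thesis by (simp add: strongly_refinable_def)
qed

lemma shift_reindex: "shift_complex A (reindex m K) = reindex m (shift_complex A K)"
  by (rule complex.equality) (auto simp: fun_eq_iff reindex_def shift_complex_def algebra_simps)

lemma refinable_shift_iff:
  assumes "bounded_complex A K"
  shows "refinable X (shift_complex A K) \<longleftrightarrow> refinable X (reindex 1 K)"
  using shift_reindex_equivalence[OF assms] refinable_equivalence homotopy_equivalence_sym by blast

lemma strongly_refinable_shift:
  assumes K: "bounded_complex A K"
  shows "shift_complex A K \<in> strongly_refinable X \<longleftrightarrow> K \<in> strongly_refinable X"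
proof -
  have "(\<forall>m. refinable X (reindex m (shift_complex A K))) \<longleftrightarrow> (\<forall>m. refinable X (reindex (m + 1) K))"
    using refinable_shift_iff[OF bounded_reindex[OF K]] by (simp add: shift_reindex add.commute)
  also have "\<dots> \<longleftrightarrow> (\<forall>m. refinable X (reindex m K))"
    by (metis diff_add_cancel)
  finally show ?thesis using K by (simp add: strongly_refinable_def)
qed

lemma strongly_refinable_cone:
  assumes K: "K \<in> strongly_refinable X" and L: "L \<in> strongly_refinable X" and f: "bounded_map A K L f"
  shows "cone A K L f \<in> strongly_refinable X"
proof -
  have "shift_complex A K \<in> strongly_refinable X"
    using strongly_refinable_shift K by (simp add: strongly_refinable_def)
  then have "refinable X (reindex m (cone A K L f))" for m
    unfolding reindex_cone
    by (intro refinable_cone bounded_map_reindex f) (use L in \<open>auto simp: strongly_refinable_def shift_reindex\<close>)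
  then show ?thesis using bounded_cone[OF f] by (simp add: strongly_refinable_def)
qed

lemma strongly_refinable_zero:
  assumes Z: "zero_object (Kb A) Z"
  shows "Z \<in> strongly_refinable X"
proof -
  note c = Kb_zero_object_contractible[OF Z]
  have "refinable X (reindex m Z)" for m
  proof -
    have "homotopic A (reindex m Z) (reindex m Z) (\<lambda>n. Id A (obj (reindex m Z) n))
      (\<lambda>n. Zero A (obj (reindex m Z) n) (obj (reindex m Z) n))"
      using homotopic_reindex[OF c(2)] by simp
    then show ?thesis
      using refinable_null homotopic_zero_if_contractible(1)[OF bounded_reindex[OF c(1)]]
      unfolding refinable_def by blast
  qed
  then show ?thesis using c by (simp add: strongly_refinable_def)
qed

lemma strongly_refinable_iso:
  assumes "u \<in> Hom (Kb A) K L" "iso_arrow (Kb A) u"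
  shows "K \<in> strongly_refinable X \<longleftrightarrow> L \<in> strongly_refinable X"
proof -
  obtain f g where "homotopy_equivalence A K L f g" by (rule isomorphicE[OF assms])
  then show ?thesis using strongly_refinable_equivalence homotopy_equivalence_sym by blast
qed

lemma triangulated_strongly_refinable: "triangulated_subcategory (Kb A) (strongly_refinable X)"
  unfolding triangulated_subcategory_def
proof (intro conjI)
  show "strongly_refinable X \<subseteq> Ob (Kb A)" by (auto simp: strongly_refinable_def Kb_fields)
  show "\<forall>Z. zero_object (Kb A) Z \<longrightarrow> Z \<in> strongly_refinable X" using strongly_refinable_zero by blast
  show "\<forall>K\<in>strongly_refinable X. \<forall>L\<in>Ob (Kb A). isomorphic (Kb A) K L \<longrightarrow> L \<in> strongly_refinable X"
    unfolding isomorphic_def using strongly_refinable_iso by blast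
  show "\<forall>K\<in>Ob (Kb A). (K \<in> strongly_refinable X) = (Shift_ob (Kb A) K \<in> strongly_refinable X)"
    using strongly_refinable_shift unfolding Kb_fields(1,7) by blast
  show "\<forall>(u, v, w)\<in>Dist (Kb A). Dom (Kb A) u \<in> strongly_refinable X \<and>
      Dom (Kb A) v \<in> strongly_refinable X \<longrightarrow> Dom (Kb A) w \<in> strongly_refinable X"
  proof (clarify)
    fix u v w assume t: "(u, v, w) \<in> Dist (Kb A)" and uv: "Dom (Kb A) u \<in> strongly_refinable X"
       "Dom (Kb A) v \<in> strongly_refinable X"
    show "Dom (Kb A) w \<in> strongly_refinable X"
      \<comment> \<open>The third vertex is isomorphic to the cone of a map between complexes
        isomorphic to the first two vertices.\<close>
      by (rule DistE[OF t]) (use strongly_refinable_iso strongly_refinable_cone uv in blast)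
  qed
qed

text \<open>By minimality of \<open>D\<close>: the strongly refinable complexes are one of the
  subcategories in the intersection that defines it.\<close>

lemma D_refinable:
  assumes X: "X \<in> Ob A" and K: "K \<in> D"
  shows "refinable X K"
proof -
  have "arrow_cone A ` S \<subseteq> strongly_refinable X"
    using refinable_generator[OF X] S_arr by (auto simp: strongly_refinable_def)
  then have "K \<in> strongly_refinable X"
    using K triangulated_strongly_refinable unfolding generated_subcategory_def by blast
  then have "refinable X (reindex 0 K)" unfolding strongly_refinable_def by blast
  then show ?thesis by simp
qed

section \<open>Removing the inverted letters of a zigzag\<close>

lemma W_HomE:
  assumes "w \<in> W" "w \<in> Hom (Kb A) Z Y"
  obtains K L f a b where "bounded_map A K L f" "cone A K L f \<in> D"
    "a \<in> Hom (Kb A) Z K" "iso_arrow (Kb A) a" "b \<in> Hom (Kb A) Y L" "iso_arrow (Kb A) b"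
    "b \<cdot>\<^bsub>Kb A\<^esub> w = homotopy_class A K L f \<cdot>\<^bsub>Kb A\<^esub> a"
proof -
  obtain v x where t: "(w, v, x) \<in> Dist (Kb A)" "Dom (Kb A) x \<in> D"
    using assms(1) unfolding arrows_with_cone_in_def by blast
  show ?thesis
  proof (rule DistE[OF t(1)])
    fix K L f a b c
    assume f: "bounded_map A K L f" and w: "w \<in> Hom (Kb A) (Dom (Kb A) w) (Dom (Kb A) v)"
      and a: "a \<in> Hom (Kb A) (Dom (Kb A) w) K" "iso_arrow (Kb A) a"
      and b: "b \<in> Hom (Kb A) (Dom (Kb A) v) L" "iso_arrow (Kb A) b"
      and c: "c \<in> Hom (Kb A) (Dom (Kb A) x) (cone A K L f)" "iso_arrow (Kb A) c"
      and eq: "b \<cdot>\<^bsub>Kb A\<^esub> w = homotopy_class A K L f \<cdot>\<^bsub>Kb A\<^esub> a"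
    \<comment> \<open>An inverted arrow comes with some distinguished triangle, not necessarily a
      standard one. Since \<open>D\<close> is strict, the standard cone lies in \<open>D\<close>
      along with the given third vertex.\<close>
    obtain p q where "homotopy_equivalence A (Dom (Kb A) x) (cone A K L f) p q" by (rule isomorphicE[OF c])
    then have "cone A K L f \<in> D" using D_equivalence[OF t(2)] by blast
    moreover have "Dom (Kb A) w = Z" "Dom (Kb A) v = Y" using w assms(2) by (auto simp: Hom_iff)
    ultimately show thesis using that f a b eq by simp
  qed
qed

text \<open>The obstruction to lifting \<open>h\<close> through \<open>w\<close> is the composite of
  \<open>h\<close> to the cone of \<open>w\<close>. The cone lies in \<open>D\<close>, so the
  obstruction vanishes after a refinement, and exactness provides the lift. The isomorphisms
  \<open>a\<close> and \<open>b\<close> only translate between \<open>w\<close> and a map with a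
  standard cone.\<close>

lemma resolution_lift:
  assumes X: "X \<in> Ob A" and res: "resolution X M t" and h: "h \<in> Hom (Kb A) M Y"
    and w: "w \<in> W" "w \<in> Hom (Kb A) Z Y"
  shows "\<exists>M' r h'. bounded_map A M' M r \<and> resolution X M' (\<lambda>n. t n \<cdot> r n)
    \<and> h' \<in> Hom (Kb A) M' Z
    \<and> w \<cdot>\<^bsub>Kb A\<^esub> h' = h \<cdot>\<^bsub>Kb A\<^esub> homotopy_class A M' M r"
proof (rule W_HomE[OF w])
  fix K L f a b
  assume f: "bounded_map A K L f" and D: "cone A K L f \<in> D"
    and a: "a \<in> Hom (Kb A) Z K" "iso_arrow (Kb A) a"
    and b: "b \<in> Hom (Kb A) Y L" "iso_arrow (Kb A) b"
    and eq: "b \<cdot>\<^bsub>Kb A\<^esub> w = homotopy_class A K L f \<cdot>\<^bsub>Kb A\<^esub> a"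
  let ?c = "\<lambda>u v. u \<cdot>\<^bsub>Kb A\<^esub> v"
  have bh: "?c b h \<in> Hom (Kb A) M L" using h b by (simp add: Hom_iff)
  obtain k where k: "bounded_map A M L k" "?c b h = homotopy_class A M L k" by (rule Kb_HomE[OF bh])
  have i: "bounded_map A L (cone A K L f) (\<lambda>n. in2 A (obj K (n + 1)) (obj L n))"
    by (rule bounded_map_cone_in2[OF f])
  obtain M' r where r: "bounded_map A M' M r" "resolution X M' (\<lambda>n. t n \<cdot> r n)"
    and null: "homotopic A M' (cone A K L f) (\<lambda>n. (in2 A (obj K (n + 1)) (obj L n) \<cdot> k n) \<cdot> r n)
      (\<lambda>n. Zero A (obj M' n) (obj (cone A K L f) n))"
    using D_refinable[OF X D] res bounded_map_comp[OF k(1) i] unfolding refinable_def by blast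
  note kr = bounded_map_comp[OF r(1) k(1)]
  note [simp] = chain_map_simps(1-5)[OF f] chain_map_simps(1-5)[OF k(1)] chain_map_simps(1-5)[OF r(1)]
  obtain x where x: "bounded_map A M' K x" "homotopic A M' L (\<lambda>n. k n \<cdot> r n) (\<lambda>n. f n \<cdot> x n)"
    using cone_exact_source[OF f kr] null by auto
  have kx: "homotopy_class A M' L (\<lambda>n. k n \<cdot> r n) = homotopy_class A M' L (\<lambda>n. f n \<cdot> x n)"
    by (rule homotopy_class_eqI[OF kr bounded_map_comp[OF x(1) f] x(2)])
  obtain a' where a': "a' \<in> Hom (Kb A) K Z" "?c a a' = Id (Kb A) K"
    using a unfolding iso_arrow_def inverse_arrows_def by (auto simp: Hom_iff)
  obtain b' where b': "b' \<in> Hom (Kb A) L Y" "?c b' b = Id (Kb A) Y"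
    using b unfolding iso_arrow_def inverse_arrows_def by (auto simp: Hom_iff)
  let ?r = "homotopy_class A M' M r" and ?x = "homotopy_class A M' K x" and ?f = "homotopy_class A K L f"
  have m: "?r \<in> Hom (Kb A) M' M" "?x \<in> Hom (Kb A) M' K" "?f \<in> Hom (Kb A) K L"
    using r x f homotopy_class_Hom by blast+
  note [simp] = m[unfolded Hom_iff] a(1)[unfolded Hom_iff] b(1)[unfolded Hom_iff]
    a'(1)[unfolded Hom_iff] b'(1)[unfolded Hom_iff] h[unfolded Hom_iff] w(2)[unfolded Hom_iff]
  have h': "?c a' ?x \<in> Hom (Kb A) M' Z" by (simp add: Hom_iff)
  have "?c b (?c w (?c a' ?x)) = ?c (?c b w) (?c a' ?x)" by simp
  also have "\<dots> = ?c ?f (?c (?c a a') ?x)" unfolding eq by simp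
  also have "\<dots> = ?c (?c b h) ?r" using a'(2) kx k r x f by simp
  finally have "?c b (?c w (?c a' ?x)) = ?c b (?c h ?r)" by simp
  \<comment> \<open>The left inverse \<open>b'\<close> removes the identification of
    \<open>Y\<close> with \<open>L\<close>.\<close>
  then have "?c (?c b' b) (?c w (?c a' ?x)) = ?c (?c b' b) (?c h ?r)" by (simp del: b')
  then have "?c w (?c a' ?x) = ?c h ?r" unfolding b'(2) by simp
  with h' r show ?thesis by blast
qed

text \<open>The zigzag is consumed from its start: a forward letter is composed with
  \<open>h\<close>, and an inverted letter is removed by lifting \<open>h\<close> through it after a
  refinement. Hence \<open>M\<close>, \<open>t\<close> and \<open>h\<close> vary in the
  induction.\<close>

lemma zigzag_resolution:
  assumes X: "X \<in> Ob A" and p: "zigzag (Kb A) W Y Z p"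
    and res: "resolution X M t" and h: "h \<in> Hom (Kb A) M Y"
  shows "\<exists>M' r h'. bounded_map A M' M r \<and> resolution X M' (\<lambda>n. t n \<cdot> r n)
    \<and> h' \<in> Hom (Kb A) M' Z
    \<and> zz_eq (Kb A) W M' Z (Fwd (homotopy_class A M' M r) # Fwd h # p) [Fwd h']"
  using p res h
proof (induction arbitrary: M t h rule: zigzag.induct)
  case (zz_nil Y)
  have t: "bounded_map A M (conc_ob A X) t" using zz_nil by (simp add: resolution_def)
  have M: "bounded_complex A M" using chain_map_simps[OF t] by simp
  have "zz_eq (Kb A) W M Y (Fwd (Id (Kb A) M) # [Fwd h]) [Fwd h]"
    by (rule Kb.zz_Fwd_Id[OF Kb.zigzag_Fwd[OF zz_nil(3)]]) (simp add: Kb_fields M)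
  then show ?case
    using resolution_comp_id[OF zz_nil(2)] bounded_map_id[OF M] zz_nil(3) unfolding Kb_Id by blast
next
  case (zz_fwd g Y Y' Z p)
  have "g \<cdot>\<^bsub>Kb A\<^esub> h \<in> Hom (Kb A) M Y'" using zz_fwd.hyps zz_fwd.prems by (simp add: Hom_iff)
  from zz_fwd.IH[OF zz_fwd.prems(1) this]
  obtain M' r h' where r: "bounded_map A M' M r" "resolution X M' (\<lambda>n. t n \<cdot> r n)"
    "h' \<in> Hom (Kb A) M' Z"
    "zz_eq (Kb A) W M' Z (Fwd (homotopy_class A M' M r) # Fwd (g \<cdot>\<^bsub>Kb A\<^esub> h) # p) [Fwd h']" by blast
  have "zz_eq (Kb A) W M' Z (Fwd (homotopy_class A M' M r) # Fwd h # Fwd g # p)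
      (Fwd (homotopy_class A M' M r) # Fwd (g \<cdot>\<^bsub>Kb A\<^esub> h) # p)"
    by (rule Kb.zz_Fwd_cong[OF homotopy_class_Hom[OF r(1)] Kb.zz_Fwd_comp[OF zz_fwd.prems(2) zz_fwd.hyps]])
  from zz_trans[OF this r(4)] show ?case using r by blast
next
  case (zz_bwd w Y' Y Z p)
  from resolution_lift[OF X zz_bwd.prems zz_bwd.hyps(1,2)]
  obtain M' r h1 where r: "bounded_map A M' M r" "resolution X M' (\<lambda>n. t n \<cdot> r n)"
    "h1 \<in> Hom (Kb A) M' Y'" and eq: "w \<cdot>\<^bsub>Kb A\<^esub> h1 = h \<cdot>\<^bsub>Kb A\<^esub> homotopy_class A M' M r" by blast
  from zz_bwd.IH[OF r(2,3)]
  obtain M'' r' h' where r': "bounded_map A M'' M' r'" "resolution X M'' (\<lambda>n. (t n \<cdot> r n) \<cdot> r' n)"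
    "h' \<in> Hom (Kb A) M'' Z"
    "zz_eq (Kb A) W M'' Z (Fwd (homotopy_class A M'' M' r') # Fwd h1 # p) [Fwd h']" by blast
  let ?r = "homotopy_class A M' M r" and ?r' = "homotopy_class A M'' M' r'"
  note rh = homotopy_class_Hom[OF r(1)] and rh' = homotopy_class_Hom[OF r'(1)]
  note q = zigzag.zz_bwd[OF zz_bwd.hyps(1-3)]
  \<comment> \<open>By the lifting equation \<open>h \<cdot> r\<close> equals
    \<open>w \<cdot> h1\<close>, and the letter \<open>Fwd w\<close> that this produces cancels
    against \<open>Bwd w\<close>.\<close>
  have 1: "zz_eq (Kb A) W M' Z (Fwd ?r # Fwd h # Bwd w # p) (Fwd h1 # p)"
  proof -
    have "zz_eq (Kb A) W M' Z (Fwd ?r # Fwd h # Bwd w # p) (Fwd (h \<cdot>\<^bsub>Kb A\<^esub> ?r) # Bwd w # p)"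
      by (rule Kb.zz_Fwd_comp[OF rh zz_bwd.prems(2) q])
    also have "zz_eq (Kb A) W M' Z (Fwd (h \<cdot>\<^bsub>Kb A\<^esub> ?r) # Bwd w # p) (Fwd h1 # Fwd w # Bwd w # p)"
      unfolding eq[symmetric] by (rule zz_sym, rule Kb.zz_Fwd_comp[OF r(3) zz_bwd.hyps(2) q])
    also have "zz_eq (Kb A) W M' Z (Fwd h1 # Fwd w # Bwd w # p) (Fwd h1 # p)"
      by (rule Kb.zz_Fwd_cong[OF r(3) Kb.zz_Fwd_Bwd[OF zz_bwd.hyps(2,1,3)]])
    finally show ?thesis .
  qed
  have hq: "zigzag (Kb A) W M Z (Fwd h # Bwd w # p)" by (rule zigzag.zz_fwd[OF zz_bwd.prems(2) q])
  have "zz_eq (Kb A) W M'' Z (Fwd (?r \<cdot>\<^bsub>Kb A\<^esub> ?r') # Fwd h # Bwd w # p)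
      (Fwd ?r' # Fwd ?r # Fwd h # Bwd w # p)"
    by (rule zz_sym, rule Kb.zz_Fwd_comp[OF rh' rh hq])
  also have "zz_eq (Kb A) W M'' Z (Fwd ?r' # Fwd ?r # Fwd h # Bwd w # p) (Fwd ?r' # Fwd h1 # p)"
    by (rule Kb.zz_Fwd_cong[OF rh' 1])
  also note r'(4)
  finally have 2: "zz_eq (Kb A) W M'' Z (Fwd (homotopy_class A M'' M (\<lambda>n. r n \<cdot> r' n)) # Fwd h # Bwd w # p) [Fwd h']"
    using r(1) r'(1) by simp
  have t: "bounded_map A M (conc_ob A X) t" using zz_bwd.prems by (simp add: resolution_def)
  \<comment> \<open>\<open>resolution\<close> speaks of a family of arrows and not of its homotopy
    class, so the two bracketings have to agree as functions.\<close>
  have "(\<lambda>n. (t n \<cdot> r n) \<cdot> r' n) = (\<lambda>n. t n \<cdot> (r n \<cdot> r' n))"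
    by (simp add: chain_map_simps(3-5)[OF t] chain_map_simps(3-5)[OF r(1)] chain_map_simps(3-5)[OF r'(1)])
  then show ?case using r' 2 bounded_map_comp[OF r'(1) r(1)] by (intro exI[of _ M''] exI conjI) auto
qed

section \<open>From a resolution to a fraction of morphisms of \<open>A\<close>\<close>

lemma conc_arr_class:
  assumes "f \<in> Hom A X Y"
  shows "conc_arr A f = homotopy_class A (conc_ob A X) (conc_ob A Y) (conc_map A f)"
  using assms unfolding conc_arr_def conc_map_def by (auto simp: Hom_iff)

lemma conc_arr_Hom: "f \<in> Hom A X Y \<Longrightarrow> conc_arr A f \<in> Hom (Kb A) (conc_ob A X) (conc_ob A Y)"
  using homotopy_class_Hom[OF bounded_map_conc] by (simp add: conc_arr_class)

lemma conc_arr_W: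
  assumes s: "s \<in> Hom A X Y" "arrow_cone A s \<in> D"
  shows "conc_arr A s \<in> W"
proof -
  obtain f g where "homotopy_equivalence A (arrow_cone A s) (cone A (conc_ob A X) (conc_ob A Y) (conc_map A s)) f g"
    using cone_conc_equivalence[OF s(1)] by blast
  then show ?thesis
    using W_I[OF bounded_map_conc[OF s(1)]] D_equivalence[OF s(2)] by (auto simp: conc_arr_class[OF s(1)])
qed

definition trunc_map :: "('o, 'a) complex \<Rightarrow> int \<Rightarrow> 'a" where
  "trunc_map M n = (if n = 0 then Id A (obj M 0) else Zero A (obj M n) (zero_ob A))"

text \<open>The critical square is the one from degree -1 to degree 0: the identity in degree 0
  would have to annihilate the incoming differential, which is zero because \<open>M\<close>
  vanishes in degree -1.\<close>

lemma trunc_map: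
  assumes M [simp]: "bounded_complex A M" and neg: "\<And>n. n < 0 \<Longrightarrow> zero_object A (obj M n)"
  shows "bounded_map A M (conc_ob A (obj M 0)) (trunc_map M)"
proof -
  have [simp]: "trunc_map M n \<in> Arr A" "Dom A (trunc_map M n) = obj M n"
    "Cod A (trunc_map M n) = obj (conc_ob A (obj M 0)) n" for n
    by (auto simp: trunc_map_def)
  show ?thesis
  proof (rule bounded_mapI)
    show "diff (conc_ob A (obj M 0)) n \<cdot> trunc_map M n = trunc_map M (n + 1) \<cdot> diff M n" for n
      by (cases "n < 0"; rule arr_zero_ob_eq) (use neg[of n] in auto)
  qed auto
qed

text \<open>All components other than \<open>f 0\<close> end in a zero object, so the factorisation
  holds already for chain maps, before passing to homotopy classes.\<close>

lemma Hom_to_conc_factor: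
  assumes M: "bounded_complex A M" "\<And>n. n < 0 \<Longrightarrow> zero_object A (obj M n)"
    and h: "h \<in> Hom (Kb A) M (conc_ob A Y)" and Y: "Y \<in> Ob A"
  shows "\<exists>g \<in> Hom A (obj M 0) Y. h = conc_arr A g \<cdot>\<^bsub>Kb A\<^esub> homotopy_class A M (conc_ob A (obj M 0)) (trunc_map M)"
proof -
  obtain f where f: "bounded_map A M (conc_ob A Y) f" "h = homotopy_class A M (conc_ob A Y) f" by (rule Kb_HomE[OF h])
  note [simp] = chain_map_simps(3-5)[OF f(1)]
  have Cf: "Cod A (f 0) = Y" by simp
  have g: "f 0 \<in> Hom A (obj M 0) Y" by (simp add: Hom_iff)
  have "conc_map A (f 0) n \<cdot> trunc_map M n = f n" for n
    by (cases "n = 0") (auto simp: conc_map_def trunc_map_def M(1) intro!: arr_zero_ob_eq)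
  then have "homotopy_class A (conc_ob A (obj M 0)) (conc_ob A Y) (conc_map A (f 0)) \<cdot>\<^bsub>Kb A\<^esub>
     homotopy_class A M (conc_ob A (obj M 0)) (trunc_map M) = h"
    using homotopy_class_comp[OF trunc_map[OF M] bounded_map_conc[OF g]] f(2) by simp
  then show ?thesis using g by (intro bexI[of _ "f 0"]) (simp_all add: conc_arr_class[OF g])
qed

lemma resolution_square:
  assumes X [simp]: "X \<in> Ob A" and t: "bounded_map A M (conc_ob A X) t"
    and neg: "\<And>n. n < 0 \<Longrightarrow> zero_object A (obj M n)"
    and T [simp]: "T \<in> Ob A" and c: "c \<in> Hom A (obj M 1) T"
    and s: "s = (in1 A X T \<cdot> t 0) \<boxplus> (in2 A X T \<cdot> (c \<cdot> diff M 0))"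
  shows "conc_arr A s \<cdot>\<^bsub>Kb A\<^esub> homotopy_class A M (conc_ob A (obj M 0)) (trunc_map M)
    = conc_arr A (in1 A X T) \<cdot>\<^bsub>Kb A\<^esub> homotopy_class A M (conc_ob A X) t"
proof -
  note [simp] = chain_map_simps(1,3-5)[OF t]
  have [simp]: "Cod A (t 0) = X" "Cod A (diff M 0) = obj M 1" by simp_all
  have [simp]: "c \<in> Arr A" "Dom A c = obj M 1" "Cod A c = T" using c by (auto simp: Hom_iff)
  have sH: "s \<in> Hom A (obj M 0) (sum_ob A X T)" by (simp add: s Hom_iff)
  then have [simp]: "s \<in> Arr A" "Dom A s = obj M 0" "Cod A s = sum_ob A X T" by (auto simp: Hom_iff)
  have iH: "in1 A X T \<in> Hom A X (sum_ob A X T)" by (simp add: Hom_iff)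
  let ?S = "conc_ob A (sum_ob A X T)"
  have M: "bounded_complex A M" by simp
  note q = trunc_map[OF M neg]
  note m1 = bounded_map_comp[OF q bounded_map_conc[OF sH]]
  note m2 = bounded_map_comp[OF t bounded_map_conc[OF iH]]
  note [simp] = chain_map_simps(3-5)[OF m1] chain_map_simps(3-5)[OF m2]
  \<comment> \<open>The component \<open>h 1\<close> goes from \<open>obj M 1\<close> to degree 0 of
    the target. In degree 0 its composite with \<open>diff M 0\<close> is exactly the second summand
    of \<open>s\<close>, by which \<open>s\<close> differs from
    \<open>in1 A X T \<cdot> t 0\<close>.\<close>
  define h where "h n = (if n = 1 then in2 A X T \<cdot> c else Zero A (obj M n) (obj ?S (n - 1)))" for n
  have [simp]: "h n \<in> Arr A" "Dom A (h n) = obj M n" "Cod A (h n) = obj ?S (n - 1)" for n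
    by (auto simp: h_def)
  have "homotopic A M ?S (\<lambda>n. conc_map A s n \<cdot> trunc_map M n) (\<lambda>n. conc_map A (in1 A X T) n \<cdot> t n)"
  proof (rule homotopicI[where h = h], goal_cases)
    case (4 n)
    show ?case
    proof (cases "n = 0")
      case True
      then show ?thesis by (simp add: h_def conc_map_def trunc_map_def conc_ob_diff) (simp add: s)
    next
      case False
      then show ?thesis by (intro arr_zero_ob_eq) auto
    qed
  qed auto
  then show ?thesis
    using homotopy_class_eqI[OF m1 m2] homotopy_class_comp[OF q bounded_map_conc[OF sH]]
      homotopy_class_comp[OF t bounded_map_conc[OF iH]]
    by (simp add: conc_arr_class[OF sH] conc_arr_class[OF iH])
qed

lemma verdier_map_conc_arr:
  assumes "g \<in> Hom A X Y"
  shows "verdier_map (Kb A) D (conc_arr A g) = loc_class (Kb A) W (conc_ob A X) (conc_ob A Y) [Fwd (conc_arr A g)]"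
  using conc_arr_Hom[OF assms] by (simp add: verdier_map_def loc_map_def Hom_iff)

lemma fraction_presentation:
  assumes X: "X \<in> Ob A" and Y: "Y \<in> Ob A"
    and f: "f \<in> Hom (verdier_quotient (Kb A) D) (conc_ob A X) (conc_ob A Y)"
  shows "\<exists>X'' \<in> Ob A. \<exists>T \<in> Ob A. \<exists>g \<in> Hom A X'' Y. \<exists>s \<in> Hom A X'' (sum_ob A X T). \<exists>s_inv.
     arrow_cone A s \<in> D
     \<and> inverse_arrows (verdier_quotient (Kb A) D) (verdier_map (Kb A) D (conc_arr A s)) s_inv
     \<and> f = verdier_map (Kb A) D (conc_arr A g) \<cdot>\<^bsub>verdier_quotient (Kb A) D\<^esub>
         (s_inv \<cdot>\<^bsub>verdier_quotient (Kb A) D\<^esub> verdier_map (Kb A) D (conc_arr A (in1 A X T)))"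
proof -
  let ?c = "\<lambda>u v. u \<cdot>\<^bsub>Kb A\<^esub> v"
  obtain p where p: "zigzag (Kb A) W (conc_ob A X) (conc_ob A Y) p"
    "f = loc_class (Kb A) W (conc_ob A X) (conc_ob A Y) p"
    using f unfolding verdier_quotient_def by (rule localization_HomE)
  have Xob: "conc_ob A X \<in> Ob (Kb A)" using X by (simp add: Kb_fields)
  obtain M r h where r: "bounded_map A M (conc_ob A X) r"
    and res: "resolution X M (\<lambda>n. Id A (obj (conc_ob A X) n) \<cdot> r n)"
    and h: "h \<in> Hom (Kb A) M (conc_ob A Y)"
    and eq: "zz_eq (Kb A) W M (conc_ob A Y)
       (Fwd (homotopy_class A M (conc_ob A X) r) # Fwd (Id (Kb A) (conc_ob A X)) # p) [Fwd h]"
    \<comment> \<open>The process starts from the trivial resolution of \<open>X\<close> by itself,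
      with the identity as the arrow to the start of the zigzag.\<close>
    using zigzag_resolution[OF X p(1) resolution_id[OF X] Kb.id_hom[OF Xob]] by blast
  have "(\<lambda>n. Id A (obj (conc_ob A X) n) \<cdot> r n) = r" using chain_map_simps(3-5)[OF r] by auto
  with res have res: "resolution X M r" by simp
  let ?t = "homotopy_class A M (conc_ob A X) r"
  have M: "bounded_complex A M" using chain_map_simps[OF r] by simp
  have neg: "\<And>n. n < 0 \<Longrightarrow> zero_object A (obj M n)" using res by (auto simp: resolution_def)
  obtain T c where T: "T \<in> Ob A" "c \<in> Hom A (obj M 1) T"
    "arrow_cone A ((in1 A X T \<cdot> r 0) \<boxplus> (in2 A X T \<cdot> (c \<cdot> diff M 0))) \<in> D"
    using res by (auto simp: resolution_def)
  define s where "s = (in1 A X T \<cdot> r 0) \<boxplus> (in2 A X T \<cdot> (c \<cdot> diff M 0))"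
  have sH: "s \<in> Hom A (obj M 0) (sum_ob A X T)"
  proof -
    have "Cod A (r 0) = X" "Cod A (diff M 0) = obj M 1" using chain_map_simps(5)[OF r, of 0] M by simp_all
    then show ?thesis using X T(1,2) M chain_map_simps(3-4)[OF r] by (simp add: s_def Hom_iff)
  qed
  have iH: "in1 A X T \<in> Hom A X (sum_ob A X T)" using X T by (simp add: Hom_iff)
  have sD: "arrow_cone A s \<in> D" using T by (simp add: s_def)
  let ?q = "homotopy_class A M (conc_ob A (obj M 0)) (trunc_map M)"
  obtain g where g: "g \<in> Hom A (obj M 0) Y" "h = ?c (conc_arr A g) ?q"
    using Hom_to_conc_factor[OF M neg h Y] by blast
  have sq: "?c (conc_arr A s) ?q = ?c (conc_arr A (in1 A X T)) ?t"
    by (rule resolution_square[OF X r neg T(1,2) s_def])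
  note qH = homotopy_class_Hom[OF trunc_map[OF M neg]] and tH = homotopy_class_Hom[OF r]
  note gK = conc_arr_Hom[OF g(1)] and sK = conc_arr_Hom[OF sH] and iK = conc_arr_Hom[OF iH]
  note sW = conc_arr_W[OF sH sD]
  let ?M0 = "conc_ob A (obj M 0)" and ?S = "conc_ob A (sum_ob A X T)"
  note zg = Kb.zigzag_Fwd[OF gK, of W] and zs = Kb.zigzag_Fwd[OF sK, of W]
    and zi = Kb.zigzag_Fwd[OF iK, of W] and zb = Kb.zigzag_Bwd[OF sK sW]
  have zsg: "zigzag (Kb A) W ?M0 (conc_ob A Y) (Fwd (conc_arr A s) # Bwd (conc_arr A s) # [Fwd (conc_arr A g)])"
    by (rule zz_fwd[OF sK zz_bwd[OF sW sK zg]])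
  \<comment> \<open>In the order of traversal: \<open>h\<close> is \<open>?q\<close> followed by
    \<open>g\<close>; inserting \<open>s\<close> and its formal inverse after \<open>?q\<close> and
    applying the square \<open>sq\<close> exchanges \<open>?q\<close>, \<open>s\<close> for
    \<open>?t\<close>, \<open>in1 A X T\<close>.\<close>
  have "zz_eq (Kb A) W M (conc_ob A Y) (Fwd ?t # p) (Fwd ?t # Fwd (Id (Kb A) (conc_ob A X)) # p)"
    by (rule Kb.zz_Fwd_cong[OF tH zz_sym[OF Kb.zz_Fwd_Id[OF p(1) Xob]]])
  also note eq
  also have "zz_eq (Kb A) W M (conc_ob A Y) [Fwd h] (Fwd ?q # [Fwd (conc_arr A g)])"
    unfolding g(2) by (rule zz_sym, rule zz_comp[OF qH gK])
  also have "zz_eq (Kb A) W M (conc_ob A Y) \<dots>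
      (Fwd ?q # Fwd (conc_arr A s) # Bwd (conc_arr A s) # [Fwd (conc_arr A g)])"
    by (rule Kb.zz_Fwd_cong[OF qH zz_sym[OF Kb.zz_Fwd_Bwd[OF sK sW zg]]])
  also have "zz_eq (Kb A) W M (conc_ob A Y) \<dots>
      (Fwd (?c (conc_arr A s) ?q) # Bwd (conc_arr A s) # [Fwd (conc_arr A g)])"
    by (rule Kb.zz_Fwd_comp[OF qH sK zz_bwd[OF sW sK zg]])
  also have "zz_eq (Kb A) W M (conc_ob A Y) \<dots>
      (Fwd ?t # Fwd (conc_arr A (in1 A X T)) # Bwd (conc_arr A s) # [Fwd (conc_arr A g)])"
    unfolding sq by (rule zz_sym, rule Kb.zz_Fwd_comp[OF tH iK zz_bwd[OF sW sK zg]])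
  finally have "zz_eq (Kb A) W M (conc_ob A Y) (Fwd ?t # p)
    (Fwd ?t # Fwd (conc_arr A (in1 A X T)) # Bwd (conc_arr A s) # [Fwd (conc_arr A g)])" .
  \<comment> \<open>Both zigzags now begin with \<open>?t\<close>, which can be cancelled.\<close>
  moreover have "loc_epi (Kb A) W ?t" using res by (simp add: resolution_def)
  ultimately have "zz_eq (Kb A) W (conc_ob A X) (conc_ob A Y) p
     (Fwd (conc_arr A (in1 A X T)) # Bwd (conc_arr A s) # [Fwd (conc_arr A g)])"
    using p(1) zz_fwd[OF iK zz_bwd[OF sW sK zg]] by (simp add: loc_epi_def)
  \<comment> \<open>The bracketing of the concatenation follows the order of composition in the
    claim, so that \<open>localization_comp\<close> applies twice.\<close>
  then have feq: "f = loc_class (Kb A) W (conc_ob A X) (conc_ob A Y)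
     (([Fwd (conc_arr A (in1 A X T))] @ [Bwd (conc_arr A s)]) @ [Fwd (conc_arr A g)])"
    using p(2) loc_class_eqI by fastforce
  define s_inv where "s_inv = loc_class (Kb A) W ?S ?M0 [Bwd (conc_arr A s)]"
  have "inverse_arrows (localization (Kb A) W) (loc_class (Kb A) W ?M0 ?S [Fwd (conc_arr A s)]) s_inv"
    unfolding inverse_arrows_def s_inv_def Hom_iff localization_dom_cod
      localization_comp[OF zs zb] localization_comp[OF zb zs]
    using localization_arr[OF zs] localization_arr[OF zb]
      loc_class_eqI[OF zz_fwd_bwd[OF sW sK]] loc_class_eqI[OF zz_bwd_fwd[OF sW sK]]
    by (simp add: localization_def)
  moreover have "f = loc_class (Kb A) W ?M0 (conc_ob A Y) [Fwd (conc_arr A g)] \<cdot>\<^bsub>localization (Kb A) W\<^esub>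
      (s_inv \<cdot>\<^bsub>localization (Kb A) W\<^esub> loc_class (Kb A) W (conc_ob A X) ?S [Fwd (conc_arr A (in1 A X T))])"
    unfolding s_inv_def localization_comp[OF zi zb] localization_comp[OF Kb.zigzag_append[OF zi zb] zg]
    by (rule feq)
  ultimately have "arrow_cone A s \<in> D
     \<and> inverse_arrows (verdier_quotient (Kb A) D) (verdier_map (Kb A) D (conc_arr A s)) s_inv
     \<and> f = verdier_map (Kb A) D (conc_arr A g) \<cdot>\<^bsub>verdier_quotient (Kb A) D\<^esub>
         (s_inv \<cdot>\<^bsub>verdier_quotient (Kb A) D\<^esub> verdier_map (Kb A) D (conc_arr A (in1 A X T)))"
    unfolding verdier_map_conc_arr[OF sH] verdier_map_conc_arr[OF g(1)] verdier_map_conc_arr[OF iH]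
    using sD by (simp add: verdier_quotient_def)
  moreover have "obj M 0 \<in> Ob A" using M by simp
  ultimately show ?thesis using T(1) g(1) sH by blast
qed

end

theorem proposition3p1p2:
  fixes A :: "('o, 'a, 'm) preadditive_category_scheme"
    and S :: "'a set"
    and X X' :: 'o
  defines "C \<equiv> Kb A"
  defines "D \<equiv> generated_subcategory C (arrow_cone A ` S)"
  defines "Q \<equiv> \<lambda>h. verdier_map C D (conc_arr A h)"
  assumes "additive_category A"
    and "S \<subseteq> Arr A"
    and "X \<in> Ob A" and "X' \<in> Ob A"
    and "f \<in> Hom (verdier_quotient C D) (conc_ob A X) (conc_ob A X')"
  shows "\<exists>X'' \<in> Ob A. \<exists>T \<in> Ob A.
           \<exists>g \<in> Hom A X'' X'. \<exists>s \<in> Hom A X'' (sum_ob A X T). \<exists>s_inv.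
             arrow_cone A s \<in> D
             \<and> inverse_arrows (verdier_quotient C D) (Q s) s_inv
             \<and> f = Q g \<cdot>\<^bsub>verdier_quotient C D\<^esub> (s_inv \<cdot>\<^bsub>verdier_quotient C D\<^esub> Q (in1 A X T))"
proof -
  interpret cone_quotient A S
    using assms(4,5) by (simp add: cone_quotient_def cone_quotient_axioms_def)
  show ?thesis
    unfolding Q_def
    by (rule fraction_presentation[OF assms(6,7,8)[unfolded D_def C_def], folded C_def, folded D_def])
qed

end
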